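(* For every constant $\Delta>0$ there exist constants $C_1\geq 1$, $c>0$ and $r\geq 0$, depending only on $\Delta$, such that the following holds. Let $P$ be a set of $n$ points and $L$ a set of $m$ lines in $\mathbb{R}^2$, with $m\le n^2/C_1$ and $n\le m^2/C_1$, and suppose that $|I(P,L)|\ge \Delta n^{2/3}m^{2/3}$. Then there exists a subset $P'\subseteq P$ with $|P'|\ge c\,n$ such that $(P',L)$ is $r$-rigid.
   Context: For a set $P$ of points and a set $L$ of lines in $\mathbb{R}^2$, $I(P,L)$ is the set of incidences, i.e. pairs $(p,\ell)\in P\times L$ with $p\in \ell$. Rigidity: let $S$ be a finite set and $T$ a finite collection of $3$-element subsets (triples) of $S$. Let $\mathcal{K}_T\subseteq(\mathbb{C}^2)^S$ be the variety of all assignments $(p_s)_{s\in S}$, $p_s\in\mathbb{C}^2$, such that whenever $\{s_1,s_2,s_3\}\in T$, the points $p_{s_1},p_{s_2},p_{s_3}$ are collinear. A point $P=(p_s)_{s\in S}\in\mathcal{K}_T$ is called $r$-rigid with respect to $T$ if every irreducible component of $\mathcal{K}_T$ passing through $P$ has dimension at most $r$. For a finite point set $P\subseteq\mathbb{R}^2\subseteq\mathbb{C}^2$ (indexed by itself) and a set $L$ of lines, let $T_L$ be the set of triples of points of $P$ that all lie on a common line of $L$; the configuration $(P,L)$ is called $r$-rigid if $P$ is $r$-rigid with respect to $T_L$. *)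

theory Defs
  imports Complex_Main
begin

text \<open>An assignment of points of C^2 to the elements of S is represented by a function
  'a => complex * complex which is extensional on S (value (0,0) outside S); the set of these
  is canonically isomorphic to (C^2)^S.\<close>

definition ext_space :: "'a set \<Rightarrow> ('a \<Rightarrow> complex \<times> complex) set" where
  "ext_space S = {x. \<forall>s. s \<notin> S \<longrightarrow> x s = (0, 0)}"

inductive poly_fun :: "'a set \<Rightarrow> (('a \<Rightarrow> complex \<times> complex) \<Rightarrow> complex) \<Rightarrow> bool"
  for S :: "'a set" where
  pf_const: "poly_fun S (\<lambda>x. c)"
| pf_fst: "s \<in> S \<Longrightarrow> poly_fun S (\<lambda>x. fst (x s))"
| pf_snd: "s \<in> S \<Longrightarrow> poly_fun S (\<lambda>x. snd (x s))"
| pf_add: "poly_fun S f \<Longrightarrow> poly_fun S g \<Longrightarrow> poly_fun S (\<lambda>x. f x + g x)"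
| pf_mult: "poly_fun S f \<Longrightarrow> poly_fun S g \<Longrightarrow> poly_fun S (\<lambda>x. f x * g x)"

definition zariski_closed :: "'a set \<Rightarrow> ('a \<Rightarrow> complex \<times> complex) set \<Rightarrow> bool" where
  "zariski_closed S A \<longleftrightarrow>
     (\<exists>F. (\<forall>f\<in>F. poly_fun S f) \<and> A = {x \<in> ext_space S. \<forall>f\<in>F. f x = 0})"

definition zariski_irreducible :: "'a set \<Rightarrow> ('a \<Rightarrow> complex \<times> complex) set \<Rightarrow> bool" where
  "zariski_irreducible S Z \<longleftrightarrow> Z \<noteq> {} \<and> Z \<subseteq> ext_space S \<and>
     (\<forall>A B. zariski_closed S A \<longrightarrow> zariski_closed S B \<longrightarrow> Z \<subseteq> A \<union> B \<longrightarrow> Z \<subseteq> A \<or> Z \<subseteq> B)"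

definition irreducible_component ::
    "'a set \<Rightarrow> ('a \<Rightarrow> complex \<times> complex) set \<Rightarrow> ('a \<Rightarrow> complex \<times> complex) set \<Rightarrow> bool" where
  "irreducible_component S V Z \<longleftrightarrow>
     Z \<subseteq> V \<and> zariski_closed S Z \<and> zariski_irreducible S Z \<and>
     (\<forall>Z'. Z \<subseteq> Z' \<and> Z' \<subseteq> V \<and> zariski_closed S Z' \<and> zariski_irreducible S Z' \<longrightarrow> Z' = Z)"

definition zariski_dim_le :: "'a set \<Rightarrow> ('a \<Rightarrow> complex \<times> complex) set \<Rightarrow> nat \<Rightarrow> bool" where
  "zariski_dim_le S Z r \<longleftrightarrow>
     (\<forall>(Ch :: nat \<Rightarrow> ('a \<Rightarrow> complex \<times> complex) set) k.
        (\<forall>i\<le>k. zariski_closed S (Ch i) \<and> zariski_irreducible S (Ch i) \<and> Ch i \<subseteq> Z) \<and>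
        (\<forall>i<k. Ch i \<subset> Ch (Suc i)) \<longrightarrow> k \<le> r)"

definition collinear3 :: "complex \<times> complex \<Rightarrow> complex \<times> complex \<Rightarrow> complex \<times> complex \<Rightarrow> bool" where
  "collinear3 p q w \<longleftrightarrow>
     (fst q - fst p) * (snd w - snd p) - (snd q - snd p) * (fst w - fst p) = 0"

definition K_var :: "'a set \<Rightarrow> 'a set set \<Rightarrow> ('a \<Rightarrow> complex \<times> complex) set" where
  "K_var S T = {x \<in> ext_space S. \<forall>a b c. {a, b, c} \<in> T \<longrightarrow> collinear3 (x a) (x b) (x c)}"

definition rigid_wrt :: "nat \<Rightarrow> 'a set \<Rightarrow> 'a set set \<Rightarrow> ('a \<Rightarrow> complex \<times> complex) \<Rightarrow> bool" where
  "rigid_wrt r S T x \<longleftrightarrow> x \<in> K_var S T \<and>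
     (\<forall>Z. irreducible_component S (K_var S T) Z \<and> x \<in> Z \<longrightarrow> zariski_dim_le S Z r)"

definition is_line :: "(real \<times> real) set \<Rightarrow> bool" where
  "is_line l \<longleftrightarrow> (\<exists>a b c. (a, b) \<noteq> (0, 0) \<and> l = {(x, y). a * x + b * y = c})"

definition incidences :: "(real \<times> real) set \<Rightarrow> (real \<times> real) set set \<Rightarrow> ((real \<times> real) \<times> (real \<times> real) set) set" where
  "incidences P L = {(p, l). p \<in> P \<and> l \<in> L \<and> p \<in> l}"

definition triples_on_lines :: "(real \<times> real) set \<Rightarrow> (real \<times> real) set set \<Rightarrow> (real \<times> real) set set" where
  "triples_on_lines P L = {t. t \<subseteq> P \<and> card t = 3 \<and> (\<exists>l\<in>L. t \<subseteq> l)}"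

text \<open>The configuration P itself, viewed as a point of (C^2)^P (indexed by itself).\<close>

definition config_point :: "(real \<times> real) set \<Rightarrow> (real \<times> real) \<Rightarrow> complex \<times> complex" where
  "config_point P s = (if s \<in> P then (complex_of_real (fst s), complex_of_real (snd s)) else (0, 0))"

definition rigid_config :: "nat \<Rightarrow> (real \<times> real) set \<Rightarrow> (real \<times> real) set set \<Rightarrow> bool" where
  "rigid_config r P L \<longleftrightarrow> rigid_wrt r P (triples_on_lines P L) (config_point P)"

end

(*
  An extremal configuration splits into about n/d clusters of about d points, where d is the average
  number of lines through a point, such that inside some cluster a positive proportion of the pairs
  of points extend to collinear triples of the cluster.  The collinearities of such a cluster form a
  block design system of linear equations on infinitesimal motions; after a suitable rescaling its
  Gram matrix is close to a multiple of the identity, so the motions of the cluster form a space of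
  bounded dimension.  A point lying on two lines, each with two points that do not move, does not
  move either.  If n <= m, the Szemeredi-Trotter bound forces the closure of the cluster under this
  rule to be a positive proportion of the points.  If m < n, the same applies to the projectively
  dual configuration: a cluster of lines spans a positive proportion of the lines, hence of the
  points.  Distinctness and non-collinearity are Zariski-open, so all this holds at a generic point
  of every component through the given configuration, and there the dimension of the component is
  at most the dimension of the space of infinitesimal motions.
*)
theory Submission
  imports Defs "HOL-Analysis.Analysis"
begin

section \<open>Tangent vectors at a generic point\<close>

text \<open>Dimension is defined by chains of irreducible closed sets, whereas linear algebra bounds
  velocity fields at one point. At a prescribed point the comparison takes the dimension theory of
  local rings; at a generic point it takes only implicit differentiation. The generic point cannot
  be chosen, so velocities are bounded at every nondegenerate complex realization.

  The rank bound is a constant times (points of the cluster / triples through each of its points)^2.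
  At most one triple is used on each line through a point, which is why a cluster must have about d
  points. In a given realization the lines through a point may be almost parallel; the diagonal
  blocks are then far from a multiple of the identity, and this is what the rescaling cures.

  With k the average number of points on a line, a cluster spans at least of the order of d^2 lines
  carrying about k points each, and k d^2 is at least of the order of m. The closure grows once this
  exceeds n, whence the two cases. The constant \<open>C1\<close> makes d and k large, which absorbs
  the linear terms of the Szemeredi-Trotter bound.\<close>

inductive poly_in :: "'i set \<Rightarrow> (('i \<Rightarrow> complex) \<Rightarrow> complex) \<Rightarrow> bool" for V :: "'i set" where
  poly_in_const: "poly_in V (\<lambda>z. c)"
| poly_in_var: "v \<in> V \<Longrightarrow> poly_in V (\<lambda>z. z v)"
| poly_in_add: "poly_in V f \<Longrightarrow> poly_in V g \<Longrightarrow> poly_in V (\<lambda>z. f z + g z)"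
| poly_in_mult: "poly_in V f \<Longrightarrow> poly_in V g \<Longrightarrow> poly_in V (\<lambda>z. f z * g z)"

lemma poly_in_mono: "poly_in V f \<Longrightarrow> V \<subseteq> W \<Longrightarrow> poly_in W f"
  by (induction rule: poly_in.induct) (auto intro: poly_in.intros)

lemma poly_in_power: "poly_in V f \<Longrightarrow> poly_in V (\<lambda>z. f z ^ n)"
  by (induction n) (auto intro: poly_in.intros)

lemma poly_in_sum: "(\<And>i. i \<in> A \<Longrightarrow> poly_in V (f i)) \<Longrightarrow> poly_in V (\<lambda>z. \<Sum>i\<in>A. f i z)"
  by (induction A rule: infinite_finite_induct) (auto intro: poly_in.intros)

lemma poly_in_diff: "poly_in V f \<Longrightarrow> poly_in V g \<Longrightarrow> poly_in V (\<lambda>z. f z - g z)"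
  using poly_in_add[OF _ poly_in_mult[OF poly_in_const[of V "-1"]], of f g] by simp

section \<open>Directional derivatives of polynomials\<close>

definition dir_deriv :: "(('i \<Rightarrow> complex) \<Rightarrow> complex) \<Rightarrow> ('i \<Rightarrow> complex) \<Rightarrow> ('i \<Rightarrow> complex) \<Rightarrow> complex" where
  "dir_deriv f z u = deriv (\<lambda>t. f (\<lambda>i. z i + t * u i)) 0"

text \<open>One vector G serves all directions u at once. Linearity of the derivative in u, and its
  dependence on the coordinates in V alone, are both read off from this formula.\<close>

lemma poly_in_gradient:
  assumes "poly_in V f" "finite V"
  shows "\<exists>G. \<forall>u. ((\<lambda>t. f (\<lambda>i. z i + t * u i)) has_field_derivative (\<Sum>v\<in>V. G v * u v)) (at 0)"
  using assms
proof (induction rule: poly_in.induct)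
  case (poly_in_const c)
  show ?case by (rule exI[of _ "\<lambda>_. 0"]) simp
next
  case (poly_in_var v)
  have "((\<lambda>t. z v + t * u v) has_field_derivative (\<Sum>w\<in>V. (if w = v then 1 else 0) * u w)) (at 0)" for u
  proof -
    have "(\<Sum>w\<in>V. (if w = v then 1 else 0) * u w) = (\<Sum>w\<in>V. if w = v then u w else 0)"
      by (intro sum.cong) auto
    also have "\<dots> = u v" using poly_in_var by simp
    finally show ?thesis by (auto intro!: derivative_eq_intros)
  qed
  then show ?case by (intro exI[of _ "\<lambda>w. if w = v then 1 else 0"] allI)
next
  case (poly_in_add f g)
  obtain F where F: "\<forall>u. ((\<lambda>t. f (\<lambda>i. z i + t * u i)) has_field_derivative (\<Sum>v\<in>V. F v * u v)) (at 0)"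
    using poly_in_add.IH(1)[OF poly_in_add.prems] by (elim exE)
  obtain G where G: "\<forall>u. ((\<lambda>t. g (\<lambda>i. z i + t * u i)) has_field_derivative (\<Sum>v\<in>V. G v * u v)) (at 0)"
    using poly_in_add.IH(2)[OF poly_in_add.prems] by (elim exE)
  show ?case
  proof (intro exI[of _ "\<lambda>v. F v + G v"] allI)
    fix u
    show "((\<lambda>t. f (\<lambda>i. z i + t * u i) + g (\<lambda>i. z i + t * u i)) has_field_derivative
      (\<Sum>v\<in>V. (F v + G v) * u v)) (at 0)"
      using DERIV_add[OF F[rule_format, of u] G[rule_format, of u]]
      by (simp only: distrib_right sum.distrib)
  qed
next
  case (poly_in_mult f g)
  obtain F where F: "\<forall>u. ((\<lambda>t. f (\<lambda>i. z i + t * u i)) has_field_derivative (\<Sum>v\<in>V. F v * u v)) (at 0)"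
    using poly_in_mult.IH(1)[OF poly_in_mult.prems] by (elim exE)
  obtain G where G: "\<forall>u. ((\<lambda>t. g (\<lambda>i. z i + t * u i)) has_field_derivative (\<Sum>v\<in>V. G v * u v)) (at 0)"
    using poly_in_mult.IH(2)[OF poly_in_mult.prems] by (elim exE)
  show ?case
  proof (intro exI[of _ "\<lambda>v. F v * g z + f z * G v"] allI)
    fix u
    show "((\<lambda>t. f (\<lambda>i. z i + t * u i) * g (\<lambda>i. z i + t * u i)) has_field_derivative
      (\<Sum>v\<in>V. (F v * g z + f z * G v) * u v)) (at 0)"
      using DERIV_mult[OF F[rule_format, of u] G[rule_format, of u]]
      by (simp add: algebra_simps sum.distrib sum_distrib_left)
  qed
qed

lemma poly_in_has_dd:
  assumes "poly_in V f" "finite V"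
  shows "((\<lambda>t. f (\<lambda>i. z i + t * u i)) has_field_derivative dir_deriv f z u) (at 0)"
proof -
  obtain G where "\<forall>u. ((\<lambda>t. f (\<lambda>i. z i + t * u i)) has_field_derivative (\<Sum>v\<in>V. G v * u v)) (at 0)"
    using poly_in_gradient[OF assms, of z] by (elim exE)
  then have "((\<lambda>t. f (\<lambda>i. z i + t * u i)) has_field_derivative (\<Sum>v\<in>V. G v * u v)) (at 0)" ..
  from this and DERIV_imp_deriv[OF this] show ?thesis unfolding dir_deriv_def by simp
qed

lemma dir_deriv_gradient:
  assumes "poly_in V f" "finite V"
  obtains G where "\<And>u. dir_deriv f z u = (\<Sum>v\<in>V. G v * u v)"
proof -
  obtain G where "\<forall>u. ((\<lambda>t. f (\<lambda>i. z i + t * u i)) has_field_derivative (\<Sum>v\<in>V. G v * u v)) (at 0)"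
    using poly_in_gradient[OF assms, of z] by (elim exE)
  then have "dir_deriv f z u = (\<Sum>v\<in>V. G v * u v)" for u
    unfolding dir_deriv_def by (intro DERIV_imp_deriv) (erule allE)
  then show ?thesis using that by blast
qed

lemma dir_deriv_cong:
  assumes "poly_in V f" "finite V" "\<And>v. v \<in> V \<Longrightarrow> u v = u' v"
  shows "dir_deriv f z u = dir_deriv f z u'"
proof -
  obtain G where G: "\<And>u. dir_deriv f z u = (\<Sum>v\<in>V. G v * u v)" using dir_deriv_gradient[OF assms(1,2)] by blast
  show ?thesis unfolding G using assms(3) by (intro sum.cong) auto
qed

lemma dir_deriv_sum_cmul:
  assumes "poly_in V f" "finite V"
  shows "dir_deriv f z (\<lambda>i. \<Sum>j\<in>J. c j * u j i) = (\<Sum>j\<in>J. c j * dir_deriv f z (u j))"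
proof -
  obtain G where G: "\<And>u. dir_deriv f z u = (\<Sum>v\<in>V. G v * u v)" using dir_deriv_gradient[OF assms] by blast
  show ?thesis unfolding G sum_distrib_left
    by (subst sum.swap) (simp add: algebra_simps)
qed

lemma dir_deriv_const: "dir_deriv (\<lambda>z. c) z u = 0"
  unfolding dir_deriv_def by simp

lemma dir_deriv_var: "dir_deriv (\<lambda>z. z v) z u = u v"
  unfolding dir_deriv_def by (intro DERIV_imp_deriv) (auto intro!: derivative_eq_intros)

lemma dir_deriv_add:
  assumes "poly_in V f" "poly_in V g" "finite V"
  shows "dir_deriv (\<lambda>z. f z + g z) z u = dir_deriv f z u + dir_deriv g z u"
  unfolding dir_deriv_def[of "\<lambda>z. f z + g z"]
  by (intro DERIV_imp_deriv DERIV_add poly_in_has_dd[OF assms(1,3)] poly_in_has_dd[OF assms(2,3)])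

lemma dir_deriv_mult:
  assumes "poly_in V f" "poly_in V g" "finite V"
  shows "dir_deriv (\<lambda>z. f z * g z) z u = dir_deriv f z u * g z + f z * dir_deriv g z u"
  unfolding dir_deriv_def[of "\<lambda>z. f z * g z"]
  using DERIV_mult[OF poly_in_has_dd[OF assms(1,3), of z u] poly_in_has_dd[OF assms(2,3), of z u]]
  by (intro DERIV_imp_deriv) (simp add: algebra_simps)

lemma dir_deriv_sum:
  assumes "\<And>i. i \<in> A \<Longrightarrow> poly_in V (f i)" "finite V"
  shows "dir_deriv (\<lambda>z. \<Sum>i\<in>A. f i z) z u = (\<Sum>i\<in>A. dir_deriv (f i) z u)"
  using assms(1)
proof (induction A rule: infinite_finite_induct)
  case (insert x F)
  have "dir_deriv (\<lambda>z. f x z + (\<Sum>i\<in>F. f i z)) z u = dir_deriv (f x) z u + dir_deriv (\<lambda>z. \<Sum>i\<in>F. f i z) z u"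
    using insert by (intro dir_deriv_add[OF _ _ assms(2)] poly_in_sum) auto
  then show ?case using insert by simp
qed (simp_all add: dir_deriv_const)

lemma dir_deriv_pow:
  assumes "poly_in V f" "finite V"
  shows "dir_deriv (\<lambda>z. f z ^ n) z u = of_nat n * f z ^ (n - 1) * dir_deriv f z u"
  unfolding dir_deriv_def[of "\<lambda>z. f z ^ n"]
  using DERIV_power[OF poly_in_has_dd[OF assms, of z u], of n]
  by (intro DERIV_imp_deriv) (simp add: algebra_simps)

section \<open>Expansion in one variable and pseudo-division\<close>

lemma poly_in_insert_expand:
  assumes "poly_in (insert v V) f"
  shows "\<exists>c N. (\<forall>e. poly_in V (c e)) \<and> (\<forall>e>N. c e = (\<lambda>_. 0)) \<and> f = (\<lambda>z. \<Sum>e\<le>N. c e z * z v ^ e)"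
  using assms
proof (induction rule: poly_in.induct)
  case (poly_in_const k)
  show ?case
    by (rule exI[of _ "\<lambda>e. if e = 0 then (\<lambda>_. k) else (\<lambda>_. 0)"], rule exI[of _ 0])
       (auto intro: poly_in.intros)
next
  case (poly_in_var w)
  show ?case
  proof (cases "w = v")
    case True
    then show ?thesis
      by (intro exI[of _ "\<lambda>e. if e = 1 then (\<lambda>_. 1) else (\<lambda>_. 0)"] exI[of _ 1])
         (auto intro: poly_in.intros)
  next
    case False
    then have "w \<in> V" using poly_in_var by simp
    then show ?thesis
      by (intro exI[of _ "\<lambda>e. if e = 0 then (\<lambda>z. z w) else (\<lambda>_. 0)"] exI[of _ 0])
         (auto intro: poly_in.intros)
  qed
next
  case (poly_in_add f g)
  then obtain c M d N where
    c: "\<forall>e. poly_in V (c e)" "\<forall>e>M. c e = (\<lambda>_. 0)" "f = (\<lambda>z. \<Sum>e\<le>M. c e z * z v ^ e)" and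
    d: "\<forall>e. poly_in V (d e)" "\<forall>e>N. d e = (\<lambda>_. 0)" "g = (\<lambda>z. \<Sum>e\<le>N. d e z * z v ^ e)" by blast
  have "f z = (\<Sum>e\<le>max M N. c e z * z v ^ e)" for z
    unfolding c(3) by (rule sum.mono_neutral_left) (use c(2) in auto)
  moreover have "g z = (\<Sum>e\<le>max M N. d e z * z v ^ e)" for z
    unfolding d(3) by (rule sum.mono_neutral_left) (use d(2) in auto)
  ultimately have "(\<lambda>z. f z + g z) = (\<lambda>z. \<Sum>e\<le>max M N. (c e z + d e z) * z v ^ e)"
    by (simp add: sum.distrib algebra_simps)
  then show ?case using c d
    by (intro exI[of _ "\<lambda>e z. c e z + d e z"] exI[of _ "max M N"]) (auto intro: poly_in.intros)
next
  case (poly_in_mult f g)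
  then obtain c M d N where
    c: "\<forall>e. poly_in V (c e)" "\<forall>e>M. c e = (\<lambda>_. 0)" "f = (\<lambda>z. \<Sum>e\<le>M. c e z * z v ^ e)" and
    d: "\<forall>e. poly_in V (d e)" "\<forall>e>N. d e = (\<lambda>_. 0)" "g = (\<lambda>z. \<Sum>e\<le>N. d e z * z v ^ e)" by blast
  have eq: "f z * g z = (\<Sum>e\<le>M+N. (\<Sum>k\<le>e. c k z * d (e - k) z) * z v ^ e)" for z
    unfolding c(3) d(3) by (rule polynomial_product) (use c d in auto)
  have "(\<Sum>k\<le>e. c k z * d (e - k) z) = 0" if "e > M + N" for e z
  proof (rule sum.neutral, safe)
    fix k assume "k \<le> e"
    show "c k z * d (e - k) z = 0"
      using c(2) d(2) that by (cases "k > M") auto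
  qed
  then show ?case using c d eq
    by (intro exI[of _ "\<lambda>e z. \<Sum>k\<le>e. c k z * d (e - k) z"] exI[of _ "M+N"])
       (auto intro!: poly_in_sum intro: poly_in.intros)
qed

text \<open>The coefficients have no inverses, so the dividend is multiplied by \<open>p n\<close>
  each time a leading term is cancelled; q counts these multiplications. The remainder again has
  coefficients in V, so that minimality of a degree can be applied to it.\<close>

lemma pseudo_division:
  assumes p: "\<And>e. poly_in V (p e)" and c: "\<And>e. poly_in V (c e)"
  shows "\<exists>q s r. poly_in (insert v V) s \<and> (\<forall>e. poly_in V (r e)) \<and>
    (\<forall>z. p n z ^ q * (\<Sum>e<N. c e z * z v ^ e) =
       (\<Sum>e\<le>n. p e z * z v ^ e) * s z + (\<Sum>e<n. r e z * z v ^ e))"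
  using c
proof (induction N arbitrary: c)
  case 0
  show ?case
    by (intro exI[of _ 0] exI[of _ "\<lambda>_. 0"] exI[of _ "\<lambda>_ _. 0"]) (auto intro: poly_in.intros)
next
  case (Suc N)
  show ?case
  proof (cases "N < n")
    case True
    have "(\<Sum>e<Suc N. c e z * z v ^ e) = (\<Sum>e<n. (if e \<le> N then c e z else 0) * z v ^ e)" for z
      by (rule sum.mono_neutral_cong_left) (use True in auto)
    moreover have "poly_in V (\<lambda>z. if e \<le> N then c e z else 0)" for e
      using Suc.prems by (cases "e \<le> N") (auto intro: poly_in.intros)
    ultimately show ?thesis
      by (intro exI[of _ 0] exI[of _ "\<lambda>_. 0"] exI[of _ "\<lambda>e z. if e \<le> N then c e z else 0"])
         (auto intro: poly_in.intros)
  next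
    case False
    then have nN: "n \<le> N" by simp
    \<comment> \<open>Coefficients of \<open>p n\<close> times the dividend minus \<open>c N\<close>
      * v^(N - n) times the divisor. The coefficient of index N is 0, so the new dividend has one
      term less.\<close>
    define c' where "c' e z = p n z * c e z - (if e + n \<ge> N then c N z * p (e + n - N) z else 0)" for e z
    have c'pol: "poly_in V (c' e)" for e
    proof (cases "e + n \<ge> N")
      case True then show ?thesis unfolding c'_def
        using Suc.prems p by (auto intro!: poly_in_diff poly_in_mult)
    next
      case False then show ?thesis unfolding c'_def
        using Suc.prems p by (auto intro!: poly_in_mult)
    qed
    obtain q s r where IH: "poly_in (insert v V) s" "\<forall>e. poly_in V (r e)"
      "\<forall>z. p n z ^ q * (\<Sum>e<N. c' e z * z v ^ e) =
       (\<Sum>e\<le>n. p e z * z v ^ e) * s z + (\<Sum>e<n. r e z * z v ^ e)"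
      using Suc.IH[of c'] c'pol by blast
    have key: "p n z * (\<Sum>e<Suc N. c e z * z v ^ e) =
        (\<Sum>e\<le>n. p e z * z v ^ e) * (c N z * z v ^ (N - n)) + (\<Sum>e<N. c' e z * z v ^ e)" for z
    proof -
      have "(\<Sum>e\<le>n. p e z * z v ^ e) * (c N z * z v ^ (N - n))
          = (\<Sum>e\<le>n. c N z * p e z * z v ^ (e + (N - n)))"
        unfolding sum_distrib_right by (intro sum.cong) (auto simp: power_add algebra_simps)
      also have "\<dots> = (\<Sum>e\<in>{N-n..N}. c N z * p (e + n - N) z * z v ^ e)"
        by (rule sum.reindex_bij_witness[of _ "\<lambda>e. e + n - N" "\<lambda>e. e + (N - n)"]) (use nN in auto)
      also have "\<dots> = (\<Sum>e<Suc N. (if e + n \<ge> N then c N z * p (e + n - N) z else 0) * z v ^ e)"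
        by (rule sum.mono_neutral_cong_left) (use nN in auto)
      finally have A: "(\<Sum>e\<le>n. p e z * z v ^ e) * (c N z * z v ^ (N - n)) =
        (\<Sum>e<Suc N. (if e + n \<ge> N then c N z * p (e + n - N) z else 0) * z v ^ e)" .
      have "(\<Sum>e<N. c' e z * z v ^ e) = (\<Sum>e<Suc N. c' e z * z v ^ e)"
        using nN by (simp add: c'_def)
      then show ?thesis unfolding A c'_def
        by (simp only: sum.distrib[symmetric] sum_distrib_left) (intro sum.cong, auto simp: algebra_simps)
    qed
    show ?thesis
    proof (intro exI conjI allI)
      show "poly_in (insert v V) (\<lambda>z. p n z ^ q * (c N z * z v ^ (N - n)) + s z)"
        by (intro poly_in_add poly_in_mult poly_in_power IH poly_in_var poly_in_mono[OF p] poly_in_mono[OF Suc.prems]) auto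
      show "poly_in V (r e)" for e using IH by blast
      fix z
      have "p n z ^ Suc q * (\<Sum>e<Suc N. c e z * z v ^ e) =
        p n z ^ q * (p n z * (\<Sum>e<Suc N. c e z * z v ^ e))" by (simp only: power_Suc ac_simps)
      also have "\<dots> = (\<Sum>e\<le>n. p e z * z v ^ e) * (p n z ^ q * (c N z * z v ^ (N - n))) +
         p n z ^ q * (\<Sum>e<N. c' e z * z v ^ e)" unfolding key by (simp only: algebra_simps)
      also have "\<dots> = (\<Sum>e\<le>n. p e z * z v ^ e) * (p n z ^ q * (c N z * z v ^ (N - n)) + s z) + (\<Sum>e<n. r e z * z v ^ e)"
        using IH(3) by (simp only: algebra_simps)
      finally show "p n z ^ Suc q * (\<Sum>e<Suc N. c e z * z v ^ e) =
        (\<Sum>e\<le>n. p e z * z v ^ e) * (p n z ^ q * (c N z * z v ^ (N - n)) + s z) + (\<Sum>e<n. r e z * z v ^ e)" .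
    qed
  qed
qed


section \<open>Tangent vectors of a set and their extension by one variable\<close>

definition vanish :: "('i \<Rightarrow> complex) set \<Rightarrow> (('i \<Rightarrow> complex) \<Rightarrow> complex) \<Rightarrow> bool" where
  "vanish D f \<longleftrightarrow> (\<forall>z\<in>D. f z = 0)"

text \<open>The polynomials in V vanishing on D form a prime ideal; that this ideal is proper is the
  separate assumption D \<noteq> {}.\<close>

definition prime_on :: "'i set \<Rightarrow> ('i \<Rightarrow> complex) set \<Rightarrow> bool" where
  "prime_on V D \<longleftrightarrow> (\<forall>f g. poly_in V f \<longrightarrow> poly_in V g \<longrightarrow> vanish D (\<lambda>z. f z * g z) \<longrightarrow> vanish D f \<or> vanish D g)"

lemma prime_on_subset: "prime_on W D \<Longrightarrow> V \<subseteq> W \<Longrightarrow> prime_on V D"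
  unfolding prime_on_def using poly_in_mono by blast

text \<open>Zariski tangent space at z, for the relations among the variables in V only. It is
  tested on all polynomials vanishing on D rather than on generators, so enlarging V by one variable
  is an extension problem for u.\<close>

definition tangent :: "'i set \<Rightarrow> ('i \<Rightarrow> complex) set \<Rightarrow> ('i \<Rightarrow> complex) \<Rightarrow> ('i \<Rightarrow> complex) \<Rightarrow> bool" where
  "tangent V D z u \<longleftrightarrow> (\<forall>f. poly_in V f \<longrightarrow> vanish D f \<longrightarrow> dir_deriv f z u = 0)"

text \<open>The coefficients of every relation involving v vanish on D themselves, and u already
  annihilates their derivatives; hence the value of u at v is unconstrained.\<close>

lemma tangent_insert_transcendental:
  assumes fin: "finite V" and v: "v \<notin> V"
    and trans: "\<And>c n. (\<And>e. poly_in V (c e)) \<Longrightarrow> vanish D (\<lambda>z. \<Sum>e\<le>n. c e z * z v ^ e) \<Longrightarrow> (\<forall>e\<le>n. vanish D (c e))"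
    and z: "z \<in> D" and u: "tangent V D z u"
  shows "tangent (insert v V) D z u"
  unfolding tangent_def
proof (intro allI impI)
  fix f assume f: "poly_in (insert v V) f" and vf: "vanish D f"
  obtain c n where c: "\<And>e. poly_in V (c e)" "f = (\<lambda>z. \<Sum>e\<le>n. c e z * z v ^ e)"
    using poly_in_insert_expand[OF f] by blast
  have van: "\<forall>e\<le>n. vanish D (c e)" using trans[of c n] c vf by simp
  have pc: "poly_in (insert v V) (c e)" for e using c(1) by (rule poly_in_mono) auto
  have pv: "poly_in (insert v V) (\<lambda>z. z v)" by (rule poly_in_var) auto
  have finv: "finite (insert v V)" using fin by simp
  have "dir_deriv f z u = (\<Sum>e\<le>n. dir_deriv (\<lambda>z. c e z * z v ^ e) z u)"
    unfolding c(2) by (rule dir_deriv_sum[OF _ finv]) (intro poly_in_mult pc poly_in_power pv)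
  also have "\<dots> = 0"
  proof (rule sum.neutral, safe)
    fix e assume e: "e \<le> n"
    have "dir_deriv (c e) z u = 0" using u c(1) van e unfolding tangent_def by blast
    moreover have "c e z = 0" using van e z unfolding vanish_def by blast
    ultimately show "dir_deriv (\<lambda>z. c e z * z v ^ e) z u = 0"
      by (subst dir_deriv_mult[OF pc poly_in_power[OF pv] finv]) simp
  qed
  finally show "dir_deriv f z u = 0" .
qed

text \<open>
  A vector tangent to the relations among the variables in V extends to a new variable v by implicit
  differentiation of a relation for v of minimal degree: by pseudo-division every other relation
  involving v is, up to a factor, a multiple of this one plus a relation with coefficients vanishing on D.
\<close>
lemma tangent_insert_algebraic:
  assumes fin: "finite V" and v: "v \<notin> V"
    and p: "\<And>e. poly_in V (p e)" and vp: "vanish D (\<lambda>z. \<Sum>e\<le>n. p e z * z v ^ e)"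
    and min: "\<And>c e. (\<And>e. poly_in V (c e)) \<Longrightarrow> vanish D (\<lambda>z. \<Sum>e<n. c e z * z v ^ e) \<Longrightarrow> e < n \<Longrightarrow> vanish D (c e)"
    and z: "z \<in> D" and lc: "p n z \<noteq> 0"
    and sep: "(\<Sum>e\<le>n. p e z * (of_nat e * z v ^ (e - 1))) \<noteq> 0"
    and u: "tangent V D z u"
  shows "\<exists>t. tangent (insert v V) D z (u(v := t))"
proof -
  define P where "P = (\<lambda>z. \<Sum>e\<le>n. p e z * z v ^ e)"
  \<comment> \<open>The value at v for which the derivative of the relation P is 0: that derivative
    is a part coming from the coefficients plus t times the partial derivative in v, and
    \<open>sep\<close> says that the latter is nonzero.\<close>
  define t where "t = - (\<Sum>e\<le>n. dir_deriv (p e) z u * z v ^ e) / (\<Sum>e\<le>n. p e z * (of_nat e * z v ^ (e - 1)))"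
  define w where "w = u(v := t)"
  have pc: "poly_in (insert v V) c" if "poly_in V c" for c using that by (rule poly_in_mono) auto
  have pv: "poly_in (insert v V) (\<lambda>z. z v)" by (rule poly_in_var) auto
  have finv: "finite (insert v V)" using fin by simp
  have ddw: "dir_deriv c z w = dir_deriv c z u" if "poly_in V c" for c
    by (rule dir_deriv_cong[OF that fin]) (use v in \<open>auto simp: w_def\<close>)
  have wv: "w v = t" by (simp add: w_def)
  have expand: "dir_deriv (\<lambda>z. \<Sum>e\<in>A. c e z * z v ^ e) z w =
      (\<Sum>e\<in>A. dir_deriv (c e) z u * z v ^ e) + (\<Sum>e\<in>A. c e z * (of_nat e * z v ^ (e - 1))) * t"
    if c: "\<And>e. poly_in V (c e)" for c A
  proof -
    have "dir_deriv (\<lambda>z. \<Sum>e\<in>A. c e z * z v ^ e) z w = (\<Sum>e\<in>A. dir_deriv (\<lambda>z. c e z * z v ^ e) z w)"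
      by (rule dir_deriv_sum[OF _ finv]) (intro poly_in_mult pc poly_in_power pv c)
    also have "\<dots> = (\<Sum>e\<in>A. dir_deriv (c e) z u * z v ^ e + c e z * (of_nat e * z v ^ (e - 1)) * t)"
      by (intro sum.cong refl)
         (subst dir_deriv_mult[OF pc[OF c] poly_in_power[OF pv] finv], subst dir_deriv_pow[OF pv finv],
           simp add: dir_deriv_var ddw[OF c] wv)
    finally show ?thesis by (simp add: sum.distrib sum_distrib_right)
  qed
  have Ppol: "poly_in (insert v V) P" unfolding P_def by (intro poly_in_sum poly_in_mult pc p poly_in_power pv)
  have Pz: "P z = 0" using vp z unfolding vanish_def P_def by blast
  have ddP: "dir_deriv P z w = 0"
    unfolding P_def expand[OF p] t_def using sep by simp
  have "dir_deriv f z w = 0" if f: "poly_in (insert v V) f" and vf: "vanish D f" for f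
  proof -
    obtain c N where c: "\<And>e. poly_in V (c e)" "f = (\<lambda>z. \<Sum>e\<le>N. c e z * z v ^ e)"
      using poly_in_insert_expand[OF f] by blast
    have f': "f = (\<lambda>z. \<Sum>e<Suc N. c e z * z v ^ e)" unfolding c(2) by (simp only: lessThan_Suc_atMost)
    obtain q s r where qsr0: "poly_in (insert v V) s \<and> (\<forall>e. poly_in V (r e)) \<and>
      (\<forall>z. p n z ^ q * (\<Sum>e<Suc N. c e z * z v ^ e) = (\<Sum>e\<le>n. p e z * z v ^ e) * s z + (\<Sum>e<n. r e z * z v ^ e))"
      using pseudo_division[of V p c v n "Suc N", OF p c(1)] by (elim exE)
    then have qsr: "poly_in (insert v V) s" "\<And>e. poly_in V (r e)"
      "\<And>z. p n z ^ q * f z = P z * s z + (\<Sum>e<n. r e z * z v ^ e)"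
      by (simp_all only: f' P_def)
    define r' where "r' = (\<lambda>z. \<Sum>e<n. r e z * z v ^ e)"
    have rpol: "poly_in (insert v V) r'" unfolding r'_def by (intro poly_in_sum poly_in_mult pc qsr poly_in_power pv)
    have "vanish D r'" unfolding vanish_def
    proof
      fix y assume "y \<in> D"
      then have "P y = 0" "f y = 0" using vp vf unfolding vanish_def P_def by blast+
      then show "r' y = 0" using qsr(3)[of y] unfolding r'_def by simp
    qed
    then have rv: "vanish D (r e)" if "e < n" for e
      using min[of r e] qsr(2) that unfolding r'_def by blast
    have ddr: "dir_deriv r' z w = 0"
    proof -
      have "dir_deriv (r e) z u = 0 \<and> r e z = 0" if "e < n" for e
        using u qsr(2) rv[OF that] z unfolding tangent_def vanish_def by blast
      then show ?thesis unfolding r'_def by (subst expand[OF qsr(2)]) simp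
    qed
    have pq: "poly_in (insert v V) (\<lambda>z. p n z ^ q)" by (intro poly_in_power pc p)
    have "dir_deriv (\<lambda>z. p n z ^ q * f z) z w = dir_deriv (\<lambda>z. P z * s z + r' z) z w"
      using qsr(3) unfolding r'_def by presburger
    moreover have "dir_deriv (\<lambda>z. p n z ^ q * f z) z w = p n z ^ q * dir_deriv f z w"
      using vf z by (subst dir_deriv_mult[OF pq f finv]) (simp add: vanish_def)
    moreover have "dir_deriv (\<lambda>z. P z * s z + r' z) z w = 0"
      by (subst dir_deriv_add[OF poly_in_mult[OF Ppol qsr(1)] rpol finv], subst dir_deriv_mult[OF Ppol qsr(1) finv])
         (simp add: ddr ddP Pz)
    ultimately show ?thesis using lc by simp
  qed
  then show ?thesis unfolding tangent_def w_def by blast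
qed

text \<open>If v is algebraic over V on D, extension can fail only where the leading coefficient or
  the v-derivative of a relation of least degree vanishes; h is their product. Neither factor
  vanishes on D, and primality passes this on to the product.\<close>

lemma generic_tangent_insert:
  assumes fin: "finite V" and v: "v \<notin> V" and prime: "prime_on (insert v V) D"
    and ne: "D \<noteq> {}"
  shows "\<exists>h. poly_in (insert v V) h \<and> \<not> vanish D h \<and>
    (\<forall>z\<in>D. h z \<noteq> 0 \<longrightarrow> (\<forall>u. tangent V D z u \<longrightarrow> (\<exists>t. tangent (insert v V) D z (u(v := t)))))"
proof (cases "\<forall>c n. (\<forall>e. poly_in V (c e)) \<longrightarrow> vanish D (\<lambda>z. \<Sum>e\<le>n. c e z * z v ^ e) \<longrightarrow> (\<forall>e\<le>n. vanish D (c e))")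
  case True
  have "\<not> vanish D (\<lambda>_. 1)" using ne unfolding vanish_def by auto
  moreover have "\<exists>t. tangent (insert v V) D z (u(v := t))" if "z \<in> D" "tangent V D z u" for z u
  proof (rule exI[of _ "u v"])
    have trans: "\<forall>e\<le>n. vanish D (c e)"
      if "\<And>e. poly_in V (c e)" "vanish D (\<lambda>z. \<Sum>e\<le>n. c e z * z v ^ e)" for c n
      using True[rule_format, of c n] that by blast
    show "tangent (insert v V) D z (u(v := u v))"
      using tangent_insert_transcendental[OF fin v trans that] by simp
  qed
  ultimately show ?thesis by (intro exI[of _ "\<lambda>_. 1"]) (simp add: poly_in_const)
next
  case False
  define bad where "bad n \<longleftrightarrow> (\<exists>c. (\<forall>e. poly_in V (c e)) \<and> vanish D (\<lambda>z. \<Sum>e\<le>n. c e z * z v ^ e) \<and> \<not> vanish D (c n))" for n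
  have low: "\<exists>m\<le>n. bad m" if c: "\<forall>e. poly_in V (c e)" "vanish D (\<lambda>z. \<Sum>e\<le>n. c e z * z v ^ e)" "e \<le> n" "\<not> vanish D (c e)" for c n e
    using that
  proof (induction n)
    case 0
    then show ?case unfolding bad_def by auto
  next
    case (Suc n)
    show ?case
    proof (cases "vanish D (c (Suc n))")
      case True
      then have "vanish D (\<lambda>z. \<Sum>e\<le>n. c e z * z v ^ e)"
        using Suc.prems(2) unfolding vanish_def by simp
      moreover have "e \<le> n" using True Suc.prems by (cases "e = Suc n") auto
      ultimately show ?thesis using Suc by (meson le_SucI)
    next
      case False
      then show ?thesis using Suc.prems unfolding bad_def by blast
    qed
  qed
  have "\<exists>n. bad n" using False low by blast
  define n where "n = (LEAST n. bad n)"
  have "bad n" unfolding n_def using \<open>\<exists>n. bad n\<close> by (metis LeastI_ex)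
  have nmin: "\<not> bad m" if "m < n" for m using not_less_Least[of m bad] that unfolding n_def by blast
  obtain p where p: "\<And>e. poly_in V (p e)" "vanish D (\<lambda>z. \<Sum>e\<le>n. p e z * z v ^ e)" "\<not> vanish D (p n)"
    using \<open>bad n\<close> unfolding bad_def by blast
  have n0: "n > 0" using p(2,3) by (cases n) auto
  have min: "vanish D (c e)" if c: "\<And>e. poly_in V (c e)" "vanish D (\<lambda>z. \<Sum>e<n. c e z * z v ^ e)" "e < n" for c e
  proof (rule ccontr)
    assume "\<not> vanish D (c e)"
    moreover have "vanish D (\<lambda>z. \<Sum>e\<le>n-1. c e z * z v ^ e)"
      using c(2) n0 by (cases n) (auto simp: lessThan_Suc_atMost)
    moreover have "e \<le> n - 1" "\<forall>e. poly_in V (c e)" using c by auto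
    ultimately obtain m where "m \<le> n - 1" "bad m" using low[of c "n - 1" e] by blast
    then show False using nmin[of m] n0 by simp
  qed
  define p' where "p' = (\<lambda>z. \<Sum>e\<le>n. p e z * (of_nat e * z v ^ (e - 1)))"
  have pc: "poly_in (insert v V) c" if "poly_in V c" for c using that by (rule poly_in_mono) auto
  have pv: "poly_in (insert v V) (\<lambda>z. z v)" by (rule poly_in_var) auto
  have p'pol: "poly_in (insert v V) p'"
    unfolding p'_def by (intro poly_in_sum poly_in_mult pc p poly_in_power pv poly_in_const)
  have p'_eq: "p' z = (\<Sum>e<n. (of_nat (Suc e) * p (Suc e) z) * z v ^ e)" for z
  proof -
    have "p' z = (\<Sum>e\<in>{1..n}. p e z * (of_nat e * z v ^ (e - 1)))"
      unfolding p'_def by (rule sum.mono_neutral_right) auto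
    also have "\<dots> = (\<Sum>e<n. (of_nat (Suc e) * p (Suc e) z) * z v ^ e)"
      by (rule sum.reindex_bij_witness[of _ Suc "\<lambda>e. e - 1"]) auto
    finally show ?thesis .
  qed
  \<comment> \<open>The derivative has degree below n, so minimality would make its top coefficient
    n * \<open>p n\<close> vanish on D. Characteristic 0 enters here.\<close>
  have "\<not> vanish D p'"
  proof
    assume "vanish D p'"
    then have "vanish D (\<lambda>z. \<Sum>e<n. (of_nat (Suc e) * p (Suc e) z) * z v ^ e)" unfolding p'_eq[abs_def] .
    then have "vanish D (\<lambda>z. of_nat (Suc (n-1)) * p (Suc (n-1)) z)"
      by (rule min[where c="\<lambda>e z. of_nat (Suc e) * p (Suc e) z", rotated]) (use n0 p in \<open>auto intro!: poly_in_mult poly_in_const\<close>)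
    then show False using p(3) n0 unfolding vanish_def by simp
  qed
  then have "\<not> vanish D (\<lambda>z. p n z * p' z)"
    using prime p pc p'pol unfolding prime_on_def by blast
  moreover have "poly_in (insert v V) (\<lambda>z. p n z * p' z)" using p pc p'pol poly_in_mult by blast
  moreover have "\<exists>t. tangent (insert v V) D z (u(v := t))"
    if "z \<in> D" "p n z * p' z \<noteq> 0" "tangent V D z u" for z u
  proof (rule tangent_insert_algebraic[where p = p and n = n])
    show "finite V" "v \<notin> V" "\<And>e. poly_in V (p e)" "vanish D (\<lambda>z. \<Sum>e\<le>n. p e z * z v ^ e)"
      "z \<in> D" "tangent V D z u" by fact+
    show "vanish D (c e)" if "\<And>e. poly_in V (c e)" "vanish D (\<lambda>z. \<Sum>e<n. c e z * z v ^ e)" "e < n" for c e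
      using min that by blast
    show "p n z \<noteq> 0" "(\<Sum>e\<le>n. p e z * (of_nat e * z v ^ (e - 1))) \<noteq> 0"
      using that(2) by (auto simp: p'_def)
  qed
  ultimately show ?thesis by blast
qed

text \<open>V0 is a set of independent parameters: no relation restricts a tangent vector there, so
  its values can be prescribed. The other variables are added one at a time, and the exceptional
  polynomials are multiplied.\<close>

lemma generic_tangent:
  assumes fin: "finite V" and V0: "finite V0" and disj: "V0 \<inter> V = {}" and prime: "prime_on (V0 \<union> V) D"
    and indep: "\<And>f. poly_in V0 f \<Longrightarrow> vanish D f \<Longrightarrow> f = (\<lambda>_. 0)"
    and ne: "D \<noteq> {}"
  shows "\<exists>h. poly_in (V0 \<union> V) h \<and> \<not> vanish D h \<and>
    (\<forall>z\<in>D. h z \<noteq> 0 \<longrightarrow> (\<forall>c. \<exists>u. tangent (V0 \<union> V) D z u \<and> (\<forall>v\<in>V0. u v = c v)))"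
  using fin disj prime
proof (induction V)
  case empty
  have "tangent V0 D z u" for z u
    unfolding tangent_def using indep dir_deriv_const by metis
  moreover have "\<not> vanish D (\<lambda>_. 1)" using ne unfolding vanish_def by auto
  ultimately show ?case using poly_in_const by (intro exI[of _ "\<lambda>_. 1"]) auto
next
  case (insert v V)
  have W: "V0 \<union> insert v V = insert v (V0 \<union> V)" by auto
  have "prime_on (V0 \<union> V) D" using insert.prems by (auto intro: prime_on_subset)
  then obtain h where h: "poly_in (V0 \<union> V) h" "\<not> vanish D h"
    "\<forall>z\<in>D. h z \<noteq> 0 \<longrightarrow> (\<forall>c. \<exists>u. tangent (V0 \<union> V) D z u \<and> (\<forall>v\<in>V0. u v = c v))"
    using insert by auto
  obtain h' where h': "poly_in (insert v (V0 \<union> V)) h'" "\<not> vanish D h'"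
    "\<forall>z\<in>D. h' z \<noteq> 0 \<longrightarrow> (\<forall>u. tangent (V0 \<union> V) D z u \<longrightarrow> (\<exists>t. tangent (insert v (V0 \<union> V)) D z (u(v := t))))"
    using generic_tangent_insert[of "V0 \<union> V" v D] insert V0 ne unfolding W by auto
  have hp: "poly_in (insert v (V0 \<union> V)) h" using h(1) by (rule poly_in_mono) auto
  have "\<not> vanish D (\<lambda>z. h z * h' z)"
    using insert.prems h h' hp unfolding W prime_on_def by blast
  moreover have "\<exists>u. tangent (insert v (V0 \<union> V)) D z u \<and> (\<forall>v\<in>V0. u v = c v)"
    if z: "z \<in> D" "h z * h' z \<noteq> 0" for z c
  proof -
    obtain u where u: "tangent (V0 \<union> V) D z u" "\<forall>v\<in>V0. u v = c v" using h(3) z by fastforce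
    then obtain t where "tangent (insert v (V0 \<union> V)) D z (u(v := t))" using h'(3) z by fastforce
    moreover have "\<forall>w\<in>V0. (u(v := t)) w = c w" using u insert by auto
    ultimately show ?thesis by blast
  qed
  ultimately show ?case unfolding W using poly_in_mult[OF hp h'(1)] by blast
qed

section \<open>From chains of irreducible sets to independent flexes\<close>

lemma poly_in_cong: "poly_in V f \<Longrightarrow> (\<And>v. v \<in> V \<Longrightarrow> z v = z' v) \<Longrightarrow> f z = f z'"
  by (induction rule: poly_in.induct) auto

definition coords :: "(nat + 'a \<times> bool \<Rightarrow> complex) \<Rightarrow> 'a \<Rightarrow> complex \<times> complex" where
  "coords z s = (z (Inr (s, True)), z (Inr (s, False)))"

text \<open>The parameters of \<open>generic_tangent\<close> must be coordinates, while the
  independent functions found on a chain are polynomials \<open>F j\<close>. On the graph of F their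
  values become the coordinates \<open>Inl j\<close>, next to the coordinates
  \<open>Inr (s, b)\<close> of the points.\<close>

definition graph_point :: "(nat \<Rightarrow> ('a \<Rightarrow> complex \<times> complex) \<Rightarrow> complex) \<Rightarrow> ('a \<Rightarrow> complex \<times> complex) \<Rightarrow>
    nat + 'a \<times> bool \<Rightarrow> complex" where
  "graph_point F x v = (case v of Inl j \<Rightarrow> F j x | Inr (s, b) \<Rightarrow> if b then fst (x s) else snd (x s))"

lemma coords_graph_point [simp]: "coords (graph_point F x) = x"
  by (auto simp: coords_def graph_point_def)

lemma graph_point_Inl [simp]: "graph_point F x (Inl j) = F j x"
  by (simp add: graph_point_def)

lemma poly_in_of_poly_fun: "poly_fun S f \<Longrightarrow> poly_in (Inr ` (S \<times> UNIV)) (\<lambda>z. f (coords z))"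
  by (induction rule: poly_fun.induct) (auto simp: coords_def intro: poly_in.intros)

lemma poly_fun_of_pol:
  assumes "poly_in (Inl ` {..<k} \<union> Inr ` (S \<times> UNIV)) g" "\<And>j. j < k \<Longrightarrow> poly_fun S (F j)"
  shows "poly_fun S (\<lambda>x. g (graph_point F x))"
  using assms(1)
proof (induction rule: poly_in.induct)
  case (poly_in_var v)
  then consider j where "v = Inl j" "j < k" | s b where "v = Inr (s, b)" "s \<in> S" by auto
  then show ?case
  proof cases
    case 1
    then show ?thesis using assms(2) by simp
  next
    case 2
    then show ?thesis by (cases b) (auto simp: graph_point_def intro: poly_fun.intros)
  qed
qed (auto intro: poly_fun.intros)

text \<open>The zero sets of f and g are closed and together cover Z.\<close>

lemma irreducible_prime:
  assumes Z: "zariski_irreducible S Z" and f: "poly_fun S f" and g: "poly_fun S g"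
    and fg: "\<And>x. x \<in> Z \<Longrightarrow> f x * g x = 0"
  shows "(\<forall>x\<in>Z. f x = 0) \<or> (\<forall>x\<in>Z. g x = 0)"
proof -
  have cl: "zariski_closed S {x \<in> ext_space S. f x = 0}" if "poly_fun S f" for f
    unfolding zariski_closed_def using that by (intro exI[of _ "{f}"]) auto
  have "Z \<subseteq> {x \<in> ext_space S. f x = 0} \<union> {x \<in> ext_space S. g x = 0}"
    using fg Z unfolding zariski_irreducible_def by fastforce
  then have "Z \<subseteq> {x \<in> ext_space S. f x = 0} \<or> Z \<subseteq> {x \<in> ext_space S. g x = 0}"
    using Z cl[OF f] cl[OF g] unfolding zariski_irreducible_def by blast
  then show ?thesis by blast
qed

lemma separating_poly:
  assumes "zariski_closed S A" "Z \<subseteq> ext_space S" "\<not> Z \<subseteq> A"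
  shows "\<exists>f. poly_fun S f \<and> (\<forall>x\<in>A. f x = 0) \<and> (\<exists>x\<in>Z. f x \<noteq> 0)"
proof -
  obtain F where F: "\<forall>f\<in>F. poly_fun S f" "A = {x \<in> ext_space S. \<forall>f\<in>F. f x = 0}"
    using assms(1) unfolding zariski_closed_def by blast
  then show ?thesis using assms(2,3) by blast
qed

text \<open>The derivative of the determinant in \<open>collinear3\<close> at (p, q, w) in the
  direction (p', q', w').\<close>

definition flex :: "complex \<times> complex \<Rightarrow> complex \<times> complex \<Rightarrow> complex \<times> complex \<Rightarrow>
    complex \<times> complex \<Rightarrow> complex \<times> complex \<Rightarrow> complex \<times> complex \<Rightarrow> bool" where
  "flex p q w p' q' w' \<longleftrightarrow>
     (fst q' - fst p') * (snd w - snd p) + (fst q - fst p) * (snd w' - snd p')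
      - (snd q' - snd p') * (fst w - fst p) - (snd q - snd p) * (fst w' - fst p') = 0"

lemma dir_deriv_collinear:
  "dir_deriv (\<lambda>z. (fst (coords z b) - fst (coords z a)) * (snd (coords z c) - snd (coords z a))
        - (snd (coords z b) - snd (coords z a)) * (fst (coords z c) - fst (coords z a))) z u = 0 \<longleftrightarrow>
   flex (coords z a) (coords z b) (coords z c) (coords u a) (coords u b) (coords u c)"
proof -
  have "dir_deriv (\<lambda>z. (fst (coords z b) - fst (coords z a)) * (snd (coords z c) - snd (coords z a))
        - (snd (coords z b) - snd (coords z a)) * (fst (coords z c) - fst (coords z a))) z u =
     (fst (coords u b) - fst (coords u a)) * (snd (coords z c) - snd (coords z a)) + (fst (coords z b) - fst (coords z a)) * (snd (coords u c) - snd (coords u a))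
      - (snd (coords u b) - snd (coords u a)) * (fst (coords z c) - fst (coords z a)) - (snd (coords z b) - snd (coords z a)) * (fst (coords u c) - fst (coords u a))"
    unfolding dir_deriv_def
    by (rule DERIV_imp_deriv) (auto simp: coords_def algebra_simps intro!: derivative_eq_intros)
  then show ?thesis unfolding flex_def by simp
qed

text \<open>
  If F i separates two consecutive members of the chain, a polynomial relation among the F i can be
  divided by the largest possible power of the last one and restricted to the smaller member.
\<close>
lemma chain_independent:
  assumes irr: "\<And>i. i \<le> k \<Longrightarrow> zariski_irreducible S (Ch i)"
    and mono: "\<And>i. i < k \<Longrightarrow> Ch i \<subseteq> Ch (Suc i)"
    and F: "\<And>i. i < k \<Longrightarrow> poly_fun S (F i)" "\<And>i x. i < k \<Longrightarrow> x \<in> Ch i \<Longrightarrow> F i x = 0"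
      "\<And>i. i < k \<Longrightarrow> \<exists>x\<in>Ch (Suc i). F i x \<noteq> 0"
    and "j \<le> k" "poly_in (Inl ` {..<j}) f" "\<And>x. x \<in> Ch j \<Longrightarrow> f (graph_point F x) = 0"
  shows "f = (\<lambda>_. 0)"
  using assms(6-)
proof (induction j arbitrary: f)
  case 0
  obtain x where "x \<in> Ch 0" using irr[of 0] unfolding zariski_irreducible_def by blast
  moreover have "f z = f (graph_point F x)" for z using 0(2) by (rule poly_in_cong) auto
  ultimately show ?case using 0(3) by auto
next
  case (Suc j)
  have j: "j < k" using Suc.prems by simp
  have "Inl ` {..<Suc j} = insert (Inl j) (Inl ` {..<j})" by (auto simp: less_Suc_eq)
  then have "poly_in (insert (Inl j) (Inl ` {..<j})) f" using Suc.prems(2) by metis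
  then obtain c N where c: "\<forall>e. poly_in (Inl ` {..<j}) (c e)" "f = (\<lambda>z. \<Sum>e\<le>N. c e z * z (Inl j) ^ e)"
    by (elim poly_in_insert_expand[THEN exE] exE conjE)
  have pf: "poly_fun S (\<lambda>x. c e (graph_point F x))" for e
    by (rule poly_fun_of_pol[of k]) (use c(1) j F(1) in \<open>auto intro: poly_in_mono\<close>)
  have "c e = (\<lambda>_. 0)" if "e \<le> N" for e
    using that
  proof (induction e rule: less_induct)
    case (less e)
    have feq: "f z = z (Inl j) ^ e * (\<Sum>i\<in>{e..N}. c i z * z (Inl j) ^ (i - e))" for z
    proof -
      have "f z = (\<Sum>i\<in>{e..N}. c i z * z (Inl j) ^ i)"
        unfolding c(2) by (rule sum.mono_neutral_right) (use less in auto)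
      also have "\<dots> = z (Inl j) ^ e * (\<Sum>i\<in>{e..N}. c i z * z (Inl j) ^ (i - e))"
        unfolding sum_distrib_left by (intro sum.cong) (auto simp: power_add[symmetric] algebra_simps)
      finally show ?thesis .
    qed
    define g where "g x = (\<Sum>i\<in>{e..N}. c i (graph_point F x) * F j x ^ (i - e))" for x
    have ps: "poly_fun S (\<lambda>x. \<Sum>i\<in>A. h i x)" if "\<And>i. poly_fun S (h i)" for A :: "nat set" and h
      using that by (induction A rule: infinite_finite_induct) (auto intro: poly_fun.intros)
    have pp: "poly_fun S (\<lambda>x. F j x ^ n)" for n
      using F(1)[OF j] by (induction n) (auto intro: poly_fun.intros)
    have "poly_fun S g" unfolding g_def by (intro ps pf_mult pf pp)
    moreover have "F j x ^ e * g x = 0" if "x \<in> Ch (Suc j)" for x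
      using Suc.prems(3)[OF that] feq[of "graph_point F x"] by (simp add: g_def)
    ultimately have "(\<forall>x\<in>Ch (Suc j). F j x ^ e = 0) \<or> (\<forall>x\<in>Ch (Suc j). g x = 0)"
      using irreducible_prime[OF irr[of "Suc j"] pp] j by (metis Suc_leI)
    then have g0: "g x = 0" if "x \<in> Ch (Suc j)" for x using F(3)[OF j] that by auto
    have "c e (graph_point F x) = 0" if x: "x \<in> Ch j" for x
    proof -
      have "x \<in> Ch (Suc j)" using mono[OF j] x by auto
      then have "0 = g x" using g0 by simp
      also have "\<dots> = (\<Sum>i\<in>{e}. c i (graph_point F x) * F j x ^ (i - e))" unfolding g_def
        by (rule sum.mono_neutral_right) (use F(2)[OF j x] less.prems in auto)
      finally show ?thesis by simp
    qed
    then show ?case using Suc.IH[of "c e"] c(1) j by simp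
  qed
  then show ?case unfolding c(2) by auto
qed

text \<open>Functions separating consecutive members of the chain are algebraically independent on
  the top member. At a generic point there is, for each j, a tangent vector along which the j-th
  function has derivative 1 and the others 0; these k vectors are independent, and tangency turns
  every collinearity valid on the top member into a flex equation. The polynomial b carries an open
  condition to be kept at the generic point.\<close>

lemma chain_flexes:
  assumes fin: "finite S"
    and irr: "\<And>i. i \<le> k \<Longrightarrow> zariski_irreducible S (Ch i)"
    and closed: "\<And>i. i \<le> k \<Longrightarrow> zariski_closed S (Ch i)"
    and strict: "\<And>i. i < k \<Longrightarrow> Ch i \<subset> Ch (Suc i)"
    and b: "poly_fun S b" "x0 \<in> Ch k" "b x0 \<noteq> 0"
  shows "\<exists>x\<in>Ch k. b x \<noteq> 0 \<and> (\<exists>v :: nat \<Rightarrow> 'a \<Rightarrow> complex \<times> complex.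
    (\<forall>j<k. \<forall>p\<in>S. \<forall>q\<in>S. \<forall>w\<in>S. (\<forall>y\<in>Ch k. collinear3 (y p) (y q) (y w)) \<longrightarrow>
       flex (x p) (x q) (x w) (v j p) (v j q) (v j w)) \<and>
    (\<forall>c. (\<forall>s\<in>S. (\<Sum>j<k. c j * fst (v j s)) = 0 \<and> (\<Sum>j<k. c j * snd (v j s)) = 0) \<longrightarrow> (\<forall>j<k. c j = 0)))"
proof -
  have ext: "Ch i \<subseteq> ext_space S" if "i \<le> k" for i
    using irr[OF that] unfolding zariski_irreducible_def by blast
  have "\<exists>f. poly_fun S f \<and> (\<forall>x\<in>Ch i. f x = 0) \<and> (\<exists>x\<in>Ch (Suc i). f x \<noteq> 0)" if "i < k" for i
    by (rule separating_poly[OF closed ext]) (use strict[OF that] that in auto)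
  then obtain F where F: "\<And>i. i < k \<Longrightarrow> poly_fun S (F i)" "\<And>i x. i < k \<Longrightarrow> x \<in> Ch i \<Longrightarrow> F i x = 0"
      "\<And>i. i < k \<Longrightarrow> \<exists>x\<in>Ch (Suc i). F i x \<noteq> 0" by metis
  define V0 :: "(nat + 'a \<times> bool) set" where "V0 = Inl ` {..<k}"
  define V :: "(nat + 'a \<times> bool) set" where "V = Inr ` (S \<times> UNIV)"
  define D where "D = graph_point F ` Ch k"
  have finV: "finite V" "finite V0" "finite (V0 \<union> V)" unfolding V_def V0_def using fin by auto
  have pf: "poly_fun S (\<lambda>x. g (graph_point F x))" if "poly_in (V0 \<union> V) g" for g
    using poly_fun_of_pol[of k S g F] that F(1) unfolding V_def V0_def by blast
  have prime: "prime_on (V0 \<union> V) D" unfolding prime_on_def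
  proof (intro allI impI)
    fix f g assume "poly_in (V0 \<union> V) f" "poly_in (V0 \<union> V) g" "vanish D (\<lambda>z. f z * g z)"
    then have "(\<forall>x\<in>Ch k. f (graph_point F x) = 0) \<or> (\<forall>x\<in>Ch k. g (graph_point F x) = 0)"
      by (intro irreducible_prime[OF irr[of k]] pf) (auto simp: vanish_def D_def)
    then show "vanish D f \<or> vanish D g" unfolding vanish_def D_def by auto
  qed
  have indep: "f = (\<lambda>_. 0)" if "poly_in V0 f" "vanish D f" for f
  proof (rule chain_independent[where k = k and S = S and Ch = Ch and F = F and j = k])
    show "zariski_irreducible S (Ch i)" if "i \<le> k" for i using irr that .
    show "Ch i \<subseteq> Ch (Suc i)" if "i < k" for i using strict[OF that] by blast
    show "poly_fun S (F i)" "\<exists>x\<in>Ch (Suc i). F i x \<noteq> 0" if "i < k" for i using F that by auto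
    show "F i x = 0" if "i < k" "x \<in> Ch i" for i x using F(2) that .
    show "poly_in (Inl ` {..<k}) f" using that(1) unfolding V0_def .
    show "f (graph_point F x) = 0" if "x \<in> Ch k" for x
      using \<open>vanish D f\<close> that unfolding vanish_def D_def by blast
  qed simp
  have "D \<noteq> {}" using b unfolding D_def by auto
  then obtain h where h: "poly_in (V0 \<union> V) h" "\<not> vanish D h"
    "\<forall>z\<in>D. h z \<noteq> 0 \<longrightarrow> (\<forall>c. \<exists>u. tangent (V0 \<union> V) D z u \<and> (\<forall>v\<in>V0. u v = c v))"
    using generic_tangent[OF finV(1,2) _ prime indep] unfolding V0_def V_def by blast
  have polV: "poly_in (V0 \<union> V) (\<lambda>z. g (coords z))" if "poly_fun S g" for g
    using poly_in_of_poly_fun[OF that] unfolding V_def by (rule poly_in_mono) auto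
  have "\<not> vanish D (\<lambda>z. b (coords z))" using b unfolding vanish_def D_def by auto
  then have "\<not> vanish D (\<lambda>z. h z * b (coords z))"
    using prime h(1,2) polV[OF b(1)] unfolding prime_on_def by blast
  then obtain x where x: "x \<in> Ch k" "h (graph_point F x) \<noteq> 0" "b x \<noteq> 0"
    unfolding vanish_def D_def by auto
  define z where "z = graph_point F x"
  have zD: "z \<in> D" unfolding z_def D_def using x by simp
  have "\<exists>u. tangent (V0 \<union> V) D z u \<and> (\<forall>v\<in>V0. u v = (if v = Inl j then 1 else 0))" for j
    using h(3) zD x(2) unfolding z_def by (auto simp del: split_paired_All)
  then obtain u where u: "\<And>j. tangent (V0 \<union> V) D z (u j)"
     "\<And>j v. v \<in> V0 \<Longrightarrow> u j v = (if v = Inl j then 1 else 0)" by metis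
  have "flex (x p) (x q) (x w) (coords (u j) p) (coords (u j) q) (coords (u j) w)"
    if S: "p \<in> S" "q \<in> S" "w \<in> S" and col: "\<forall>y\<in>Ch k. collinear3 (y p) (y q) (y w)" for j p q w
  proof -
    define f where "f z = (fst (coords z q) - fst (coords z p)) * (snd (coords z w) - snd (coords z p))
        - (snd (coords z q) - snd (coords z p)) * (fst (coords z w) - fst (coords z p))" for z :: "nat + 'a \<times> bool \<Rightarrow> complex"
    have "poly_in (V0 \<union> V) f" unfolding f_def coords_def fst_conv snd_conv
      by (intro poly_in_diff poly_in_mult poly_in_var) (use S in \<open>auto simp: V_def\<close>)
    moreover have "vanish D f" using col unfolding vanish_def D_def f_def collinear3_def by auto
    ultimately have "dir_deriv f z (u j) = 0" using u(1) unfolding tangent_def by blast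
    then show ?thesis unfolding f_def[abs_def] dir_deriv_collinear by (simp add: z_def)
  qed
  moreover have "c j = 0"
    if c: "\<forall>s\<in>S. (\<Sum>j<k. c j * fst (coords (u j) s)) = 0 \<and> (\<Sum>j<k. c j * snd (coords (u j) s)) = 0" and j: "j < k" for c j
  proof -
    \<comment> \<open>\<open>F j\<close> as a polynomial in the point coordinates. It agrees on D
      with the coordinate \<open>Inl j\<close>, so its derivative along \<open>u i\<close> is 1 or
      0, although it only sees the point part of \<open>u i\<close>. A combination with zero point
      part therefore has \<open>c j\<close> = 0.\<close>
    define G where "G z = F j (coords z)" for z :: "nat + 'a \<times> bool \<Rightarrow> complex"
    have GV: "poly_in V G" using poly_in_of_poly_fun[OF F(1)[OF j]] unfolding G_def V_def .
    have GW: "poly_in (V0 \<union> V) G" using polV[OF F(1)[OF j]] unfolding G_def .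
    have ddG: "dir_deriv G z (u i) = (if i = j then 1 else 0)" for i
    proof -
      have Ij: "Inl j \<in> V0" using j unfolding V0_def by simp
      have pI: "poly_in (V0 \<union> V) (\<lambda>z. z (Inl j))" using Ij by (intro poly_in_var) auto
      have pm: "poly_in (V0 \<union> V) (\<lambda>z. - 1 * z (Inl j))" by (intro poly_in_mult poly_in_const pI)
      have "vanish D (\<lambda>z. G z + - 1 * z (Inl j))" unfolding vanish_def D_def G_def by auto
      then have "dir_deriv (\<lambda>z. G z + - 1 * z (Inl j)) z (u i) = 0"
        using u(1)[of i] poly_in_add[OF GW pm] unfolding tangent_def by blast
      then show ?thesis
        by (subst (asm) dir_deriv_add[OF GW pm finV(3)], subst (asm) dir_deriv_mult[OF poly_in_const pI finV(3)])
           (simp add: dir_deriv_const dir_deriv_var u(2)[OF Ij])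
    qed
    have "c j = (\<Sum>i<k. c i * dir_deriv G z (u i))" unfolding ddG using j by (simp add: if_distrib cong: if_cong)
    also have "\<dots> = dir_deriv G z (\<lambda>v. \<Sum>i<k. c i * u i v)" by (rule dir_deriv_sum_cmul[OF GV finV(1), symmetric])
    also have "\<dots> = dir_deriv G z (\<lambda>v. \<Sum>i\<in>{}. c i * u i v)"
    proof (rule dir_deriv_cong[OF GV finV(1)])
      fix v assume "v \<in> V"
      then obtain s e where "v = Inr (s, e)" "s \<in> S" unfolding V_def by auto
      then show "(\<Sum>i<k. c i * u i v) = (\<Sum>i\<in>{}. c i * u i v)" using c by (cases e) (auto simp: coords_def)
    qed
    also have "\<dots> = 0" by (subst dir_deriv_sum_cmul[OF GV finV(1)]) simp
    finally show ?thesis .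
  qed
  ultimately show ?thesis using x(1,3)
    by (intro bexI[of _ x] conjI exI[of _ "\<lambda>j. coords (u j)"]) auto
qed

section \<open>Rank of block design systems\<close>

definition orthonormal_on :: "'i set \<Rightarrow> nat \<Rightarrow> (nat \<Rightarrow> 'i \<Rightarrow> complex) \<Rightarrow> bool" where
  "orthonormal_on J k W \<longleftrightarrow>
     (\<forall>j<k. \<forall>l<k. (\<Sum>i\<in>J. W j i * cnj (W l i)) = (if j = l then 1 else 0))"

text \<open>Gram-Schmidt. The second conjunct is kept because homogeneous linear equations satisfied
  by U have to pass to W.\<close>

lemma orthonormalize:
  fixes U :: "nat \<Rightarrow> 'i \<Rightarrow> complex"
  assumes fin: "finite J"
    and indep: "\<And>c. \<forall>i\<in>J. (\<Sum>j<k. c j * U j i) = 0 \<Longrightarrow> \<forall>j<k. c j = 0"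
  shows "\<exists>W. orthonormal_on J k W \<and> (\<forall>j<k. \<exists>c. \<forall>i. W j i = (\<Sum>l<k. c l * U l i))"
  using indep
proof (induction k)
  case 0
  then show ?case by (simp add: orthonormal_on_def)
next
  case (Suc k)
  have "\<forall>j<k. c j = 0" if "\<forall>i\<in>J. (\<Sum>j<k. c j * U j i) = 0" for c
  proof -
    have "\<forall>j<Suc k. (c(k := 0)) j = 0" using Suc.prems[of "c(k := 0)"] that by simp
    then show ?thesis by (metis fun_upd_other less_SucI nat_neq_iff)
  qed
  then obtain W where W: "orthonormal_on J k W" "\<forall>j<k. \<exists>c. \<forall>i. W j i = (\<Sum>l<k. c l * U l i)"
    using Suc.IH by blast
  then obtain C where C: "\<And>j i. j < k \<Longrightarrow> W j i = (\<Sum>l<k. C j l * U l i)" by metis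
  define a where "a l = (\<Sum>i\<in>J. U k i * cnj (W l i))" for l
  define v where "v i = U k i - (\<Sum>l<k. a l * W l i)" for i
  define d where "d m = (if m = k then 1 else - (\<Sum>l<k. a l * C l m))" for m
  have v_eq: "v i = (\<Sum>m<Suc k. d m * U m i)" for i
  proof -
    have "(\<Sum>l<k. a l * W l i) = (\<Sum>l<k. \<Sum>m<k. a l * C l m * U m i)"
      by (intro sum.cong refl) (simp add: C sum_distrib_left mult.assoc)
    also have "\<dots> = (\<Sum>m<k. (\<Sum>l<k. a l * C l m) * U m i)"
      by (subst sum.swap) (simp add: sum_distrib_right)
    finally show ?thesis by (simp add: v_def d_def sum_negf)
  qed
  define n2 where "n2 = (\<Sum>i\<in>J. (cmod (v i))\<^sup>2)"
  have "n2 > 0"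
  proof (rule ccontr)
    assume "\<not> n2 > 0"
    then have "n2 = 0" unfolding n2_def by (meson not_less order_antisym sum_nonneg zero_le_power2)
    then have "\<forall>i\<in>J. v i = 0" unfolding n2_def using fin by (simp add: sum_nonneg_eq_0_iff)
    then have "d k = 0" using Suc.prems[of d] unfolding v_eq by blast
    then show False by (simp add: d_def)
  qed
  define n where "n = complex_of_real (sqrt n2)"
  have n: "n \<noteq> 0" "n * cnj n = complex_of_real n2"
    using \<open>n2 > 0\<close> unfolding n_def by (auto simp flip: of_real_mult)
  have vv: "(\<Sum>i\<in>J. v i * cnj (v i)) = complex_of_real n2"
    unfolding n2_def of_real_sum complex_norm_square ..
  have vW: "(\<Sum>i\<in>J. v i * cnj (W l i)) = 0" if l: "l < k" for l
  proof -
    have "(\<Sum>i\<in>J. v i * cnj (W l i)) = a l - (\<Sum>i\<in>J. \<Sum>m<k. a m * (W m i * cnj (W l i)))"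
      unfolding v_def a_def by (simp add: left_diff_distrib sum_subtractf sum_distrib_right mult.assoc)
    also have "(\<Sum>i\<in>J. \<Sum>m<k. a m * (W m i * cnj (W l i))) = (\<Sum>m<k. a m * (\<Sum>i\<in>J. W m i * cnj (W l i)))"
      by (subst sum.swap) (simp add: sum_distrib_left)
    also have "\<dots> = (\<Sum>m<k. a m * (if m = l then 1 else 0))"
      using W(1) l unfolding orthonormal_on_def by (intro sum.cong) auto
    also have "\<dots> = a l" using l by (simp add: if_distrib cong: if_cong)
    finally show ?thesis by simp
  qed
  have Wv: "(\<Sum>i\<in>J. W l i * cnj (v i)) = 0" if l: "l < k" for l
  proof -
    have "(\<Sum>i\<in>J. W l i * cnj (v i)) = cnj (\<Sum>i\<in>J. v i * cnj (W l i))" by (simp add: mult.commute)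
    then show ?thesis using vW[OF l] by simp
  qed
  define W' where "W' = W(k := \<lambda>i. v i / n)"
  have "orthonormal_on J (Suc k) W'"
    unfolding orthonormal_on_def
  proof (intro allI impI)
    fix j l assume jl: "j < Suc k" "l < Suc k"
    consider "j < k" "l < k" | "j = k" "l < k" | "j < k" "l = k" | "j = k" "l = k" using jl by linarith
    then show "(\<Sum>i\<in>J. W' j i * cnj (W' l i)) = (if j = l then 1 else 0)"
    proof cases
      case 1
      then show ?thesis using W(1) by (simp add: W'_def orthonormal_on_def)
    next
      case 2
      then have "(\<Sum>i\<in>J. W' j i * cnj (W' l i)) = (\<Sum>i\<in>J. v i * cnj (W l i)) / n"
        by (simp add: W'_def sum_divide_distrib)
      then show ?thesis using vW 2 by simp
    next
      case 3
      then have "(\<Sum>i\<in>J. W' j i * cnj (W' l i)) = (\<Sum>i\<in>J. W j i * cnj (v i)) / cnj n"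
        by (simp add: W'_def sum_divide_distrib)
      then show ?thesis using Wv 3 by simp
    next
      case 4
      then have "(\<Sum>i\<in>J. W' j i * cnj (W' l i)) = (\<Sum>i\<in>J. v i * cnj (v i)) / (n * cnj n)"
        by (simp add: W'_def sum_divide_distrib)
      then show ?thesis using 4 vv n \<open>n2 > 0\<close> by simp
    qed
  qed
  moreover have "\<exists>c. \<forall>i. W' j i = (\<Sum>l<Suc k. c l * U l i)" if "j < Suc k" for j
  proof (cases "j = k")
    case True
    have "W' j i = (\<Sum>l<Suc k. (d l / n) * U l i)" for i
      using True unfolding W'_def by (simp only: fun_upd_same v_eq sum_divide_distrib) simp
    then show ?thesis by (intro exI[of _ "\<lambda>l. d l / n"]) blast
  next
    case False
    then have "W' j i = (\<Sum>l<Suc k. ((C j)(k := 0)) l * U l i)" for i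
      using that by (simp add: W'_def C)
    then show ?thesis by (intro exI[of _ "(C j)(k := 0)"]) blast
  qed
  ultimately show ?case by (intro exI[of _ W']) blast
qed

text \<open>The residual x of \<beta> has nonnegative squared norm. The pairing of \<beta> with
  \<open>W j\<close> is bilinear, hence the residual is formed with the conjugates of
  \<open>W j\<close>, which are orthonormal as well.\<close>

lemma bessel:
  assumes W: "orthonormal_on J k W"
  shows "(\<Sum>j<k. (cmod (\<Sum>i\<in>J. \<beta> i * W j i))\<^sup>2) \<le> (\<Sum>i\<in>J. (cmod (\<beta> i))\<^sup>2)"
proof -
  define b where "b j = (\<Sum>i\<in>J. \<beta> i * W j i)" for j
  define x where "x i = \<beta> i - (\<Sum>j<k. b j * cnj (W j i))" for i
  have x_cnj: "cnj (x i) = cnj (\<beta> i) - (\<Sum>l<k. cnj (b l) * W l i)" for i by (simp add: x_def)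
  have A: "(\<Sum>i\<in>J. (\<Sum>j<k. b j * cnj (W j i)) * cnj (\<beta> i)) = (\<Sum>j<k. b j * cnj (b j))"
    by (simp add: sum_distrib_right sum_distrib_left b_def mult_ac) (subst sum.swap, simp add: mult_ac)
  have B: "(\<Sum>i\<in>J. \<beta> i * (\<Sum>l<k. cnj (b l) * W l i)) = (\<Sum>j<k. b j * cnj (b j))"
  proof -
    have "(\<Sum>i\<in>J. \<beta> i * (\<Sum>l<k. cnj (b l) * W l i)) = (\<Sum>l<k. \<Sum>i\<in>J. cnj (b l) * (\<beta> i * W l i))"
      unfolding sum_distrib_left by (subst sum.swap) (simp add: mult_ac)
    also have "\<dots> = (\<Sum>l<k. cnj (b l) * b l)" by (simp add: sum_distrib_left b_def)
    finally show ?thesis by (simp add: mult_ac)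
  qed
  have D: "(\<Sum>i\<in>J. (\<Sum>j<k. b j * cnj (W j i)) * (\<Sum>l<k. cnj (b l) * W l i)) = (\<Sum>j<k. b j * cnj (b j))"
  proof -
    have "(\<Sum>i\<in>J. (\<Sum>j<k. b j * cnj (W j i)) * (\<Sum>l<k. cnj (b l) * W l i)) =
      (\<Sum>i\<in>J. \<Sum>j<k. \<Sum>l<k. b j * cnj (b l) * (W l i * cnj (W j i)))"
      by (simp add: sum_product mult_ac)
    also have "\<dots> = (\<Sum>j<k. \<Sum>l<k. b j * cnj (b l) * (\<Sum>i\<in>J. W l i * cnj (W j i)))"
      by (subst sum.swap, intro sum.cong refl, subst sum.swap) (simp add: sum_distrib_left)
    also have "\<dots> = (\<Sum>j<k. \<Sum>l<k. b j * cnj (b l) * (if l = j then 1 else 0))"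
      using W unfolding orthonormal_on_def by (intro sum.cong refl) auto
    also have "\<dots> = (\<Sum>j<k. b j * cnj (b j))"
      by (intro sum.cong refl) (simp add: if_distrib cong: if_cong)
    finally show ?thesis .
  qed
  have "(\<Sum>i\<in>J. x i * cnj (x i)) = (\<Sum>i\<in>J. \<beta> i * cnj (\<beta> i)) - (\<Sum>j<k. b j * cnj (b j))"
    unfolding x_cnj unfolding x_def
    by (simp add: left_diff_distrib right_diff_distrib sum_subtractf A B D)
  then have "complex_of_real (\<Sum>i\<in>J. (cmod (x i))\<^sup>2) =
     complex_of_real ((\<Sum>i\<in>J. (cmod (\<beta> i))\<^sup>2) - (\<Sum>j<k. (cmod (b j))\<^sup>2))"
    unfolding of_real_diff of_real_sum complex_norm_square .
  then have "(\<Sum>i\<in>J. (cmod (x i))\<^sup>2) = (\<Sum>i\<in>J. (cmod (\<beta> i))\<^sup>2) - (\<Sum>j<k. (cmod (b j))\<^sup>2)"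
    by (simp only: of_real_eq_iff)
  moreover have "(\<Sum>i\<in>J. (cmod (x i))\<^sup>2) \<ge> 0" by (simp add: sum_nonneg)
  ultimately show ?thesis by (simp add: b_def)
qed


text \<open>
  Summing over an orthonormal basis of the solution space, the dimension is bounded by the squared
  Frobenius norm of the off-diagonal part of the Gram matrix relative to its diagonal blocks.  Since
  two elements share at most one block, each off-diagonal block has norm at most 1.
\<close>
lemma gram_bound:
  fixes r :: "'q set \<Rightarrow> 'q \<Rightarrow> bool \<Rightarrow> complex" and U :: "nat \<Rightarrow> 'q \<Rightarrow> bool \<Rightarrow> complex"
  assumes fin: "finite Q" and T: "\<And>t. t \<in> T \<Longrightarrow> t \<subseteq> Q"
    and pair: "\<And>t t' p q. t \<in> T \<Longrightarrow> t' \<in> T \<Longrightarrow> {p, q} \<subseteq> t \<Longrightarrow> {p, q} \<subseteq> t' \<Longrightarrow> p \<noteq> q \<Longrightarrow> t = t'"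
    and norm: "\<And>t p. t \<in> T \<Longrightarrow> p \<in> t \<Longrightarrow> (\<Sum>e\<in>UNIV. (cmod (r t p e))\<^sup>2) \<le> 1"
    and lower: "\<And>p u. p \<in> Q \<Longrightarrow>
      \<mu> * (\<Sum>e\<in>UNIV. (cmod (u e))\<^sup>2) \<le> (\<Sum>t\<in>{t\<in>T. p \<in> t}. (cmod (\<Sum>e\<in>UNIV. r t p e * u e))\<^sup>2)"
    and \<mu>: "\<mu> > 0"
    and ker: "\<And>j t. j < k \<Longrightarrow> t \<in> T \<Longrightarrow> (\<Sum>p\<in>t. \<Sum>e\<in>UNIV. r t p e * U j p e) = 0"
    and indep: "\<And>c. \<forall>p\<in>Q. \<forall>e. (\<Sum>j<k. c j * U j p e) = 0 \<Longrightarrow> \<forall>j<k. c j = 0"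
  shows "real k \<le> (real (card Q))\<^sup>2 / \<mu>\<^sup>2"
proof -
  define J where "J = Q \<times> (UNIV :: bool set)"
  have finJ: "finite J" unfolding J_def using fin by simp
  have finT: "finite T" using T fin by (meson Sup_least finite_UnionD finite_subset)
  obtain W0 where W0: "orthonormal_on J k W0"
      "\<forall>j<k. \<exists>c. \<forall>i. W0 j i = (\<Sum>l<k. c l * (\<lambda>(p, e). U l p e) i)"
    using orthonormalize[OF finJ, where k = k and U = "\<lambda>l (p, e). U l p e"] indep
    unfolding J_def by auto
  define W where "W j p e = W0 j (p, e)" for j p e
  have kerW: "(\<Sum>p\<in>t. \<Sum>e\<in>UNIV. r t p e * W j p e) = 0" if j: "j < k" and t: "t \<in> T" for j t
  proof -
    obtain c where c: "\<And>i. W0 j i = (\<Sum>l<k. c l * (\<lambda>(p, e). U l p e) i)" using W0(2) j by blast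
    have "(\<Sum>p\<in>t. \<Sum>e\<in>UNIV. r t p e * W j p e) = (\<Sum>p\<in>t. \<Sum>e\<in>UNIV. \<Sum>l<k. c l * (r t p e * U l p e))"
      unfolding W_def c by (simp add: sum_distrib_left mult_ac)
    also have "\<dots> = (\<Sum>p\<in>t. \<Sum>l<k. c l * (\<Sum>e\<in>UNIV. r t p e * U l p e))"
      by (subst sum.swap) (simp add: sum_distrib_left)
    also have "\<dots> = (\<Sum>l<k. c l * (\<Sum>p\<in>t. \<Sum>e\<in>UNIV. r t p e * U l p e))"
      by (subst sum.swap) (simp add: sum_distrib_left)
    also have "\<dots> = 0" using ker t by simp
    finally show ?thesis .
  qed
  \<comment> \<open>Row (p, e) of the Gram matrix R^H R with its diagonal block removed, where R is
    the matrix with rows \<open>r t\<close>.\<close>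
  define \<beta> where "\<beta> p e = (\<lambda>(q, e'). \<Sum>t\<in>{t\<in>T. p \<in> t \<and> q \<in> t \<and> q \<noteq> p}. cnj (r t p e) * r t q e')" for p e
  have \<beta>_bound: "(\<Sum>e\<in>UNIV. \<Sum>i\<in>J. (cmod (\<beta> p e i))\<^sup>2) \<le> card Q" if p: "p \<in> Q" for p
  proof -
    have q: "(\<Sum>e\<in>UNIV. \<Sum>e'\<in>UNIV. (cmod (\<beta> p e (q, e')))\<^sup>2) \<le> 1" for q
    proof (cases "\<exists>t\<in>T. p \<in> t \<and> q \<in> t \<and> q \<noteq> p")
      case True
      then obtain t where t: "t \<in> T" "p \<in> t" "q \<in> t" "q \<noteq> p" by blast
      have eq: "{t\<in>T. p \<in> t \<and> q \<in> t \<and> q \<noteq> p} = {t}"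
      proof (intro equalityI subsetI)
        fix t' assume "t' \<in> {t\<in>T. p \<in> t \<and> q \<in> t \<and> q \<noteq> p}"
        then have "t' = t" using pair[of t' t p q] t by simp
        then show "t' \<in> {t}" by simp
      qed (use t in simp)
      have "(\<Sum>e\<in>UNIV. \<Sum>e'\<in>UNIV. (cmod (\<beta> p e (q, e')))\<^sup>2)
        = (\<Sum>e\<in>UNIV. (cmod (r t p e))\<^sup>2) * (\<Sum>e'\<in>UNIV. (cmod (r t q e'))\<^sup>2)"
        unfolding \<beta>_def case_prod_conv eq sum_product by (simp add: norm_mult power_mult_distrib)
      also have "\<dots> \<le> 1" using mult_mono[OF norm[OF t(1,2)] norm[OF t(1,3)]] by (simp add: sum_nonneg)
      finally show ?thesis .
    next
      case False
      then have eq: "{t\<in>T. p \<in> t \<and> q \<in> t \<and> q \<noteq> p} = {}" by blast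
      then show ?thesis by (simp add: \<beta>_def eq)
    qed
    have "(\<Sum>e\<in>UNIV. \<Sum>i\<in>J. (cmod (\<beta> p e i))\<^sup>2) =
        (\<Sum>e\<in>UNIV. \<Sum>q\<in>Q. \<Sum>e'\<in>UNIV. (cmod (\<beta> p e (q, e')))\<^sup>2)"
      unfolding J_def by (simp add: sum.cartesian_product)
    also have "\<dots> = (\<Sum>q\<in>Q. \<Sum>e\<in>UNIV. \<Sum>e'\<in>UNIV. (cmod (\<beta> p e (q, e')))\<^sup>2)"
      by (subst sum.swap) simp
    also have "\<dots> \<le> (\<Sum>q\<in>Q. 1)" by (intro sum_mono q)
    finally show ?thesis by simp
  qed
  have point: "\<mu>\<^sup>2 * (\<Sum>e\<in>UNIV. (cmod (W j p e))\<^sup>2) \<le> (\<Sum>e\<in>UNIV. (cmod (\<Sum>i\<in>J. \<beta> p e i * W0 j i))\<^sup>2)"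
    if j: "j < k" and p: "p \<in> Q" for j p
  proof -
    define \<rho> where "\<rho> t = (\<Sum>e\<in>UNIV. r t p e * W j p e)" for t
    define y where "y e = (\<Sum>i\<in>J. \<beta> p e i * W0 j i)" for e
    define Tp where "Tp = {t\<in>T. p \<in> t}"
    \<comment> \<open>Row t annihilates W, so what the other elements of t contribute is the
      negative of the contribution \<rho> of p.\<close>
    have y_eq: "y e = - (\<Sum>t\<in>Tp. cnj (r t p e) * \<rho> t)" for e
    proof -
      have "y e = (\<Sum>q\<in>Q. \<Sum>e'\<in>UNIV. \<beta> p e (q, e') * W j q e')"
        unfolding y_def J_def W_def by (simp add: sum.cartesian_product split_beta)
      also have "\<dots> = (\<Sum>q\<in>Q. \<Sum>t\<in>{t\<in>Tp. q \<in> t \<and> q \<noteq> p}. cnj (r t p e) * (\<Sum>e'\<in>UNIV. r t q e' * W j q e'))"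
      proof (intro sum.cong refl)
        fix q
        have s: "{t\<in>T. p \<in> t \<and> q \<in> t \<and> q \<noteq> p} = {t\<in>Tp. q \<in> t \<and> q \<noteq> p}" unfolding Tp_def by auto
        show "(\<Sum>e'\<in>UNIV. \<beta> p e (q, e') * W j q e') =
           (\<Sum>t\<in>{t\<in>Tp. q \<in> t \<and> q \<noteq> p}. cnj (r t p e) * (\<Sum>e'\<in>UNIV. r t q e' * W j q e'))"
          unfolding \<beta>_def case_prod_conv s sum_distrib_right sum_distrib_left
          by (subst sum.swap) (simp add: mult_ac)
      qed
      also have "\<dots> = (\<Sum>t\<in>Tp. \<Sum>q\<in>{q\<in>Q. q \<in> t \<and> q \<noteq> p}. cnj (r t p e) * (\<Sum>e'\<in>UNIV. r t q e' * W j q e'))"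
        by (rule sum.swap_restrict) (use fin finT in \<open>auto simp: Tp_def\<close>)
      also have "\<dots> = (\<Sum>t\<in>Tp. - (cnj (r t p e) * \<rho> t))"
      proof (intro sum.cong refl)
        fix t assume t: "t \<in> Tp"
        have tq: "{q\<in>Q. q \<in> t \<and> q \<noteq> p} = t - {p}" using T t unfolding Tp_def by auto
        have ft: "finite t" using T t fin unfolding Tp_def by (auto intro: finite_subset)
        have "(\<Sum>q\<in>t. \<Sum>e'\<in>UNIV. r t q e' * W j q e') = 0" using kerW[OF j] t unfolding Tp_def by blast
        then have "(\<Sum>q\<in>t-{p}. \<Sum>e'\<in>UNIV. r t q e' * W j q e') = - \<rho> t"
          using sum.remove[OF ft, of p "\<lambda>q. \<Sum>e'\<in>UNIV. r t q e' * W j q e'"] t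
          unfolding \<rho>_def Tp_def by (simp add: add_eq_0_iff del: UNIV_bool)
        then show "(\<Sum>q\<in>{q\<in>Q. q \<in> t \<and> q \<noteq> p}. cnj (r t p e) * (\<Sum>e'\<in>UNIV. r t q e' * W j q e')) = - (cnj (r t p e) * \<rho> t)"
          unfolding tq by (simp add: sum_distrib_left[symmetric] del: UNIV_bool)
      qed
      finally show ?thesis by (simp add: sum_negf)
    qed
    define A where "A = (\<Sum>e\<in>UNIV. (cmod (W j p e))\<^sup>2)"
    define Y where "Y = (\<Sum>e\<in>UNIV. (cmod (y e))\<^sup>2)"
    have A0: "A \<ge> 0" "Y \<ge> 0" unfolding A_def Y_def by (simp_all add: sum_nonneg)
    define R where "R = (\<Sum>t\<in>Tp. (cmod (\<rho> t))\<^sup>2)"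
    have lR: "\<mu> * A \<le> R" using lower[OF p, of "W j p"] unfolding A_def R_def \<rho>_def Tp_def .
    \<comment> \<open>Pairing y with W at p gives -R, the negative of the diagonal quadratic form.
      With Cauchy-Schwarz, \<mu> A \<le> R \<le> sqrt (Y A), and hence \<mu>^2 A \<le> Y.\<close>
    have "(\<Sum>e\<in>UNIV. y e * cnj (W j p e)) = - (\<Sum>e\<in>UNIV. \<Sum>t\<in>Tp. cnj (r t p e * W j p e) * \<rho> t)"
      unfolding y_eq by (simp add: sum_distrib_left sum_distrib_right sum_negf mult_ac del: UNIV_bool)
    also have "\<dots> = - (\<Sum>t\<in>Tp. cnj (\<rho> t) * \<rho> t)"
    proof -
      have "(\<Sum>e\<in>UNIV. cnj (r t p e * W j p e) * \<rho> t) = cnj (\<rho> t) * \<rho> t" for t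
        unfolding \<rho>_def[of t] cnj_sum sum_distrib_right ..
      then show ?thesis by (subst sum.swap) (simp del: UNIV_bool)
    qed
    also have "\<dots> = - complex_of_real R"
      unfolding R_def of_real_sum complex_norm_square by (simp add: mult.commute)
    finally have "cmod (\<Sum>e\<in>UNIV. y e * cnj (W j p e)) = \<bar>R\<bar>"
      by (simp only: norm_minus_cancel norm_of_real)
    moreover have "R \<ge> 0" unfolding R_def by (simp add: sum_nonneg)
    ultimately have "R = cmod (\<Sum>e\<in>UNIV. y e * cnj (W j p e))" by simp
    also have "\<dots> \<le> (\<Sum>e\<in>UNIV. cmod (y e) * cmod (W j p e))"
      by (rule order_trans[OF norm_sum]) (simp add: norm_mult)
    finally have RY: "R \<le> (\<Sum>e\<in>UNIV. cmod (y e) * cmod (W j p e))" .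
    have "(\<Sum>e\<in>UNIV. cmod (y e) * cmod (W j p e))\<^sup>2 \<le> Y * A"
      unfolding Y_def A_def by (rule Cauchy_Schwarz_ineq_sum)
    moreover have "(\<mu> * A)\<^sup>2 \<le> (\<Sum>e\<in>UNIV. cmod (y e) * cmod (W j p e))\<^sup>2"
      using lR RY \<mu> A0 by (intro power_mono) auto
    ultimately have "\<mu>\<^sup>2 * A * A \<le> Y * A" by (simp add: power2_eq_square mult_ac)
    then have "\<mu>\<^sup>2 * A \<le> Y" using A0 by (cases "A = 0") auto
    then show ?thesis unfolding A_def Y_def y_def .
  qed
  have one: "(\<Sum>p\<in>Q. \<Sum>e\<in>UNIV. (cmod (W j p e))\<^sup>2) = 1" if j: "j < k" for j
  proof -
    have "complex_of_real (\<Sum>p\<in>Q. \<Sum>e\<in>UNIV. (cmod (W j p e))\<^sup>2) = (\<Sum>i\<in>J. W0 j i * cnj (W0 j i))"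
      unfolding J_def W_def of_real_sum complex_norm_square by (simp add: sum.cartesian_product split_beta del: UNIV_bool)
    also have "\<dots> = 1" using W0(1) j unfolding orthonormal_on_def by simp
    finally show ?thesis by (simp only: of_real_eq_1_iff)
  qed
  have "\<mu>\<^sup>2 * real k = (\<Sum>j<k. \<mu>\<^sup>2 * (\<Sum>p\<in>Q. \<Sum>e\<in>UNIV. (cmod (W j p e))\<^sup>2))"
    by (simp add: one)
  also have "\<dots> \<le> (\<Sum>j<k. \<Sum>p\<in>Q. \<Sum>e\<in>UNIV. (cmod (\<Sum>i\<in>J. \<beta> p e i * W0 j i))\<^sup>2)"
    unfolding sum_distrib_left[of "\<mu>\<^sup>2" _ Q] by (intro sum_mono point) auto
  also have "\<dots> = (\<Sum>p\<in>Q. \<Sum>e\<in>UNIV. \<Sum>j<k. (cmod (\<Sum>i\<in>J. \<beta> p e i * W0 j i))\<^sup>2)"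
    by (subst sum.swap, intro sum.cong refl, subst sum.swap) simp
  also have "\<dots> \<le> (\<Sum>p\<in>Q. \<Sum>e\<in>UNIV. \<Sum>i\<in>J. (cmod (\<beta> p e i))\<^sup>2)"
    by (intro sum_mono bessel[OF W0(1)])
  also have "\<dots> \<le> (\<Sum>p\<in>Q. real (card Q))" by (intro sum_mono \<beta>_bound)
  also have "\<dots> = (real (card Q))\<^sup>2" by (simp add: power2_eq_square)
  finally show ?thesis using \<mu> by (simp add: field_simps)
qed

section \<open>Two by two matrices and radial position\<close>

definition nrm2 :: "(bool \<Rightarrow> complex) \<Rightarrow> real" where
  "nrm2 a = (cmod (a True))\<^sup>2 + (cmod (a False))\<^sup>2"

definition cross2 :: "(bool \<Rightarrow> complex) \<Rightarrow> (bool \<Rightarrow> complex) \<Rightarrow> complex" where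
  "cross2 a b = a True * b False - a False * b True"

definition app2 :: "(bool \<Rightarrow> bool \<Rightarrow> complex) \<Rightarrow> (bool \<Rightarrow> complex) \<Rightarrow> bool \<Rightarrow> complex" where
  "app2 M a e = M e True * a True + M e False * a False"

definition det2 :: "(bool \<Rightarrow> bool \<Rightarrow> complex) \<Rightarrow> complex" where
  "det2 M = M True True * M False False - M True False * M False True"

lemma cross2_app2: "cross2 (app2 M a) (app2 M b) = det2 M * cross2 a b"
  unfolding cross2_def app2_def det2_def by algebra

lemma nrm2_nonneg [simp]: "nrm2 a \<ge> 0"
  by (simp add: nrm2_def)

lemma nrm2_of_real: "complex_of_real (nrm2 a) = a True * cnj (a True) + a False * cnj (a False)"
  unfolding nrm2_def of_real_add complex_norm_square ..

text \<open>Hadamard's inequality for two vectors: after the triangle inequality it is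
  Cauchy-Schwarz with the coordinates of b exchanged.\<close>

lemma cross2_le: "(cmod (cross2 a b))\<^sup>2 \<le> nrm2 a * nrm2 b"
proof -
  have "cmod (cross2 a b) \<le> cmod (a True) * cmod (b False) + cmod (a False) * cmod (b True)"
    unfolding cross2_def by (rule order_trans[OF norm_triangle_ineq4]) (simp add: norm_mult)
  then have "(cmod (cross2 a b))\<^sup>2 \<le> (cmod (a True) * cmod (b False) + cmod (a False) * cmod (b True))\<^sup>2"
    by (intro power_mono) auto
  also have "\<dots> \<le> nrm2 a * nrm2 b"
  proof -
    have "(p * s + q * r)\<^sup>2 \<le> (p\<^sup>2 + q\<^sup>2) * (r\<^sup>2 + s\<^sup>2)" for p q r s :: real
      using zero_le_power2[of "p * r - q * s"] by (simp add: power2_eq_square algebra_simps)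
    then show ?thesis unfolding nrm2_def .
  qed
  finally show ?thesis .
qed

text \<open>The matrix (I + (sqrt 2 - 1) u u^H) M. For a unit vector u the component along u is
  multiplied by sqrt 2, the factor for which the squared norm grows by exactly the squared component
  along u.\<close>

definition stretch :: "(bool \<Rightarrow> complex) \<Rightarrow> (bool \<Rightarrow> bool \<Rightarrow> complex) \<Rightarrow> bool \<Rightarrow> bool \<Rightarrow> complex" where
  "stretch u M e c = M e c +
     complex_of_real (sqrt 2 - 1) * u e * (cnj (u True) * M True c + cnj (u False) * M False c)"

lemma stretch_scalar: "complex_of_real (sqrt 2 - 1) * complex_of_real (sqrt 2 - 1) + 2 * complex_of_real (sqrt 2 - 1) = 1"
proof -
  have "(sqrt 2 - 1) * (sqrt 2 - 1) + 2 * (sqrt 2 - 1) = (1::real)" by (simp add: algebra_simps)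
  then show ?thesis by (metis (no_types) of_real_1 of_real_add of_real_mult of_real_numeral)
qed

lemma nrm2_stretch:
  assumes "nrm2 u = 1"
  shows "nrm2 (app2 (stretch u M) a) =
    nrm2 (app2 M a) + (cmod (cnj (u True) * app2 M a True + cnj (u False) * app2 M a False))\<^sup>2"
proof -
  define s where "s = complex_of_real (sqrt 2 - 1)"
  define w W where "w = app2 M a True" and "W = app2 M a False"
  define I where "I = cnj (u True) * w + cnj (u False) * W"
  have s: "s * s + 2 * s = 1" "cnj s = s" using stretch_scalar unfolding s_def by simp_all
  have u: "u True * cnj (u True) + u False * cnj (u False) = 1"
    using assms nrm2_of_real[of u] by simp
  have app: "app2 (stretch u M) a e = app2 M a e + s * u e * I" for e
    unfolding app2_def stretch_def I_def w_def W_def s_def by algebra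
  have cI: "cnj I = u True * cnj w + u False * cnj W" by (simp add: I_def)
  have "complex_of_real (nrm2 (app2 (stretch u M) a)) =
     (w + s * u True * I) * (cnj w + s * cnj (u True) * cnj I) + (W + s * u False * I) * (cnj W + s * cnj (u False) * cnj I)"
    unfolding nrm2_of_real app by (simp add: w_def W_def s)
  also have "\<dots> = w * cnj w + W * cnj W + I * cnj I"
    using s(1) u unfolding cI unfolding I_def by algebra
  also have "\<dots> = complex_of_real (nrm2 (app2 M a) + (cmod I)\<^sup>2)"
    unfolding of_real_add nrm2_of_real complex_norm_square w_def W_def ..
  finally show ?thesis unfolding of_real_eq_iff I_def w_def W_def .
qed

lemma det2_stretch:
  assumes "nrm2 u = 1"
  shows "det2 (stretch u M) = complex_of_real (sqrt 2) * det2 M"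
proof -
  have u: "u True * cnj (u True) + u False * cnj (u False) = 1"
    using assms nrm2_of_real[of u] by simp
  define s where "s = complex_of_real (sqrt 2 - 1)"
  have "det2 (stretch u M) = (1 + s) * det2 M"
    unfolding det2_def stretch_def s_def[symmetric] using u by algebra
  then show ?thesis by (simp add: s_def)
qed


text \<open>
  The rescaling g nearly minimises
  f(g) = (sum over t of ln S t) - (sum over p of deg p / 6 * ln |det (g p)|^2).
  If the diagonal block at p were small in the direction of a unit vector u, stretching g p by the
  factor sqrt 2 along u would lower f by a fixed amount.  Boundedness from below is Hadamard's
  inequality for pairs of non-parallel vectors at p.
\<close>
lemma radial_position:
  fixes \<alpha> :: "'q set \<Rightarrow> 'q \<Rightarrow> bool \<Rightarrow> complex"
  assumes fin: "finite Q" and T: "\<And>t. t \<in> T \<Longrightarrow> t \<subseteq> Q \<and> card t = 3"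
    and nonpar: "\<And>t t' p. t \<in> T \<Longrightarrow> t' \<in> T \<Longrightarrow> t \<noteq> t' \<Longrightarrow> p \<in> t \<Longrightarrow> p \<in> t' \<Longrightarrow> cross2 (\<alpha> t p) (\<alpha> t' p) \<noteq> 0"
    and deg: "\<And>p. p \<in> Q \<Longrightarrow> 2 \<le> card {t\<in>T. p \<in> t}"
  obtains g where "\<And>p. p \<in> Q \<Longrightarrow> det2 (g p) \<noteq> 0"
    and "\<And>t p. t \<in> T \<Longrightarrow> p \<in> t \<Longrightarrow> nrm2 (app2 (g p) (\<alpha> t p)) > 0"
    and "\<And>p u. p \<in> Q \<Longrightarrow> real (card {t\<in>T. p \<in> t}) / 10 * nrm2 u \<le>
      (\<Sum>t\<in>{t\<in>T. p \<in> t}. (cmod (app2 (g p) (\<alpha> t p) True * u True + app2 (g p) (\<alpha> t p) False * u False))\<^sup>2 /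
         (\<Sum>q\<in>t. nrm2 (app2 (g q) (\<alpha> t q))))"
proof -
  define Tp where "Tp p = {t\<in>T. p \<in> t}" for p
  define deg where "deg p = real (card (Tp p))" for p
  have finT: "finite T" using T fin by (meson Sup_least finite_UnionD finite_subset)
  have finTp: "finite (Tp p)" for p unfolding Tp_def using finT by simp
  have deg2: "deg p \<ge> 2" if "p \<in> Q" for p using assms(4)[OF that] unfolding deg_def Tp_def by simp
  define G where "G = {g :: 'q \<Rightarrow> bool \<Rightarrow> bool \<Rightarrow> complex. \<forall>p\<in>Q. det2 (g p) \<noteq> 0}"
  define N where "N g t p = nrm2 (app2 (g p) (\<alpha> t p))" for g t p
  define S where "S g t = (\<Sum>q\<in>t. N g t q)" for g t
  define D where "D g p = ln ((cmod (det2 (g p)))\<^sup>2)" for g and p :: 'q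
  \<comment> \<open>The weight deg p / 6 makes f invariant under a common scaling of all
    \<open>g p\<close>: the degrees add up to three times the number of triples, and the determinant
    is homogeneous of degree 2.\<close>
  define f where "f g = (\<Sum>t\<in>T. ln (S g t)) - (\<Sum>p\<in>Q. deg p / 6 * D g p)" for g
  define K where "K t t' p = ln ((cmod (cross2 (\<alpha> t p) (\<alpha> t' p)))\<^sup>2)" for t t' p
  have had: "N g t p > 0 \<and> N g t' p > 0 \<and> D g p + K t t' p \<le> ln (N g t p) + ln (N g t' p)"
    if g: "g \<in> G" and t: "t \<in> Tp p" "t' \<in> Tp p" "t \<noteq> t'" for g t t' p
  proof -
    have p: "p \<in> Q" using t T unfolding Tp_def by blast
    have c: "cmod (cross2 (\<alpha> t p) (\<alpha> t' p)) > 0" using nonpar t unfolding Tp_def by simp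
    have d: "cmod (det2 (g p)) > 0" using g p unfolding G_def by simp
    have le: "(cmod (det2 (g p)))\<^sup>2 * (cmod (cross2 (\<alpha> t p) (\<alpha> t' p)))\<^sup>2 \<le> N g t p * N g t' p"
      using cross2_le[of "app2 (g p) (\<alpha> t p)" "app2 (g p) (\<alpha> t' p)"]
      unfolding N_def cross2_app2 by (simp add: norm_mult power_mult_distrib)
    moreover have "(cmod (det2 (g p)))\<^sup>2 * (cmod (cross2 (\<alpha> t p) (\<alpha> t' p)))\<^sup>2 > 0" using c d by simp
    ultimately have "N g t p * N g t' p > 0" by linarith
    moreover have "N g t p \<ge> 0" "N g t' p \<ge> 0" unfolding N_def by simp_all
    ultimately have N0: "N g t p > 0" "N g t' p > 0" by (auto simp: zero_less_mult_iff)
    have "D g p + K t t' p = ln ((cmod (det2 (g p)))\<^sup>2 * (cmod (cross2 (\<alpha> t p) (\<alpha> t' p)))\<^sup>2)"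
      unfolding D_def K_def using c d by (subst ln_mult) auto
    also have "\<dots> \<le> ln (N g t p * N g t' p)" using le c d N0 by (subst ln_le_cancel_iff) auto
    also have "\<dots> = ln (N g t p) + ln (N g t' p)" using N0 by (subst ln_mult) auto
    finally show ?thesis using N0 by simp
  qed
  have Npos: "N g t p > 0" if g: "g \<in> G" and t: "t \<in> T" "p \<in> t" for g t p
  proof -
    have p: "p \<in> Q" using T t by blast
    have "\<exists>t'\<in>Tp p. t' \<noteq> t"
    proof (rule ccontr)
      assume "\<not> ?thesis"
      then have "Tp p \<subseteq> {t}" by blast
      then have "card (Tp p) \<le> 1" using card_mono[of "{t}" "Tp p"] by simp
      then show False using deg2[OF p] unfolding deg_def by simp
    qed
    then show ?thesis using had[OF g, of t p] t unfolding Tp_def by blast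
  qed
  have finite_t: "finite t" if "t \<in> T" for t using T[OF that] fin finite_subset by blast
  have NS: "N g t p \<le> S g t" if "t \<in> T" "p \<in> t" for g t p
    unfolding S_def by (rule member_le_sum[OF that(2) _ finite_t[OF that(1)]]) (simp add: N_def)
  \<comment> \<open>Averaging Hadamard's inequality over the ordered pairs of triples at p bounds
    the sum of \<open>ln (N g t p)\<close> from below; the mean of these logarithms over the three
    points of t is at most \<open>ln (S g t)\<close>.\<close>
  define B where "B = (\<Sum>p\<in>Q. (\<Sum>t\<in>Tp p. \<Sum>t'\<in>Tp p - {t}. K t t' p) / (2 * (deg p - 1)) / 3)"
  have lower: "B \<le> f g" if g: "g \<in> G" for g
  proof -
    have "(\<Sum>p\<in>Q. \<Sum>t\<in>Tp p. ln (N g t p)) = (\<Sum>t\<in>T. \<Sum>p\<in>{p\<in>Q. p \<in> t}. ln (N g t p))"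
      unfolding Tp_def by (rule sum.swap_restrict[OF fin finT])
    also have "\<dots> = (\<Sum>t\<in>T. \<Sum>p\<in>t. ln (N g t p))"
      by (intro sum.cong refl) (use T in auto)
    also have "\<dots> \<le> (\<Sum>t\<in>T. 3 * ln (S g t))"
    proof (rule sum_mono)
      fix t assume t: "t \<in> T"
      have "(\<Sum>p\<in>t. ln (N g t p)) \<le> (\<Sum>p\<in>t. ln (S g t))"
      proof (rule sum_mono)
        fix p assume p: "p \<in> t"
        show "ln (N g t p) \<le> ln (S g t)"
          using Npos[OF g t p] NS[OF t p, of g] by (subst ln_le_cancel_iff) auto
      qed
      then show "(\<Sum>p\<in>t. ln (N g t p)) \<le> 3 * ln (S g t)" using T[OF t] by simp
    qed
    finally have 1: "(\<Sum>p\<in>Q. (\<Sum>t\<in>Tp p. ln (N g t p)) / 3) \<le> (\<Sum>t\<in>T. ln (S g t))"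
      by (simp add: sum_divide_distrib[symmetric] sum_distrib_left[symmetric])
    have 2: "(\<Sum>t\<in>Tp p. \<Sum>t'\<in>Tp p - {t}. K t t' p) / (2 * (deg p - 1)) / 3 \<le>
       (\<Sum>t\<in>Tp p. ln (N g t p)) / 3 - deg p / 6 * D g p" if p: "p \<in> Q" for p
    proof -
      define Lp where "Lp = (\<Sum>t\<in>Tp p. ln (N g t p))"
      have cardT: "real (card (Tp p - {t})) = deg p - 1" if "t \<in> Tp p" for t
        using that finTp deg2[OF p] unfolding deg_def by (simp add: of_nat_diff)
      have "(\<Sum>t\<in>Tp p. \<Sum>t'\<in>Tp p - {t}. D g p + K t t' p) \<le> (\<Sum>t\<in>Tp p. \<Sum>t'\<in>Tp p - {t}. ln (N g t p) + ln (N g t' p))"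
        by (intro sum_mono) (use had[OF g] in blast)
      also have "\<dots> = (\<Sum>t\<in>Tp p. (deg p - 1) * ln (N g t p) + (Lp - ln (N g t p)))"
      proof (rule sum.cong[OF refl])
        fix t assume t: "t \<in> Tp p"
        show "(\<Sum>t'\<in>Tp p - {t}. ln (N g t p) + ln (N g t' p)) = (deg p - 1) * ln (N g t p) + (Lp - ln (N g t p))"
          using cardT[OF t] t finTp by (simp add: sum.distrib sum_diff1 Lp_def)
      qed
      also have "\<dots> = 2 * (deg p - 1) * Lp"
        by (simp add: sum.distrib sum_subtractf sum_distrib_left[symmetric] Lp_def[symmetric] deg_def[symmetric] algebra_simps)
      finally have "(\<Sum>t\<in>Tp p. \<Sum>t'\<in>Tp p - {t}. D g p + K t t' p) \<le> 2 * (deg p - 1) * Lp" .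
      moreover have "(\<Sum>t\<in>Tp p. \<Sum>t'\<in>Tp p - {t}. D g p + K t t' p) =
        deg p * (deg p - 1) * D g p + (\<Sum>t\<in>Tp p. \<Sum>t'\<in>Tp p - {t}. K t t' p)"
      proof -
        have "(\<Sum>t\<in>Tp p. \<Sum>t'\<in>Tp p - {t}. D g p) = (\<Sum>t\<in>Tp p. (deg p - 1) * D g p)"
          by (intro sum.cong refl) (simp only: sum_constant cardT)
        then show ?thesis by (simp add: sum.distrib deg_def[symmetric] algebra_simps)
      qed
      ultimately have "(\<Sum>t\<in>Tp p. \<Sum>t'\<in>Tp p - {t}. K t t' p) \<le> (2 * Lp - deg p * D g p) * (deg p - 1)"
        by (simp add: algebra_simps)
      then have "(\<Sum>t\<in>Tp p. \<Sum>t'\<in>Tp p - {t}. K t t' p) / (deg p - 1) \<le> 2 * Lp - deg p * D g p"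
        using deg2[OF p] by (subst pos_divide_le_eq) auto
      then have "(\<Sum>t\<in>Tp p. \<Sum>t'\<in>Tp p - {t}. K t t' p) / (deg p - 1) / 6 \<le> (2 * Lp - deg p * D g p) / 6"
        by (rule divide_right_mono) simp
      also have "\<dots> = Lp / 3 - deg p / 6 * D g p" by (simp add: diff_divide_distrib)
      finally show ?thesis unfolding Lp_def[symmetric] divide_divide_eq_left by (simp add: mult.commute)
    qed
    have "B \<le> (\<Sum>p\<in>Q. (\<Sum>t\<in>Tp p. ln (N g t p)) / 3 - deg p / 6 * D g p)"
      unfolding B_def by (intro sum_mono 2)
    then show ?thesis using 1 unfolding f_def by (simp add: sum_subtractf)
  qed
  have "(\<lambda>p e c. if e = c then 1 else 0) \<in> G" unfolding G_def det2_def by simp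
  then have ne: "f ` G \<noteq> {}" by blast
  have bdd: "bdd_below (f ` G)" using lower by (intro bdd_belowI[of _ B]) auto
  \<comment> \<open>An approximate minimiser suffices: with ln 2 \<ge> 2/3 and degree at least 2, a
    stretch would gain deg p / 6 * ln 2 - deg p / 10 \<ge> deg p / 90 \<ge> 2 / 90, more than the
    slack 1/100.\<close>
  obtain y where y: "y \<in> f ` G" "y < Inf (f ` G) + 1/100"
    using cInf_lessD[OF ne, of "Inf (f ` G) + 1/100"] by auto
  then obtain g where g: "g \<in> G" "f g < Inf (f ` G) + 1/100" by blast
  have near: "f g < f g' + 1/100" if "g' \<in> G" for g'
    using g(2) cInf_lower[OF _ bdd, of "f g'"] that by fastforce
  have unit: "deg p / 10 \<le> (\<Sum>t\<in>Tp p. (cmod (cnj (u True) * app2 (g p) (\<alpha> t p) True + cnj (u False) * app2 (g p) (\<alpha> t p) False))\<^sup>2 / S g t)"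
    if p: "p \<in> Q" and u: "nrm2 u = 1" for p u
  proof (rule ccontr)
    define i where "i t = (cmod (cnj (u True) * app2 (g p) (\<alpha> t p) True + cnj (u False) * app2 (g p) (\<alpha> t p) False))\<^sup>2" for t
    assume "\<not> deg p / 10 \<le> (\<Sum>t\<in>Tp p. (cmod (cnj (u True) * app2 (g p) (\<alpha> t p) True + cnj (u False) * app2 (g p) (\<alpha> t p) False))\<^sup>2 / S g t)"
    then have small: "(\<Sum>t\<in>Tp p. i t / S g t) < deg p / 10" unfolding i_def by simp
    define g' where "g' = g(p := stretch u (g p))"
    have det': "det2 (g' p) = complex_of_real (sqrt 2) * det2 (g p)"
      unfolding g'_def by (simp add: det2_stretch[OF u])
    have dp: "det2 (g p) \<noteq> 0" using g(1) p unfolding G_def by blast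
    have g': "g' \<in> G" using g(1) det' dp unfolding G_def g'_def by auto
    have Dp: "D g' p = D g p + ln 2"
    proof -
      have "(cmod (det2 (g' p)))\<^sup>2 = 2 * (cmod (det2 (g p)))\<^sup>2"
        unfolding det' by (simp add: norm_mult power_mult_distrib)
      then show ?thesis unfolding D_def using dp by (simp add: ln_mult)
    qed
    have Dq: "D g' q = D g q" if "q \<noteq> p" for q unfolding D_def g'_def using that by simp
    have "(\<Sum>q\<in>Q. deg q / 6 * D g' q) = (\<Sum>q\<in>Q. deg q / 6 * D g q) + deg p / 6 * ln 2"
      using sum.remove[OF fin p, of "\<lambda>q. deg q / 6 * D g' q"] sum.remove[OF fin p, of "\<lambda>q. deg q / 6 * D g q"]
        sum.cong[OF refl, of "Q - {p}" "\<lambda>q. deg q / 6 * D g' q" "\<lambda>q. deg q / 6 * D g q"]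
      by (simp add: Dp Dq algebra_simps)
    moreover have "(\<Sum>t\<in>T. ln (S g' t)) \<le> (\<Sum>t\<in>T. ln (S g t)) + (\<Sum>t\<in>Tp p. i t / S g t)"
    proof -
      have St: "ln (S g' t) \<le> ln (S g t) + i t / S g t" if t: "t \<in> T" "p \<in> t" for t
      proof -
        have "N g' t p = N g t p + i t" unfolding N_def g'_def i_def by (simp add: nrm2_stretch[OF u])
        moreover have "N g' t q = N g t q" if "q \<noteq> p" for q unfolding N_def g'_def using that by simp
        ultimately have "S g' t = S g t + i t"
          unfolding S_def sum.remove[OF finite_t[OF t(1)] t(2), of "\<lambda>q. N g' t q"] sum.remove[OF finite_t[OF t(1)] t(2), of "\<lambda>q. N g t q"]
          by simp
        moreover have S0: "S g t > 0" using Npos[OF g(1) t] NS[OF t, of g] by linarith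
        moreover have "i t \<ge> 0" unfolding i_def by simp
        ultimately have eq: "S g' t = S g t * (1 + i t / S g t)" and pos: "S g t > 0" "1 + i t / S g t > 0"
          by (auto simp: field_simps add_pos_nonneg)
        have "ln (S g' t) = ln (S g t) + ln (1 + i t / S g t)"
          unfolding eq by (rule ln_mult_pos[OF pos])
        moreover have "ln (1 + i t / S g t) \<le> i t / S g t"
          using \<open>i t \<ge> 0\<close> S0 by (intro ln_add_one_self_le_self) simp
        ultimately show ?thesis by simp
      qed
      have S': "S g' t = S g t" if "t \<in> T" "p \<notin> t" for t
        unfolding S_def N_def g'_def using that by (intro sum.cong) auto
      have "(\<Sum>t\<in>T. ln (S g' t)) \<le> (\<Sum>t\<in>T. ln (S g t) + (if p \<in> t then i t / S g t else 0))"
        by (intro sum_mono) (use St S' in auto)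
      also have "\<dots> = (\<Sum>t\<in>T. ln (S g t)) + (\<Sum>t\<in>Tp p. i t / S g t)"
        unfolding Tp_def using finT by (simp add: sum.distrib sum.inter_filter)
      finally show ?thesis .
    qed
    ultimately have "f g' \<le> f g + (\<Sum>t\<in>Tp p. i t / S g t) - deg p / 6 * ln 2" unfolding f_def by simp
    then have "f g' < f g + deg p / 10 - deg p / 6 * ln 2" using small by simp
    moreover have "deg p / 6 * ln 2 \<ge> deg p / 6 * (2 / 3)"
      using deg2[OF p] ln2_ge_two_thirds by (intro mult_left_mono) auto
    ultimately have "f g' < f g - 1/100" using deg2[OF p] by linarith
    then show False using near[OF g'] by simp
  qed
  show ?thesis
  proof (rule that[of g])
    show "det2 (g p) \<noteq> 0" if "p \<in> Q" for p using g(1) that unfolding G_def by blast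
    show "nrm2 (app2 (g p) (\<alpha> t p)) > 0" if "t \<in> T" "p \<in> t" for t p
      using Npos[OF g(1) that] unfolding N_def .
    fix p u assume p: "p \<in> Q"
    define F where "F u = (\<Sum>t\<in>Tp p. (cmod (app2 (g p) (\<alpha> t p) True * u True + app2 (g p) (\<alpha> t p) False * u False))\<^sup>2 / S g t)" for u
    have "deg p / 10 * nrm2 u \<le> F u"
    proof (cases "nrm2 u = 0")
      case True
      have "F u \<ge> 0" unfolding F_def S_def N_def by (intro sum_nonneg divide_nonneg_nonneg) (auto intro: sum_nonneg)
      then show ?thesis using True by simp
    next
      case False
      define n where "n = sqrt (nrm2 u)"
      have "nrm2 u > 0" using False nrm2_nonneg[of u] by linarith
      then have n: "n > 0" "n\<^sup>2 = nrm2 u" unfolding n_def by auto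
      \<comment> \<open>Conjugation turns the bilinear pairing of the claim into the Hermitian one
        for which the effect of stretching was computed.\<close>
      define u' where "u' e = cnj (u e) / complex_of_real n" for e
      have "nrm2 u' = nrm2 u / n\<^sup>2" unfolding u'_def nrm2_def using n(1)
        by (simp add: norm_divide power_divide add_divide_distrib)
      then have "nrm2 u' = 1" using n by (simp add: False)
      from unit[OF p this] have "deg p / 10 \<le> F (\<lambda>e. cnj (u' e))" unfolding F_def by (simp add: mult.commute)
      also have "F (\<lambda>e. cnj (u' e)) = F u / n\<^sup>2"
      proof -
        have *: "(cmod (a * cnj (u' True) + b * cnj (u' False)))\<^sup>2 = (cmod (a * u True + b * u False))\<^sup>2 / n\<^sup>2" for a b
        proof -
          have "a * cnj (u' True) + b * cnj (u' False) = (a * u True + b * u False) / complex_of_real n"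
            unfolding u'_def by (simp add: add_divide_distrib)
          then show ?thesis using n(1) by (simp add: norm_divide power_divide)
        qed
        show ?thesis unfolding F_def sum_divide_distrib
          by (intro sum.cong refl) (simp only: * divide_divide_eq_left, simp only: mult.commute)
      qed
      finally have "deg p / 10 * n\<^sup>2 \<le> F u" using n(1) by (simp add: pos_le_divide_eq)
      then show ?thesis unfolding n(2) .
    qed
    then show "real (card {t\<in>T. p \<in> t}) / 10 * nrm2 u \<le>
      (\<Sum>t\<in>{t\<in>T. p \<in> t}. (cmod (app2 (g p) (\<alpha> t p) True * u True + app2 (g p) (\<alpha> t p) False * u False))\<^sup>2 /
         (\<Sum>q\<in>t. nrm2 (app2 (g q) (\<alpha> t q))))"
      unfolding F_def deg_def Tp_def S_def N_def .
  qed
qed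

text \<open>In radial position, with row t divided by sqrt (S t), all rows have norm at most 1 at
  each point and all diagonal blocks are at least \<kappa> / 10; the factor 100 is the square of
  this 10. Solutions are carried over by the inverse transpose of \<open>g p\<close>.\<close>

lemma rank_bound:
  fixes \<alpha> :: "'q set \<Rightarrow> 'q \<Rightarrow> bool \<Rightarrow> complex" and w :: "nat \<Rightarrow> 'q \<Rightarrow> bool \<Rightarrow> complex" and \<kappa> :: real
  assumes fin: "finite Q" and T: "\<And>t. t \<in> T \<Longrightarrow> t \<subseteq> Q \<and> card t = 3"
    and pair: "\<And>t t' p q. t \<in> T \<Longrightarrow> t' \<in> T \<Longrightarrow> {p, q} \<subseteq> t \<Longrightarrow> {p, q} \<subseteq> t' \<Longrightarrow> p \<noteq> q \<Longrightarrow> t = t'"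
    and nonpar: "\<And>t t' p. t \<in> T \<Longrightarrow> t' \<in> T \<Longrightarrow> t \<noteq> t' \<Longrightarrow> p \<in> t \<Longrightarrow> p \<in> t' \<Longrightarrow> cross2 (\<alpha> t p) (\<alpha> t' p) \<noteq> 0"
    and deg: "\<And>p. p \<in> Q \<Longrightarrow> \<kappa> \<le> real (card {t\<in>T. p \<in> t})" and \<kappa>: "\<kappa> \<ge> 2"
    and ker: "\<And>j t. j < k \<Longrightarrow> t \<in> T \<Longrightarrow> (\<Sum>p\<in>t. \<alpha> t p True * w j p True + \<alpha> t p False * w j p False) = 0"
    and indep: "\<And>c. \<forall>p\<in>Q. \<forall>e. (\<Sum>j<k. c j * w j p e) = 0 \<Longrightarrow> \<forall>j<k. c j = 0"
  shows "real k \<le> 100 * (real (card Q))\<^sup>2 / \<kappa>\<^sup>2"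
proof -
  have deg2: "2 \<le> card {t\<in>T. p \<in> t}" if "p \<in> Q" for p using deg[OF that] \<kappa> by linarith
  obtain g where g: "\<And>p. p \<in> Q \<Longrightarrow> det2 (g p) \<noteq> 0"
      "\<And>t p. t \<in> T \<Longrightarrow> p \<in> t \<Longrightarrow> nrm2 (app2 (g p) (\<alpha> t p)) > 0"
      "\<And>p u. p \<in> Q \<Longrightarrow> real (card {t\<in>T. p \<in> t}) / 10 * nrm2 u \<le>
      (\<Sum>t\<in>{t\<in>T. p \<in> t}. (cmod (app2 (g p) (\<alpha> t p) True * u True + app2 (g p) (\<alpha> t p) False * u False))\<^sup>2 /
         (\<Sum>q\<in>t. nrm2 (app2 (g q) (\<alpha> t q))))"
  proof (rule radial_position[where Q = Q and T = T and \<alpha> = \<alpha>])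
    show "cross2 (\<alpha> t p) (\<alpha> t' p) \<noteq> 0" if "t \<in> T" "t' \<in> T" "t \<noteq> t'" "p \<in> t" "p \<in> t'" for t t' p
      using nonpar that by blast
  qed (use fin T deg2 in auto)
  define S where "S t = (\<Sum>q\<in>t. nrm2 (app2 (g q) (\<alpha> t q)))" for t
  define r where "r t p e = app2 (g p) (\<alpha> t p) e / complex_of_real (sqrt (S t))" for t p e
  \<comment> \<open>Cramer's rule for the transpose of \<open>g p\<close>: U solves g^T U = w, so
    that the rescaled coefficients paired with U give the original ones paired with w.\<close>
  define U where "U j p e = (if e then w j p True * g p False False - w j p False * g p False True
      else w j p False * g p True True - w j p True * g p True False) / det2 (g p)" for j p e
  have ft: "finite t" if "t \<in> T" for t using T[OF that] fin finite_subset by blast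
  have Sp: "nrm2 (app2 (g p) (\<alpha> t p)) \<le> S t" "S t > 0" if "t \<in> T" "p \<in> t" for t p
  proof -
    show "nrm2 (app2 (g p) (\<alpha> t p)) \<le> S t" unfolding S_def by (rule member_le_sum[OF that(2) _ ft[OF that(1)]]) simp
    then show "S t > 0" using g(2)[OF that] by linarith
  qed
  have wU: "w j p c = g p True c * U j p True + g p False c * U j p False" if p: "p \<in> Q" for j p c
  proof -
    have d: "det2 (g p) \<noteq> 0" by (rule g(1)[OF p])
    have u: "det2 (g p) * U j p True = w j p True * g p False False - w j p False * g p False True"
      "det2 (g p) * U j p False = w j p False * g p True True - w j p True * g p True False"
      using d by (simp_all add: U_def)
    have "det2 (g p) * (g p True c * U j p True + g p False c * U j p False) =
      g p True c * (w j p True * g p False False - w j p False * g p False True) +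
      g p False c * (w j p False * g p True True - w j p True * g p True False)"
      unfolding u[symmetric] by (simp add: algebra_simps)
    also have "\<dots> = det2 (g p) * w j p c"
      unfolding det2_def by (cases c) (simp_all add: algebra_simps)
    finally show ?thesis using d by simp
  qed
  have "real k \<le> (real (card Q))\<^sup>2 / (\<kappa> / 10)\<^sup>2"
  proof (rule gram_bound[where T = T and r = r and U = U])
    show "finite Q" by fact
    show "t \<subseteq> Q" if "t \<in> T" for t using T that by blast
    show "t = t'" if "t \<in> T" "t' \<in> T" "{p, q} \<subseteq> t" "{p, q} \<subseteq> t'" "p \<noteq> q" for t t' p q using pair that by blast
    show "(\<Sum>e\<in>UNIV. (cmod (r t p e))\<^sup>2) \<le> 1" if t: "t \<in> T" "p \<in> t" for t p
    proof -
      have "(\<Sum>e\<in>UNIV. (cmod (r t p e))\<^sup>2) = nrm2 (app2 (g p) (\<alpha> t p)) / S t"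
        unfolding r_def nrm2_def using Sp(2)[OF t] by (simp add: UNIV_bool norm_divide power_divide add_divide_distrib)
      then show ?thesis using Sp[OF t] by simp
    qed
    show "\<kappa> / 10 * (\<Sum>e\<in>UNIV. (cmod (u e))\<^sup>2) \<le> (\<Sum>t\<in>{t\<in>T. p \<in> t}. (cmod (\<Sum>e\<in>UNIV. r t p e * u e))\<^sup>2)"
      if p: "p \<in> Q" for p u
    proof -
      have "\<kappa> / 10 * (\<Sum>e\<in>UNIV. (cmod (u e))\<^sup>2) = \<kappa> / 10 * nrm2 u" by (simp add: nrm2_def UNIV_bool)
      also have "\<dots> \<le> real (card {t\<in>T. p \<in> t}) / 10 * nrm2 u"
        using deg[OF p] by (intro mult_right_mono) auto
      also note g(3)[OF p, of u]
      also have "(\<Sum>t\<in>{t\<in>T. p \<in> t}. (cmod (app2 (g p) (\<alpha> t p) True * u True + app2 (g p) (\<alpha> t p) False * u False))\<^sup>2 /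
         (\<Sum>q\<in>t. nrm2 (app2 (g q) (\<alpha> t q)))) = (\<Sum>t\<in>{t\<in>T. p \<in> t}. (cmod (\<Sum>e\<in>UNIV. r t p e * u e))\<^sup>2)"
      proof (intro sum.cong refl)
        fix t assume t: "t \<in> {t\<in>T. p \<in> t}"
        have "(\<Sum>e\<in>UNIV. r t p e * u e) =
           (app2 (g p) (\<alpha> t p) True * u True + app2 (g p) (\<alpha> t p) False * u False) / complex_of_real (sqrt (S t))"
          by (simp add: UNIV_bool r_def add_divide_distrib)
        then show "(cmod (app2 (g p) (\<alpha> t p) True * u True + app2 (g p) (\<alpha> t p) False * u False))\<^sup>2 /
         (\<Sum>q\<in>t. nrm2 (app2 (g q) (\<alpha> t q))) = (cmod (\<Sum>e\<in>UNIV. r t p e * u e))\<^sup>2"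
          using Sp(2)[of t p] t unfolding S_def[symmetric] by (simp add: norm_divide power_divide)
      qed
      finally show ?thesis .
    qed
    show "\<kappa> / 10 > 0" using \<kappa> by simp
    show "(\<Sum>p\<in>t. \<Sum>e\<in>UNIV. r t p e * U j p e) = 0" if j: "j < k" and t: "t \<in> T" for j t
    proof -
      have "(\<Sum>p\<in>t. \<Sum>e\<in>UNIV. r t p e * U j p e) =
        (\<Sum>p\<in>t. (\<alpha> t p True * w j p True + \<alpha> t p False * w j p False) / complex_of_real (sqrt (S t)))"
      proof (intro sum.cong refl)
        fix p assume "p \<in> t"
        then have p: "p \<in> Q" using T t by blast
        show "(\<Sum>e\<in>UNIV. r t p e * U j p e) = (\<alpha> t p True * w j p True + \<alpha> t p False * w j p False) / complex_of_real (sqrt (S t))"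
          unfolding wU[OF p] r_def app2_def by (simp add: UNIV_bool add_divide_distrib algebra_simps)
      qed
      also have "\<dots> = 0" unfolding sum_divide_distrib[symmetric] using ker[OF j t] by simp
      finally show ?thesis .
    qed
    show "\<forall>j<k. c j = 0" if c: "\<forall>p\<in>Q. \<forall>e. (\<Sum>j<k. c j * U j p e) = 0" for c
    proof (rule indep, intro ballI allI)
      fix p e assume p: "p \<in> Q"
      have "(\<Sum>j<k. c j * w j p e) = g p True e * (\<Sum>j<k. c j * U j p True) + g p False e * (\<Sum>j<k. c j * U j p False)"
        unfolding wU[OF p] by (simp add: sum_distrib_left sum.distrib algebra_simps)
      then show "(\<Sum>j<k. c j * w j p e) = 0" using c p by simp
    qed
  qed
  then show ?thesis by (simp add: power_divide mult.commute)
qed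

section \<open>Vertical decompositions\<close>

definition line_at :: "real \<times> real \<Rightarrow> real \<Rightarrow> real" where
  "line_at l x = fst l * x + snd l"

definition on_line :: "real \<times> real \<Rightarrow> real \<times> real \<Rightarrow> bool" where
  "on_line p l \<longleftrightarrow> snd p = line_at l (fst p)"

definition cross_x :: "real \<times> real \<Rightarrow> real \<times> real \<Rightarrow> real" where
  "cross_x a c = (snd c - snd a) / (fst a - fst c)"

lemma on_line_unique:
  assumes "on_line p l" "on_line p l'" "on_line q l" "on_line q l'" "l \<noteq> l'"
  shows "p = q"
proof -
  have e: "snd p = line_at l (fst p)" "snd p = line_at l' (fst p)" "snd q = line_at l (fst q)" "snd q = line_at l' (fst q)"
    using assms unfolding on_line_def by auto
  then have "(fst l - fst l') * (fst p - fst q) = 0" unfolding line_at_def by (simp add: algebra_simps)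
  moreover have "fst l \<noteq> fst l'" using e assms(5) unfolding line_at_def by (auto simp: prod_eq_iff)
  ultimately have "fst p = fst q" by simp
  then show "p = q" using e by (simp add: prod_eq_iff)
qed

text \<open>The crossing cannot be at x, where the order is strict, but it may be at x'. This
  asymmetry matches walls that are strictly separated from the point they belong to.\<close>

lemma crossing_between:
  assumes "line_at a x < line_at c x" "line_at c x' \<le> line_at a x'"
  shows "fst c \<noteq> fst a \<and> (x' \<le> cross_x a c \<and> cross_x a c < x \<or> x < cross_x a c \<and> cross_x a c \<le> x')"
proof -
  have ne: "fst c \<noteq> fst a" using assms unfolding line_at_def by auto
  show ?thesis
  proof (cases "fst c < fst a")
    case True
    then have "x < cross_x a c \<and> cross_x a c \<le> x'"
      using assms unfolding cross_x_def line_at_def by (auto simp: field_simps)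
    then show ?thesis using ne by blast
  next
    case False
    then have "fst a < fst c" using ne by simp
    then have "x' \<le> cross_x a c \<and> cross_x a c < x"
      using assms unfolding cross_x_def line_at_def by (auto simp: field_simps)
    then show ?thesis using ne by blast
  qed
qed

lemma crossing_between':
  assumes "line_at c x < line_at a x" "line_at a x' \<le> line_at c x'"
  shows "fst c \<noteq> fst a \<and> (x' \<le> cross_x a c \<and> cross_x a c < x \<or> x < cross_x a c \<and> cross_x a c \<le> x')"
proof -
  have "cross_x a c = cross_x c a" unfolding cross_x_def by (metis minus_diff_eq minus_divide_divide)
  then show ?thesis using crossing_between[OF assms] by auto
qed

lemma cross_x_ev:
  assumes "fst c \<noteq> fst a"
  shows "line_at a (cross_x a c) = line_at c (cross_x a c)"
  using assms unfolding line_at_def cross_x_def by (simp add: field_simps)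

text \<open>
  The cells of a set S of lines are the trapezoids of its vertical decomposition, closed below and
  open above; a point on two lines of S belongs to no cell.  The two horizontal lines at heights H and
  - H and the abscissae X0 and X1 serve as a frame, so that every cell is bounded.  The genericity
  assumption says that a vertical line through a point p of P meets no crossing of two lines
  other than p.
\<close>

locale cells =
  fixes P L :: "(real \<times> real) set" and H X0 X1 :: real
  assumes finP: "finite P" and finL: "finite L"
    and generic: "\<And>p l l'. p \<in> P \<Longrightarrow> l \<in> L \<Longrightarrow> l' \<in> L \<Longrightarrow> l \<noteq> l' \<Longrightarrow> line_at l (fst p) = line_at l' (fst p) \<Longrightarrow> on_line p l"
    and H: "\<And>p. p \<in> P \<Longrightarrow> \<bar>snd p\<bar> < H" "\<And>p l. p \<in> P \<Longrightarrow> l \<in> L \<Longrightarrow> \<bar>line_at l (fst p)\<bar> < H"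
    and X: "\<And>p. p \<in> P \<Longrightarrow> X0 < fst p" "\<And>p. p \<in> P \<Longrightarrow> fst p < X1"
begin

section \<open>Trapezoids of the vertical decomposition\<close>

definition framed where "framed S = insert (0, H) (insert (0, - H) S)"

definition nonvertex where
  "nonvertex S p \<longleftrightarrow> (\<forall>l\<in>S. \<forall>l'\<in>S. on_line p l \<longrightarrow> on_line p l' \<longrightarrow> l = l')"

definition upper where "upper S p = arg_min_on (\<lambda>l. line_at l (fst p)) {l \<in> framed S. snd p < line_at l (fst p)}"
definition lower where "lower S p = arg_min_on (\<lambda>l. - line_at l (fst p)) {l \<in> framed S. line_at l (fst p) \<le> snd p}"

definition crossings where "crossings S a = cross_x a ` {c \<in> framed S. fst c \<noteq> fst a}"
text \<open>Only crossings on the ceiling and the floor of p produce walls; this is why a cell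
  depends on few lines.\<close>

definition left_wall where "left_wall S p = Max (insert X0 {w \<in> crossings S (upper S p) \<union> crossings S (lower S p). w < fst p})"
definition right_wall where "right_wall S p = Min (insert X1 {w \<in> crossings S (upper S p) \<union> crossings S (lower S p). fst p < w})"
definition cell where "cell S p = (upper S p, lower S p, left_wall S p, right_wall S p)"

lemma fin_framed: "S \<subseteq> L \<Longrightarrow> finite (framed S)"
  unfolding framed_def using finL finite_subset by auto

lemma upper_props:
  assumes "S \<subseteq> L" "p \<in> P"
  shows "upper S p \<in> framed S" "snd p < line_at (upper S p) (fst p)"
    "\<And>l. l \<in> framed S \<Longrightarrow> snd p < line_at l (fst p) \<Longrightarrow> line_at (upper S p) (fst p) \<le> line_at l (fst p)"
proof -
  define A where "A = {l \<in> framed S. snd p < line_at l (fst p)}"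
  have "(0, H) \<in> A" using H(1)[OF assms(2)] unfolding A_def framed_def line_at_def by auto
  moreover have "finite A" unfolding A_def using fin_framed[OF assms(1)] by simp
  ultimately have *: "upper S p \<in> A \<and> \<not> (\<exists>l\<in>A. line_at l (fst p) < line_at (upper S p) (fst p))"
    using arg_min_if_finite[of A "\<lambda>l. line_at l (fst p)"] unfolding upper_def A_def[symmetric] by blast
  then show "upper S p \<in> framed S" "snd p < line_at (upper S p) (fst p)" unfolding A_def by auto
  show "line_at (upper S p) (fst p) \<le> line_at l (fst p)" if "l \<in> framed S" "snd p < line_at l (fst p)" for l
  proof -
    have "l \<in> A" using that unfolding A_def by simp
    then show ?thesis using * by (simp add: not_less)
  qed
qed

lemma lower_props:
  assumes "S \<subseteq> L" "p \<in> P"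
  shows "lower S p \<in> framed S" "line_at (lower S p) (fst p) \<le> snd p"
    "\<And>l. l \<in> framed S \<Longrightarrow> line_at l (fst p) \<le> snd p \<Longrightarrow> line_at l (fst p) \<le> line_at (lower S p) (fst p)"
proof -
  define A where "A = {l \<in> framed S. line_at l (fst p) \<le> snd p}"
  have "(0, - H) \<in> A" using H(1)[OF assms(2)] unfolding A_def framed_def line_at_def by auto
  moreover have "finite A" unfolding A_def using fin_framed[OF assms(1)] by simp
  ultimately have *: "lower S p \<in> A \<and> \<not> (\<exists>l\<in>A. - line_at l (fst p) < - line_at (lower S p) (fst p))"
    using arg_min_if_finite[of A "\<lambda>l. - line_at l (fst p)"] unfolding lower_def A_def[symmetric] by blast
  then show "lower S p \<in> framed S" "line_at (lower S p) (fst p) \<le> snd p" unfolding A_def by auto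
  show "line_at l (fst p) \<le> line_at (lower S p) (fst p)" if "l \<in> framed S" "line_at l (fst p) \<le> snd p" for l
  proof -
    have "l \<in> A" using that unfolding A_def by simp
    then show ?thesis using * by (simp add: not_less)
  qed
qed

text \<open>Distinct lines have distinct heights above a point that is not a vertex, so its ceiling
  and floor are unique. Two lines of S of equal height there would both pass through p by
  genericity, and H separates the frame from S.\<close>

lemma line_at_inj:
  assumes "S \<subseteq> L" "p \<in> P" "nonvertex S p" "l \<in> framed S" "l' \<in> framed S" "line_at l (fst p) = line_at l' (fst p)"
  shows "l = l'"
proof -
  have "H > 0" using H(1)[OF assms(2)] by linarith
  have e: "line_at (0, H) x = H" "line_at (0, -H) x = - H" for x by (simp_all add: line_at_def)
  show ?thesis
  proof (cases "l \<in> S \<and> l' \<in> S")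
    case True
    show ?thesis
    proof (rule ccontr)
      assume ne: "l \<noteq> l'"
      have "on_line p l" "on_line p l'"
        using generic[OF assms(2), of l l'] generic[OF assms(2), of l' l] True assms ne by auto
      then show False using assms(3) True ne unfolding nonvertex_def by blast
    qed
  next
    case False
    then have lsent: "l \<in> {(0, H), (0, -H)} \<or> l' \<in> {(0, H), (0, -H)}" using assms unfolding framed_def by auto
    have "z = (0, H)" if z: "z \<in> framed S" "line_at z (fst p) = H" for z
    proof -
      have "z \<notin> S" using z H(2)[OF assms(2), of z] assms(1) by auto
      moreover have "z \<noteq> (0, -H)" using z(2) \<open>H > 0\<close> e(2)[of "fst p"] by (metis less_minus_iff neg_less_0_iff_less order_less_asym)
      ultimately show ?thesis using z(1) unfolding framed_def by blast
    qed
    moreover have "z = (0, -H)" if z: "z \<in> framed S" "line_at z (fst p) = - H" for z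
    proof -
      have "z \<notin> S" using z H(2)[OF assms(2), of z] assms(1) by auto
      moreover have "z \<noteq> (0, H)" using z(2) \<open>H > 0\<close> e(1)[of "fst p"] by (metis less_minus_iff neg_less_0_iff_less order_less_asym)
      ultimately show ?thesis using z(1) unfolding framed_def by blast
    qed
    ultimately have "(l = (0, H) \<longrightarrow> l' = (0, H)) \<and> (l' = (0, H) \<longrightarrow> l = (0, H)) \<and>
        (l = (0, -H) \<longrightarrow> l' = (0, -H)) \<and> (l' = (0, -H) \<longrightarrow> l = (0, -H))"
      using assms(4-6) e[of "fst p"] by metis
    then show ?thesis using lsent by blast
  qed
qed

lemma upper_eqI:
  assumes "S \<subseteq> L" "p \<in> P" "nonvertex S p" "l \<in> framed S" "snd p < line_at l (fst p)"
    "\<And>l'. l' \<in> framed S \<Longrightarrow> snd p < line_at l' (fst p) \<Longrightarrow> line_at l (fst p) \<le> line_at l' (fst p)"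
  shows "upper S p = l"
  using line_at_inj[OF assms(1-3)] upper_props[OF assms(1,2)] assms(4-6) by (meson order_antisym)

lemma lower_eqI:
  assumes "S \<subseteq> L" "p \<in> P" "nonvertex S p" "l \<in> framed S" "line_at l (fst p) \<le> snd p"
    "\<And>l'. l' \<in> framed S \<Longrightarrow> line_at l' (fst p) \<le> snd p \<Longrightarrow> line_at l' (fst p) \<le> line_at l (fst p)"
  shows "lower S p = l"
  using line_at_inj[OF assms(1-3)] lower_props[OF assms(1,2)] assms(4-6) by (meson order_antisym)

lemma fin_crossings: "S \<subseteq> L \<Longrightarrow> finite (crossings S a)"
  unfolding crossings_def using fin_framed by simp

lemma left_wall_props:
  assumes "S \<subseteq> L" "p \<in> P"
  shows "left_wall S p < fst p" "left_wall S p \<in> insert X0 (crossings S (upper S p) \<union> crossings S (lower S p))"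
    "\<And>w. w \<in> crossings S (upper S p) \<union> crossings S (lower S p) \<Longrightarrow> w < fst p \<Longrightarrow> w \<le> left_wall S p" "X0 \<le> left_wall S p"
proof -
  define A where "A = insert X0 {w \<in> crossings S (upper S p) \<union> crossings S (lower S p). w < fst p}"
  have A: "finite A" "A \<noteq> {}" unfolding A_def using fin_crossings[OF assms(1)] by auto
  have "left_wall S p = Max A" unfolding left_wall_def A_def ..
  then have *: "left_wall S p \<in> A" "\<And>w. w \<in> A \<Longrightarrow> w \<le> left_wall S p" using A Max_in Max_ge by auto
  show "left_wall S p < fst p" "left_wall S p \<in> insert X0 (crossings S (upper S p) \<union> crossings S (lower S p))"
    using *(1) X(1)[OF assms(2)] unfolding A_def by auto
  show "w \<le> left_wall S p" if "w \<in> crossings S (upper S p) \<union> crossings S (lower S p)" "w < fst p" for w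
    using *(2) that unfolding A_def by blast
  show "X0 \<le> left_wall S p" using *(2) unfolding A_def by blast
qed

lemma right_wall_props:
  assumes "S \<subseteq> L" "p \<in> P"
  shows "fst p < right_wall S p" "right_wall S p \<in> insert X1 (crossings S (upper S p) \<union> crossings S (lower S p))"
    "\<And>w. w \<in> crossings S (upper S p) \<union> crossings S (lower S p) \<Longrightarrow> fst p < w \<Longrightarrow> right_wall S p \<le> w" "right_wall S p \<le> X1"
proof -
  define A where "A = insert X1 {w \<in> crossings S (upper S p) \<union> crossings S (lower S p). fst p < w}"
  have A: "finite A" "A \<noteq> {}" unfolding A_def using fin_crossings[OF assms(1)] by auto
  have "right_wall S p = Min A" unfolding right_wall_def A_def ..
  then have *: "right_wall S p \<in> A" "\<And>w. w \<in> A \<Longrightarrow> right_wall S p \<le> w" using A Min_in Min_le by auto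
  show "fst p < right_wall S p" "right_wall S p \<in> insert X1 (crossings S (upper S p) \<union> crossings S (lower S p))"
    using *(1) X(2)[OF assms(2)] unfolding A_def by auto
  show "right_wall S p \<le> w" if "w \<in> crossings S (upper S p) \<union> crossings S (lower S p)" "fst p < w" for w
    using *(2) that unfolding A_def by blast
  show "right_wall S p \<le> X1" using *(2) unfolding A_def by blast
qed

text \<open>A change of order relative to the ceiling or the floor would be a crossing on that line
  strictly between the walls, and the walls are the nearest such crossings on either side.\<close>

lemma order_in_cell:
  assumes "S \<subseteq> L" "p \<in> P" "nonvertex S p" "left_wall S p < x'" "x' < right_wall S p"
    and a: "a = upper S p \<or> a = lower S p" and c: "c \<in> framed S"
  shows "(line_at a (fst p) < line_at c (fst p) \<longrightarrow> line_at a x' < line_at c x') \<and> (line_at c (fst p) < line_at a (fst p) \<longrightarrow> line_at c x' < line_at a x')"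
proof -
  have w: False if "fst c \<noteq> fst a" "x' \<le> cross_x a c \<and> cross_x a c < fst p \<or> fst p < cross_x a c \<and> cross_x a c \<le> x'"
  proof -
    have "cross_x a c \<in> crossings S (upper S p) \<union> crossings S (lower S p)" using a c that(1) unfolding crossings_def by blast
    then show False using left_wall_props(3)[OF assms(1,2), of "cross_x a c"] right_wall_props(3)[OF assms(1,2), of "cross_x a c"]
      that(2) assms(4,5) by fastforce
  qed
  show ?thesis
    using crossing_between[of a "fst p" c x'] crossing_between'[of c "fst p" a x'] w by (meson not_le)
qed

lemma up_gt_lo:
  assumes "S \<subseteq> L" "p \<in> P"
  shows "line_at (lower S p) (fst p) < line_at (upper S p) (fst p)"
  using upper_props(2)[OF assms] lower_props(2)[OF assms] by linarith

lemma between_up_lo: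
  assumes "S \<subseteq> L" "p \<in> P" "nonvertex S p" "c \<in> framed S" "c \<noteq> upper S p" "c \<noteq> lower S p"
  shows "line_at (upper S p) (fst p) < line_at c (fst p) \<or> line_at c (fst p) < line_at (lower S p) (fst p)"
proof (cases "snd p < line_at c (fst p)")
  case True
  then show ?thesis using upper_props[OF assms(1,2)] line_at_inj[OF assms(1-4)] assms by (metis less_le)
next
  case False
  then show ?thesis using lower_props[OF assms(1,2)] line_at_inj[OF assms(1-4)] assms by (metis less_le not_le)
qed

text \<open>A trapezoid is determined by its left wall and either its ceiling or its floor. Since
  \<open>fst p \<le> fst q\<close> puts p between the walls of q, the lines keep their order
  relative to the ceiling and floor of q, and this determines the other bounding line at p.\<close>

lemma cell_eqI_aux:
  assumes "S \<subseteq> L" "p \<in> P" "q \<in> P" "nonvertex S p" "nonvertex S q" "left_wall S p = left_wall S q" "fst p \<le> fst q"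
    and ab: "upper S p = upper S q \<or> lower S p = lower S q"
  shows "cell S p = cell S q"
proof -
  have x: "left_wall S q < fst p" "fst p < right_wall S q"
    using left_wall_props(1)[OF assms(1,2)] right_wall_props(1)[OF assms(1,3)] assms(6,7) by auto
  note ord = order_in_cell[OF assms(1,3,5) x]
  have uq: "upper S q \<in> framed S" and lq: "lower S q \<in> framed S" using upper_props(1)[OF assms(1,3)] lower_props(1)[OF assms(1,3)] by auto
  have ul: "line_at (lower S q) (fst p) < line_at (upper S q) (fst p)"
    using ord[OF disjI1[OF refl] lq] up_gt_lo[OF assms(1,3)] by blast
  have sep: "line_at (upper S q) (fst p) < line_at c (fst p) \<or> line_at c (fst p) < line_at (lower S q) (fst p)"
    if c: "c \<in> framed S" "c \<noteq> upper S q" "c \<noteq> lower S q" for c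
    using between_up_lo[OF assms(1,3,5) c] ord[OF disjI1[OF refl] c(1)] ord[OF disjI2[OF refl] c(1)] by blast
  have both: "upper S p = upper S q \<and> lower S p = lower S q"
    using ab
  proof
    assume u: "upper S p = upper S q"
    have "lower S p = lower S q"
    proof (rule lower_eqI[OF assms(1,2,4) lq])
      show "line_at (lower S q) (fst p) \<le> snd p"
        using upper_props(3)[OF assms(1,2) lq] ul u by fastforce
      fix l' assume l': "l' \<in> framed S" "line_at l' (fst p) \<le> snd p"
      show "line_at l' (fst p) \<le> line_at (lower S q) (fst p)"
        using sep[OF l'(1)] l' upper_props(2)[OF assms(1,2)] u by fastforce
    qed
    then show ?thesis using u by blast
  next
    assume l: "lower S p = lower S q"
    have "upper S p = upper S q"
    proof (rule upper_eqI[OF assms(1,2,4) uq])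
      show "snd p < line_at (upper S q) (fst p)"
        using lower_props(3)[OF assms(1,2) uq] ul l by fastforce
      fix l' assume l': "l' \<in> framed S" "snd p < line_at l' (fst p)"
      show "line_at (upper S q) (fst p) \<le> line_at l' (fst p)"
        using sep[OF l'(1)] l' lower_props(2)[OF assms(1,2)] l by fastforce
    qed
    then show ?thesis using l by blast
  qed
  have "{w \<in> crossings S (upper S q) \<union> crossings S (lower S q). fst p < w} = {w \<in> crossings S (upper S q) \<union> crossings S (lower S q). fst q < w}"
  proof (intro equalityI subsetI)
    fix w assume w: "w \<in> {w \<in> crossings S (upper S q) \<union> crossings S (lower S q). fst p < w}"
    have ne: "w \<noteq> fst q"
    proof
      assume wq: "w = fst q"
      obtain a c where ac: "a = upper S q \<or> a = lower S q" "c \<in> framed S" "fst c \<noteq> fst a" "w = cross_x a c"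
        using w unfolding crossings_def by blast
      then have "line_at a (fst q) = line_at c (fst q)" using cross_x_ev wq by metis
      then have "a = c" using line_at_inj[OF assms(1,3,5) _ ac(2)] ac(1) uq lq by blast
      then show False using ac by simp
    qed
    have "\<not> w < fst q"
      using left_wall_props(3)[OF assms(1,3), of w] w assms(6) left_wall_props(1)[OF assms(1,2)] by fastforce
    then show "w \<in> {w \<in> crossings S (upper S q) \<union> crossings S (lower S q). fst q < w}" using w ne by auto
  qed (use assms(7) in auto)
  then have "right_wall S p = right_wall S q" using both unfolding right_wall_def by simp
  then show ?thesis using both assms(6) unfolding cell_def by simp
qed

lemma cell_eqI:
  assumes "S \<subseteq> L" "p \<in> P" "q \<in> P" "nonvertex S p" "nonvertex S q" "left_wall S p = left_wall S q"
    and "upper S p = upper S q \<or> lower S p = lower S q"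
  shows "cell S p = cell S q"
  using cell_eqI_aux[of S p q] cell_eqI_aux[of S q p] assms by (metis linear)

text \<open>A label that determines the cell: the left wall is X0 or a crossing on the ceiling or
  the floor, and it is recorded together with that line. Labels are easily counted, which gives a
  quadratic bound on the number of cells.\<close>

definition key where
  "key S p = (if left_wall S p \<in> insert X0 (crossings S (upper S p)) then (True, upper S p, left_wall S p) else (False, lower S p, left_wall S p))"

lemma card_cells:
  assumes S: "S \<subseteq> L" "card S \<le> s"
  shows "card (cell S ` {p\<in>P. nonvertex S p}) \<le> 2 * (s + 2) * (s + 3)"
proof -
  define P' where "P' = {p\<in>P. nonvertex S p}"
  define KS where "KS = (UNIV :: bool set) \<times> (SIGMA a : framed S. insert X0 (crossings S a))"
  have finS: "finite S" using S(1) finL finite_subset by blast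
  have cSb: "card (framed S) \<le> s + 2"
    using S(2) finS unfolding framed_def by (simp add: card_insert_if)
  have ccr: "card (insert X0 (crossings S a)) \<le> s + 3" for a
  proof -
    have "card (crossings S a) \<le> card (framed S)" unfolding crossings_def
      by (rule order_trans[OF card_image_le card_mono]) (use fin_framed[OF S(1)] in auto)
    then have "card (crossings S a) \<le> s + 2" using cSb by simp
    then show ?thesis using fin_crossings[OF S(1)] by (simp add: card_insert_if)
  qed
  have finKS: "finite KS" unfolding KS_def using fin_framed[OF S(1)] fin_crossings[OF S(1)] by auto
  have "card KS = 2 * (\<Sum>a\<in>framed S. card (insert X0 (crossings S a)))"
    unfolding KS_def card_cartesian_product
    by (subst card_SigmaI) (use fin_framed[OF S(1)] fin_crossings[OF S(1)] in auto)
  also have "\<dots> \<le> 2 * (\<Sum>a\<in>framed S. s + 3)" by (intro mult_left_mono sum_mono ccr) auto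
  also have "\<dots> = 2 * (card (framed S) * (s + 3))" by simp
  also have "\<dots> \<le> 2 * ((s + 2) * (s + 3))" using cSb by (intro mult_le_mono) auto
  finally have cKS: "card KS \<le> 2 * (s + 2) * (s + 3)" by (simp add: mult.assoc)
  have keyin: "key S p \<in> KS" if "p \<in> P'" for p
    using that upper_props(1)[OF S(1), of p] lower_props(1)[OF S(1), of p] left_wall_props(2)[OF S(1), of p]
    unfolding P'_def KS_def key_def by auto
  have keydet: "cell S p = cell S q" if "p \<in> P'" "q \<in> P'" "key S p = key S q" for p q
    by (rule cell_eqI[OF S(1)]) (use that in \<open>auto simp: P'_def key_def split: if_splits\<close>)
  have "cell S ` P' \<subseteq> (\<lambda>k. cell S (SOME p. p \<in> P' \<and> key S p = k)) ` KS"
  proof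
    fix z assume "z \<in> cell S ` P'"
    then obtain p where p: "p \<in> P'" "z = cell S p" by blast
    have "(SOME p'. p' \<in> P' \<and> key S p' = key S p) \<in> P' \<and> key S (SOME p'. p' \<in> P' \<and> key S p' = key S p) = key S p"
      by (rule someI[of _ p]) (use p in simp)
    then have "cell S (SOME p'. p' \<in> P' \<and> key S p' = key S p) = z" using keydet p by blast
    then show "z \<in> (\<lambda>k. cell S (SOME p. p \<in> P' \<and> key S p = k)) ` KS" using keyin[OF p(1)] by blast
  qed
  then have "card (cell S ` P') \<le> card KS" using finKS surj_card_le by blast
  then show ?thesis using cKS unfolding P'_def by simp
qed

lemma nonvertex_mono: "nonvertex S p \<Longrightarrow> R \<subseteq> S \<Longrightarrow> nonvertex R p"
  unfolding nonvertex_def by blast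

text \<open>The four lines are the ceiling, the floor and, for each wall, one line crossing them
  there. Without any other line the same ceiling, floor and walls remain nearest, since removal
  creates no new crossings.\<close>

lemma cell_local:
  assumes S: "S \<subseteq> L" "p \<in> P" "nonvertex S p"
  shows "\<exists>D. finite D \<and> card D \<le> 4 \<and> (\<forall>l\<in>S - D. cell (S - {l}) p = cell S p)"
proof -
  define a b where "a = upper S p" and "b = lower S p"
  have "\<exists>c. left_wall S p = X0 \<or> c \<in> framed S \<and> (fst c \<noteq> fst a \<and> left_wall S p = cross_x a c \<or> fst c \<noteq> fst b \<and> left_wall S p = cross_x b c)"
    using left_wall_props(2)[OF S(1,2)] unfolding crossings_def a_def b_def by blast
  then obtain c where c: "left_wall S p = X0 \<or> c \<in> framed S \<and> (fst c \<noteq> fst a \<and> left_wall S p = cross_x a c \<or> fst c \<noteq> fst b \<and> left_wall S p = cross_x b c)" by blast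
  have "\<exists>d. right_wall S p = X1 \<or> d \<in> framed S \<and> (fst d \<noteq> fst a \<and> right_wall S p = cross_x a d \<or> fst d \<noteq> fst b \<and> right_wall S p = cross_x b d)"
    using right_wall_props(2)[OF S(1,2)] unfolding crossings_def a_def b_def by blast
  then obtain d where d: "right_wall S p = X1 \<or> d \<in> framed S \<and> (fst d \<noteq> fst a \<and> right_wall S p = cross_x a d \<or> fst d \<noteq> fst b \<and> right_wall S p = cross_x b d)" by blast
  have "cell (S - {l}) p = cell S p" if l: "l \<in> S - {a, b, c, d}" for l
  proof -
    define R where "R = S - {l}"
    have R: "R \<subseteq> L" "nonvertex R p" "framed R \<subseteq> framed S" unfolding R_def framed_def using S nonvertex_mono by blast+
    have keep: "z \<in> framed R" if "z \<in> framed S" "z \<noteq> l" for z using that unfolding R_def framed_def by blast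
    have aR: "a \<in> framed R" and bR: "b \<in> framed R"
      using keep upper_props(1)[OF S(1,2)] lower_props(1)[OF S(1,2)] l unfolding a_def b_def by blast+
    have ua: "upper R p = a"
      by (rule upper_eqI[OF R(1) S(2) R(2) aR]) (use upper_props[OF S(1,2)] R(3) in \<open>auto simp: a_def\<close>)
    have lb: "lower R p = b"
      by (rule lower_eqI[OF R(1) S(2) R(2) bR]) (use lower_props[OF S(1,2)] R(3) in \<open>auto simp: b_def\<close>)
    have crsub: "crossings R z \<subseteq> crossings S z" for z unfolding crossings_def using R(3) by blast
    have "left_wall R p = left_wall S p"
      unfolding left_wall_def[of R] ua lb
    proof (rule Max_eqI)
      show "finite (insert X0 {w \<in> crossings R a \<union> crossings R b. w < fst p})" using fin_crossings[OF R(1)] by simp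
      show "y \<le> left_wall S p" if "y \<in> insert X0 {w \<in> crossings R a \<union> crossings R b. w < fst p}" for y
        using that left_wall_props(3,4)[OF S(1,2)] crsub unfolding a_def b_def by blast
      have "left_wall S p = X0 \<or> left_wall S p \<in> crossings R a \<union> crossings R b" using c keep l unfolding crossings_def by blast
      then show "left_wall S p \<in> insert X0 {w \<in> crossings R a \<union> crossings R b. w < fst p}" using left_wall_props(1)[OF S(1,2)] by blast
    qed
    moreover have "right_wall R p = right_wall S p"
      unfolding right_wall_def[of R] ua lb
    proof (rule Min_eqI)
      show "finite (insert X1 {w \<in> crossings R a \<union> crossings R b. fst p < w})" using fin_crossings[OF R(1)] by simp
      show "right_wall S p \<le> y" if "y \<in> insert X1 {w \<in> crossings R a \<union> crossings R b. fst p < w}" for y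
        using that right_wall_props(3,4)[OF S(1,2)] crsub unfolding a_def b_def by blast
      have "right_wall S p = X1 \<or> right_wall S p \<in> crossings R a \<union> crossings R b" using d keep l unfolding crossings_def by blast
      then show "right_wall S p \<in> insert X1 {w \<in> crossings R a \<union> crossings R b. fst p < w}" using right_wall_props(1)[OF S(1,2)] by blast
    qed
    ultimately show ?thesis using ua lb unfolding cell_def R_def[symmetric] a_def b_def by simp
  qed
  moreover have "card {a, b, c, d} \<le> 4" by (simp add: card_insert_if)
  ultimately show ?thesis by (intro exI[of _ "{a, b, c, d}"]) auto
qed

text \<open>At q the line l runs between floor and ceiling. If the cell of p survived the insertion
  of l, then at p the line l would be above the ceiling or below the floor, and this order cannot
  change within the cell.\<close>

lemma conflict:
  assumes S: "S \<subseteq> L" and l: "l \<in> L - S" and p: "p \<in> P" "nonvertex S p" and q: "q \<in> P" "nonvertex S q"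
    and same: "cell S p = cell S q" and ql: "on_line q l"
  shows "\<not> nonvertex (insert l S) p \<or> cell (insert l S) p \<noteq> cell S p"
proof (rule ccontr)
  assume "\<not> ?thesis"
  then have nv: "nonvertex (insert l S) p" and ce: "cell (insert l S) p = cell S p" by auto
  define R where "R = insert l S"
  have R: "R \<subseteq> L" "nonvertex R p" using S l nv unfolding R_def by auto
  have lR: "l \<in> framed R" unfolding R_def framed_def by blast
  define a b where "a = upper S p" and "b = lower S p"
  have eqs: "upper R p = a" "lower R p = b" "left_wall R p = left_wall S p" "right_wall R p = right_wall S p"
    "upper S q = a" "lower S q = b" "left_wall S q = left_wall S p" "right_wall S q = right_wall S p"
    using ce same unfolding cell_def R_def a_def b_def by auto
  have xq: "left_wall R p < fst q" "fst q < right_wall R p"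
    using left_wall_props(1)[OF S q(1)] right_wall_props(1)[OF S q(1)] eqs by auto
  have qa: "line_at l (fst q) < line_at a (fst q)" using upper_props(2)[OF S q(1)] ql eqs unfolding on_line_def by simp
  have qb: "line_at b (fst q) \<le> line_at l (fst q)" using lower_props(2)[OF S q(1)] ql eqs unfolding on_line_def by simp
  have "H > 0" using H(1)[OF p(1)] by linarith
  have lab: "l \<noteq> a" "l \<noteq> b"
  proof -
    have "a \<in> framed S" "b \<in> framed S" unfolding a_def b_def using upper_props(1)[OF S p(1)] lower_props(1)[OF S p(1)] by auto
    moreover have "l \<notin> framed S"
      using l H(2)[OF p(1), of l] \<open>H > 0\<close> unfolding framed_def by (auto simp: line_at_def)
    ultimately show "l \<noteq> a" "l \<noteq> b" by auto
  qed
  have "line_at a (fst p) < line_at l (fst p) \<or> line_at l (fst p) < line_at b (fst p)"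
    using between_up_lo[OF R(1) p(1) R(2) lR] lab eqs by simp
  then have "line_at a (fst q) < line_at l (fst q) \<or> line_at l (fst q) < line_at b (fst q)"
    using order_in_cell[OF R(1) p(1) R(2) xq, of a l] order_in_cell[OF R(1) p(1) R(2) xq, of b l] lR eqs by blast
  then show False using qa qb by linarith
qed

section \<open>Random samples of lines and cells met by few lines\<close>

definition bad where
  "bad S l p \<longleftrightarrow> nonvertex S p \<and> (\<not> nonvertex (insert l S) p \<or> cell (insert l S) p \<noteq> cell S p)"

text \<open>If p is not a vertex, only the lines of \<open>cell_local\<close> can be bad. If p lies
  on two lines of S, removing a third one leaves p a vertex, so only those two can be bad.\<close>

lemma card_bad:
  assumes S: "S \<subseteq> L" and p: "p \<in> P"
  shows "card {l\<in>S. bad (S - {l}) l p} \<le> 4"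
proof (cases "nonvertex S p")
  case True
  obtain D where D: "finite D" "card D \<le> 4" "\<forall>l\<in>S - D. cell (S - {l}) p = cell S p"
    using cell_local[OF S p True] by blast
  have "{l\<in>S. bad (S - {l}) l p} \<subseteq> D"
  proof
    fix l assume l: "l \<in> {l\<in>S. bad (S - {l}) l p}"
    then have "insert l (S - {l}) = S" by blast
    then have "cell (S - {l}) p \<noteq> cell S p" using l True unfolding bad_def by auto
    then show "l \<in> D" using D(3) l by blast
  qed
  then show ?thesis using D card_mono le_trans by blast
next
  case False
  then obtain l1 l2 where l: "l1 \<in> S" "l2 \<in> S" "on_line p l1" "on_line p l2" "l1 \<noteq> l2"
    unfolding nonvertex_def by blast
  have "{l\<in>S. bad (S - {l}) l p} \<subseteq> {l1, l2}"
    using l unfolding bad_def nonvertex_def by blast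
  then have "card {l\<in>S. bad (S - {l}) l p} \<le> card {l1, l2}" by (intro card_mono) auto
  also have "\<dots> \<le> 4" by (simp add: card_insert_if)
  finally show ?thesis .
qed

text \<open>
  Backward analysis: a random sample of size s together with a random further line is a random
  sample of size s + 1 with a random distinguished line, and at most four lines of the larger sample
  affect the cell of p.
\<close>
lemma average_conflict:
  "\<exists>S\<subseteq>L. card S \<le> s \<and>
     real (\<Sum>p\<in>P. card {l\<in>L - S. bad S l p}) * real (s + 1) \<le> 4 * real (card P) * real (card L)"
proof (cases "s < card L")
  case False
  \<comment> \<open>All of L is an admissible sample here, and no line is left outside it.\<close>
  then show ?thesis by (intro exI[of _ L]) simp
next
  case True
  define m where "m = card L"
  define A where "A k = {S. S \<subseteq> L \<and> card S = k}" for k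
  have cA: "card (A k) = m choose k" for k unfolding A_def m_def by (rule n_subsets[OF finL])
  have finA: "finite (A k)" for k unfolding A_def using finL by simp
  have finS: "finite S" if "S \<in> A k" for S k using that finL finite_subset unfolding A_def by blast
  define g where "g S = (\<Sum>p\<in>P. card {l\<in>L - S. bad S l p})" for S
  have swap: "(\<Sum>S\<in>A s. card {l\<in>L - S. bad S l p}) = (\<Sum>S\<in>A (Suc s). card {l\<in>S. bad (S - {l}) l p})" for p
  proof -
    have "(\<Sum>S\<in>A s. card {l\<in>L - S. bad S l p}) = card (SIGMA S : A s. {l\<in>L - S. bad S l p})"
      by (rule card_SigmaI[symmetric]) (use finA finL in auto)
    also have "\<dots> = card (SIGMA S : A (Suc s). {l\<in>S. bad (S - {l}) l p})"
    proof (rule bij_betw_same_card[of "\<lambda>(S, l). (insert l S, l)"], rule bij_betw_byWitness[where f' = "\<lambda>(S, l). (S - {l}, l)"])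
      show "(\<lambda>(S, l). (insert l S, l)) ` (SIGMA S : A s. {l\<in>L - S. bad S l p}) \<subseteq> (SIGMA S : A (Suc s). {l\<in>S. bad (S - {l}) l p})"
        using finL by (auto simp: A_def finite_subset)
      show "(\<lambda>(S, l). (S - {l}, l)) ` (SIGMA S : A (Suc s). {l\<in>S. bad (S - {l}) l p}) \<subseteq> (SIGMA S : A s. {l\<in>L - S. bad S l p})"
        using finL by (auto simp: A_def finite_subset)
    qed (auto simp: A_def insert_absorb)
    also have "\<dots> = (\<Sum>S\<in>A (Suc s). card {l\<in>S. bad (S - {l}) l p})"
      by (rule card_SigmaI) (use finA finS in auto)
    finally show ?thesis .
  qed
  have "(\<Sum>S\<in>A s. g S) = (\<Sum>p\<in>P. \<Sum>S\<in>A s. card {l\<in>L - S. bad S l p})"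
    unfolding g_def by (rule sum.swap)
  also have "\<dots> \<le> (\<Sum>p\<in>P. \<Sum>S\<in>A (Suc s). 4)"
    unfolding swap by (intro sum_mono card_bad) (auto simp: A_def)
  also have "\<dots> = 4 * card P * (m choose Suc s)" by (simp add: cA)
  finally have tot: "(\<Sum>S\<in>A s. g S) \<le> 4 * card P * (m choose Suc s)" .
  \<comment> \<open>Both sides count the sets of s lines together with one further line.\<close>
  have bin: "(m choose Suc s) * Suc s = (m choose s) * (m - s)"
    using binomial_absorb_comp[of m s] binomial_absorption[of s m] by (metis Suc_times_binomial_eq binomial_absorb_comp mult.commute times_binomial_minus1_eq)
  show ?thesis
  proof (rule ccontr)
    assume no: "\<not> ?thesis"
    have gt: "4 * card P * m < g S * Suc s" if "S \<in> A s" for S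
    proof -
      have "\<not> real (g S) * real (s + 1) \<le> 4 * real (card P) * real (card L)"
        using no that unfolding A_def g_def by blast
      then have "real (4 * card P * m) < real (g S * Suc s)" unfolding m_def by (simp add: algebra_simps)
      then show ?thesis by (simp only: of_nat_less_iff)
    qed
    have ne: "A s \<noteq> {}"
    proof
      assume "A s = {}"
      then have "m choose s = 0" using cA[of s] by simp
      then show False using True unfolding m_def by (simp add: binomial_eq_0_iff)
    qed
    have "(\<Sum>S\<in>A s. 4 * card P * m) < (\<Sum>S\<in>A s. g S * Suc s)"
      by (rule sum_strict_mono[OF finA ne gt])
    also have "\<dots> = (\<Sum>S\<in>A s. g S) * Suc s" by (rule sum_distrib_right[symmetric])
    also have "\<dots> \<le> 4 * card P * (m choose Suc s) * Suc s" using tot by (rule mult_le_mono1)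
    also have "\<dots> = 4 * card P * ((m choose s) * (m - s))" unfolding bin[symmetric] by (simp only: mult.assoc)
    also have "\<dots> \<le> 4 * card P * ((m choose s) * m)" by (intro mult_le_mono) auto
    finally show False by (simp add: cA mult_ac)
  qed
qed

lemma card_vertices:
  assumes S: "S \<subseteq> L" "card S \<le> s"
  shows "card {p\<in>P. \<not> nonvertex S p} \<le> s\<^sup>2"
proof -
  have finS: "finite S" using S finL finite_subset by blast
  define V where "V = {p\<in>P. \<not> nonvertex S p}"
  have "\<forall>p\<in>V. \<exists>z\<in>S \<times> S. on_line p (fst z) \<and> on_line p (snd z) \<and> fst z \<noteq> snd z"
    unfolding V_def nonvertex_def by auto
  then obtain z where z: "\<And>p. p \<in> V \<Longrightarrow> z p \<in> S \<times> S"
    "\<And>p. p \<in> V \<Longrightarrow> on_line p (fst (z p)) \<and> on_line p (snd (z p)) \<and> fst (z p) \<noteq> snd (z p)" by metis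
  have "inj_on z V"
  proof (rule inj_onI)
    fix p q assume pq: "p \<in> V" "q \<in> V" "z p = z q"
    show "p = q"
      using on_line_unique[of p "fst (z p)" "snd (z p)" q] z(2)[OF pq(1)] z(2)[OF pq(2)] unfolding pq(3) by blast
  qed
  moreover have "z ` V \<subseteq> S \<times> S" using z(1) by blast
  ultimately have "card V \<le> card (S \<times> S)" using finS by (intro card_inj_on_le[of z]) simp_all
  also have "\<dots> \<le> s\<^sup>2" using S by (simp add: card_cartesian_product power2_eq_square mult_le_mono)
  finally show ?thesis unfolding V_def .
qed

text \<open>Vertices and points in cells with fewer than B points number at most 3 (s + 3)^2 B,
  which \<open>big\<close> makes at most half of P. Among the other points one has at most twice the
  average number of conflicts. A line meeting its cell is a conflict or, if it belongs to the
  sample, the floor of the cell: hence the summand 1.\<close>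

lemma rich_cell:
  fixes s B :: nat
  assumes B: "B \<ge> 1" and big: "6 * (s + 3)\<^sup>2 * B \<le> card P"
  shows "\<exists>Q\<subseteq>P. card Q \<ge> B \<and>
    real (card {l\<in>L. \<exists>q\<in>Q. on_line q l}) \<le> 8 * real (card L) / real (s + 1) + 1"
proof -
  obtain S where S: "S \<subseteq> L" "card S \<le> s"
    "real (\<Sum>p\<in>P. card {l\<in>L - S. bad S l p}) * real (s + 1) \<le> 4 * real (card P) * real (card L)"
    using average_conflict by blast
  define P' where "P' = {p\<in>P. nonvertex S p}"
  define Cl where "Cl z = {p\<in>P'. cell S p = z}" for z
  define G where "G = {p\<in>P'. card (Cl (cell S p)) \<ge> B}"
  have finP': "finite P'" unfolding P'_def using finP by simp
  have n0: "card P > 0" using big B by (metis gr0I le_zero_eq mult_is_0 not_one_le_zero power_not_zero add_is_0 zero_neq_numeral)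
  have "P' - G \<subseteq> (\<Union>z\<in>{z\<in>cell S ` P'. card (Cl z) < B}. Cl z)" unfolding G_def Cl_def by auto
  then have "card (P' - G) \<le> card (\<Union>z\<in>{z\<in>cell S ` P'. card (Cl z) < B}. Cl z)"
    by (intro card_mono) (use finP' in \<open>auto simp: Cl_def\<close>)
  also have "\<dots> \<le> (\<Sum>z\<in>{z\<in>cell S ` P'. card (Cl z) < B}. card (Cl z))"
    by (rule card_UN_le) (use finP' in simp)
  also have "\<dots> \<le> (\<Sum>z\<in>{z\<in>cell S ` P'. card (Cl z) < B}. B)" by (rule sum_mono) auto
  also have "\<dots> \<le> card (cell S ` P') * B"
    by (simp add: card_mono finP')
  also have "\<dots> \<le> 2 * (s + 2) * (s + 3) * B"
    using card_cells[OF S(1,2)] unfolding P'_def by (rule mult_le_mono1)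
  finally have small: "card (P' - G) \<le> 2 * (s + 2) * (s + 3) * B" .
  have "P = {p\<in>P. \<not> nonvertex S p} \<union> (P' - G) \<union> G" unfolding P'_def G_def by auto
  then have "card P = card ({p\<in>P. \<not> nonvertex S p} \<union> (P' - G) \<union> G)" by (rule arg_cong)
  also have "\<dots> \<le> card ({p\<in>P. \<not> nonvertex S p} \<union> (P' - G)) + card G" by (rule card_Un_le)
  also have "\<dots> \<le> card {p\<in>P. \<not> nonvertex S p} + card (P' - G) + card G"
    by (rule add_right_mono[OF card_Un_le])
  also have "\<dots> \<le> s\<^sup>2 + 2 * (s + 2) * (s + 3) * B + card G"
    using small card_vertices[OF S(1,2)] by linarith
  also have "\<dots> \<le> 3 * (s + 3)\<^sup>2 * B + card G"
  proof -
    have "s\<^sup>2 * 1 \<le> (s + 3)\<^sup>2 * B" using B by (intro mult_le_mono power_mono) auto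
    moreover have "2 * (s + 2) * (s + 3) \<le> 2 * (s + 3)\<^sup>2"
      by (simp add: power2_eq_square algebra_simps)
    then have "2 * (s + 2) * (s + 3) * B \<le> 2 * (s + 3)\<^sup>2 * B" by (rule mult_le_mono1)
    ultimately show ?thesis by linarith
  qed
  finally have Gbig: "card P \<le> 2 * card G" using big by linarith
  have "\<exists>p\<in>G. real (card {l\<in>L - S. bad S l p}) * real (s + 1) \<le> 8 * real (card L)"
  proof (rule ccontr)
    assume "\<not> ?thesis"
    then have *: "\<And>p. p \<in> G \<Longrightarrow> 8 * real (card L) < real (card {l\<in>L - S. bad S l p}) * real (s + 1)" by force
    have "G \<noteq> {}" using Gbig n0 by auto
    then have "(\<Sum>p\<in>G. 8 * real (card L)) < (\<Sum>p\<in>G. real (card {l\<in>L - S. bad S l p}) * real (s + 1))"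
      using * finP' by (intro sum_strict_mono) (auto simp: G_def)
    also have "\<dots> \<le> (\<Sum>p\<in>P. real (card {l\<in>L - S. bad S l p}) * real (s + 1))"
      by (rule sum_mono2) (use finP in \<open>auto simp: G_def P'_def\<close>)
    also have "\<dots> \<le> 4 * real (card P) * real (card L)" using S(3) by (simp add: sum_distrib_right)
    also have "\<dots> \<le> 4 * real (2 * card G) * real (card L)"
      using Gbig by (intro mult_right_mono mult_left_mono) (auto simp del: of_nat_mult)
    finally show False by simp
  qed
  then obtain p where p: "p \<in> G" "real (card {l\<in>L - S. bad S l p}) * real (s + 1) \<le> 8 * real (card L)" by blast
  define Q where "Q = Cl (cell S p)"
  have "{l\<in>L. \<exists>q\<in>Q. on_line q l} \<subseteq> insert (lower S p) {l\<in>L - S. bad S l p}"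
  proof
    fix l assume "l \<in> {l\<in>L. \<exists>q\<in>Q. on_line q l}"
    then obtain q where lq: "l \<in> L" "q \<in> P" "nonvertex S q" "cell S q = cell S p" "on_line q l"
      unfolding Q_def Cl_def P'_def by blast
    have pp: "p \<in> P" "nonvertex S p" using p(1) unfolding G_def P'_def by auto
    show "l \<in> insert (lower S p) {l\<in>L - S. bad S l p}"
    proof (cases "l \<in> S")
      case True
      then have "lower S q = l"
        by (intro lower_eqI[OF S(1) lq(2,3)]) (use lq(5) in \<open>auto simp: framed_def on_line_def\<close>)
      then show ?thesis using lq(4) unfolding cell_def by auto
    next
      case False
      then show ?thesis using conflict[OF S(1) _ pp lq(2,3) lq(4)[symmetric] lq(5)] lq(1) pp unfolding bad_def by blast
    qed
  qed
  then have "card {l\<in>L. \<exists>q\<in>Q. on_line q l} \<le> card (insert (lower S p) {l\<in>L - S. bad S l p})"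
    by (intro card_mono) (use finL in auto)
  also have "\<dots> \<le> card {l\<in>L - S. bad S l p} + 1" using finL by (simp add: card_insert_if)
  finally have "real (card {l\<in>L. \<exists>q\<in>Q. on_line q l}) \<le> real (card {l\<in>L - S. bad S l p}) + 1" by linarith
  also have "real (card {l\<in>L - S. bad S l p}) \<le> 8 * real (card L) / real (s + 1)"
    using p(2) by (simp add: field_simps)
  finally have "real (card {l\<in>L. \<exists>q\<in>Q. on_line q l}) \<le> 8 * real (card L) / real (s + 1) + 1" by simp
  moreover have "Q \<subseteq> P" "card Q \<ge> B" using p(1) unfolding Q_def G_def Cl_def P'_def by auto
  ultimately show ?thesis by blast
qed

end

section \<open>Cluster partitions and the Szemeredi--Trotter bound\<close>

text \<open>
  A point (x, y) lies on the line (a, b) if y = a x + b, equivalently b = - x a + y; in this form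
  point-line duality is a change of names.
\<close>
definition plane_inc :: "'p set \<Rightarrow> 'l set \<Rightarrow> ('p \<Rightarrow> 'l \<Rightarrow> bool) \<Rightarrow> bool" where
  "plane_inc P L inc \<longleftrightarrow> (\<exists>f g. inj_on f P \<and> inj_on g L \<and> (\<forall>p\<in>P. \<forall>l\<in>L. inc p l \<longleftrightarrow> on_line (f p) (g l)))"

lemma plane_incI:
  "inj_on f P \<Longrightarrow> inj_on g L \<Longrightarrow> (\<And>p l. p \<in> P \<Longrightarrow> l \<in> L \<Longrightarrow> inc p l \<longleftrightarrow> on_line (f p) (g l)) \<Longrightarrow> plane_inc P L inc"
  unfolding plane_inc_def by blast

lemma plane_inc_subset: "plane_inc P L inc \<Longrightarrow> P' \<subseteq> P \<Longrightarrow> L' \<subseteq> L \<Longrightarrow> plane_inc P' L' inc"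
  unfolding plane_inc_def by (meson inj_on_subset subsetD)

lemma plane_inc_dual:
  assumes "plane_inc P L inc"
  shows "plane_inc L P (\<lambda>l p. inc p l)"
proof -
  obtain f g where fg: "inj_on f P" "inj_on g L" "\<And>p l. p \<in> P \<Longrightarrow> l \<in> L \<Longrightarrow> inc p l \<longleftrightarrow> on_line (f p) (g l)"
    using assms unfolding plane_inc_def by blast
  show ?thesis
  proof (rule plane_incI[where f = g and g = "\<lambda>p. (- fst (f p), snd (f p))"])
    show "inj_on (\<lambda>p. (- fst (f p), snd (f p))) P"
      using fg(1) unfolding inj_on_def by (simp add: prod_eq_iff)
    show "inc p l \<longleftrightarrow> on_line (g l) (- fst (f p), snd (f p))" if "l \<in> L" "p \<in> P" for l p
      using fg(3)[OF that(2,1)] unfolding on_line_def line_at_def by (simp add: algebra_simps) linarith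
  qed (fact fg(2))
qed

lemma plane_inc_unique:
  assumes "plane_inc P L inc" "p \<in> P" "q \<in> P" "l \<in> L" "l' \<in> L" "inc p l" "inc p l'" "inc q l" "inc q l'" "p \<noteq> q"
  shows "l = l'"
proof -
  obtain f g where fg: "inj_on f P" "inj_on g L" "\<And>p l. p \<in> P \<Longrightarrow> l \<in> L \<Longrightarrow> inc p l \<longleftrightarrow> on_line (f p) (g l)"
    using assms(1) unfolding plane_inc_def by blast
  have "f p \<noteq> f q" using fg(1) assms by (meson inj_onD)
  then have "g l = g l'" using on_line_unique[of "f p" "g l" "g l'" "f q"] fg(3) assms by blast
  then show ?thesis using fg(2) assms by (meson inj_onD)
qed


text \<open>
  The shear (x, y) |-> (x + e y, y) works for all but finitely many e: the condition that two lines
  agree on the vertical line through p is affine in e.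
\<close>
lemma plane_inc_generic:
  assumes "plane_inc P L inc" and fin: "finite P" "finite L"
  shows "\<exists>f g. inj_on f P \<and> inj_on g L \<and> (\<forall>p\<in>P. \<forall>l\<in>L. inc p l \<longleftrightarrow> on_line (f p) (g l)) \<and>
    (\<forall>p\<in>P. \<forall>l\<in>L. \<forall>l'\<in>L. l \<noteq> l' \<longrightarrow> line_at (g l) (fst (f p)) = line_at (g l') (fst (f p)) \<longrightarrow> on_line (f p) (g l))"
proof -
  obtain f g where fg: "inj_on f P" "inj_on g L" "\<And>p l. p \<in> P \<Longrightarrow> l \<in> L \<Longrightarrow> inc p l \<longleftrightarrow> on_line (f p) (g l)"
    using assms(1) unfolding plane_inc_def by blast
  \<comment> \<open>The shear takes slope a and intercept b to a / (1 + e a) and b / (1 + e a). With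
    denominators cleared, equality of two lines above the image of p is c0 + e c1 = 0, because the
    terms in e^2 cancel. The values in \<open>bad1\<close> would make a line vertical.\<close>
  define c0 where "c0 p l l' = line_at (g l) (fst (f p)) - line_at (g l') (fst (f p))" for p l l'
  define c1 where "c1 p l l' = (fst (g l) - fst (g l')) * snd (f p) +
     fst (g l') * line_at (g l) (fst (f p)) - fst (g l) * line_at (g l') (fst (f p))" for p l l'
  define bad1 where "bad1 = (\<Union>l\<in>L. {e. 1 + e * fst (g l) = 0})"
  define bad2 where "bad2 = (\<Union>p\<in>P. \<Union>l\<in>L. \<Union>l'\<in>L. if c0 p l l' = 0 \<and> c1 p l l' = 0 then {} else {e. c0 p l l' + e * c1 p l l' = 0})"
  have lin: "finite {e :: real. a + e * b = 0}" if "\<not> (a = 0 \<and> b = 0)" for a b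
  proof (cases "b = 0")
    case False
    then have "{e. a + e * b = 0} \<subseteq> {- a / b}" by (auto simp: field_simps)
    then show ?thesis using finite_subset by blast
  qed (use that in simp)
  have "finite bad1" unfolding bad1_def using fin lin[of 1] by auto
  moreover have "finite bad2" unfolding bad2_def using fin lin by auto
  ultimately have "finite (bad1 \<union> bad2)" by simp
  then obtain e where e: "e \<notin> bad1" "e \<notin> bad2"
    using infinite_UNIV_char_0[where 'a = real] by (metis UNIV_I UnI1 UnI2 ex_new_if_finite)
  define f' where "f' p = (fst (f p) + e * snd (f p), snd (f p))" for p
  define g' where "g' l = (fst (g l) / (1 + e * fst (g l)), snd (g l) / (1 + e * fst (g l)))" for l
  have d: "1 + e * fst (g l) \<noteq> 0" if "l \<in> L" for l using e(1) that unfolding bad1_def by auto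
  have evg': "line_at (g' l) x = (fst (g l) * x + snd (g l)) / (1 + e * fst (g l))" if "l \<in> L" for l x
    unfolding line_at_def g'_def by (simp add: add_divide_distrib)
  have "inj_on f' P"
  proof (rule inj_onI)
    fix p q assume pq: "p \<in> P" "q \<in> P" "f' p = f' q"
    then have "snd (f p) = snd (f q)" "fst (f p) + e * snd (f p) = fst (f q) + e * snd (f q)"
      unfolding f'_def by auto
    then have "f p = f q" by (auto simp: prod_eq_iff)
    then show "p = q" using fg(1) pq by (meson inj_onD)
  qed
  moreover have "inj_on g' L"
  proof (rule inj_onI)
    fix l l' assume l: "l \<in> L" "l' \<in> L" "g' l = g' l'"
    have eq: "fst (g l) / (1 + e * fst (g l)) = fst (g l') / (1 + e * fst (g l'))"
      "snd (g l) / (1 + e * fst (g l)) = snd (g l') / (1 + e * fst (g l'))"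
      using l(3) unfolding g'_def by auto
    have "fst (g l) * (1 + e * fst (g l')) = fst (g l') * (1 + e * fst (g l))"
      using eq(1) d[OF l(1)] d[OF l(2)] by (simp add: frac_eq_eq)
    then have 1: "fst (g l) = fst (g l')" by (simp add: algebra_simps)
    then have "snd (g l) = snd (g l')" using eq(2) d[OF l(1)] by simp
    then have "g l = g l'" using 1 by (simp add: prod_eq_iff)
    then show "l = l'" using fg(2) l by (meson inj_onD)
  qed
  moreover have inc': "inc p l \<longleftrightarrow> on_line (f' p) (g' l)" if pl: "p \<in> P" "l \<in> L" for p l
  proof -
    have "on_line (f' p) (g' l) \<longleftrightarrow> snd (f p) * (1 + e * fst (g l)) = fst (g l) * (fst (f p) + e * snd (f p)) + snd (g l)"
      unfolding on_line_def evg'[OF pl(2)] f'_def using d[OF pl(2)] by (simp add: eq_divide_eq)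
    also have "\<dots> \<longleftrightarrow> on_line (f p) (g l)" unfolding on_line_def line_at_def by (auto simp: algebra_simps)
    finally show ?thesis using fg(3)[OF pl] by simp
  qed
  moreover have "on_line (f' p) (g' l)"
    if pl: "p \<in> P" "l \<in> L" "l' \<in> L" "l \<noteq> l'" "line_at (g' l) (fst (f' p)) = line_at (g' l') (fst (f' p))" for p l l'
  proof -
    define x y a b a' b' where xy: "x = fst (f p)" "y = snd (f p)" "a = fst (g l)" "b = snd (g l)" "a' = fst (g l')" "b' = snd (g l')"
    have "(a * (x + e * y) + b) / (1 + e * a) = (a' * (x + e * y) + b') / (1 + e * a')"
      using pl(5) unfolding evg'[OF pl(2)] evg'[OF pl(3)] f'_def xy by simp
    then have "(a * (x + e * y) + b) * (1 + e * a') = (a' * (x + e * y) + b') * (1 + e * a)"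
      using d[OF pl(2)] d[OF pl(3)] unfolding xy by (simp add: frac_eq_eq)
    then have z: "c0 p l l' + e * c1 p l l' = 0"
      unfolding c0_def c1_def line_at_def xy[symmetric] by (simp add: algebra_simps)
    have "c0 p l l' = 0 \<and> c1 p l l' = 0"
    proof (rule ccontr)
      assume "\<not> ?thesis"
      then have "e \<in> bad2" unfolding bad2_def using z pl(1,2,3) by auto
      then show False using e(2) by blast
    qed
    \<comment> \<open>Both coefficients vanish only if the lines already meet above or below p and,
      having different slopes, pass through p itself.\<close>
    then have A: "a * x + b = a' * x + b'" and B: "(a - a') * y + a' * (a * x + b) - a * (a' * x + b') = 0"
      unfolding c0_def c1_def line_at_def xy[symmetric] by auto
    have "(a - a') * (y - (a * x + b)) = 0" using A B by (simp add: algebra_simps)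
    moreover have "a \<noteq> a'"
    proof
      assume "a = a'"
      then have "g l = g l'" using A unfolding xy by (simp add: prod_eq_iff)
      then show False using fg(2) pl by (meson inj_onD)
    qed
    ultimately have "on_line (f p) (g l)" unfolding on_line_def line_at_def xy by simp
    then show ?thesis using inc'[OF pl(1,2)] fg(3)[OF pl(1,2)] by simp
  qed
  ultimately show ?thesis by blast
qed

section \<open>Clusters met by few lines\<close>

definition lines_meeting :: "'l set \<Rightarrow> ('p \<Rightarrow> 'l \<Rightarrow> bool) \<Rightarrow> 'p set \<Rightarrow> 'l set" where
  "lines_meeting L inc Q = {l\<in>L. \<exists>q\<in>Q. inc q l}"

lemma rich_cluster:
  fixes s B :: nat
  assumes pi: "plane_inc P L inc" and fin: "finite P" "finite L" and B: "B \<ge> 1"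
    and big: "6 * (s + 3)\<^sup>2 * B \<le> card P"
  shows "\<exists>Q\<subseteq>P. B \<le> card Q \<and> real (card (lines_meeting L inc Q)) \<le> 8 * real (card L) / real (s + 1) + 1"
proof -
  obtain f g where fg0: "inj_on f P \<and> inj_on g L \<and> (\<forall>p\<in>P. \<forall>l\<in>L. inc p l \<longleftrightarrow> on_line (f p) (g l)) \<and>
    (\<forall>p\<in>P. \<forall>l\<in>L. \<forall>l'\<in>L. l \<noteq> l' \<longrightarrow> line_at (g l) (fst (f p)) = line_at (g l') (fst (f p)) \<longrightarrow> on_line (f p) (g l))"
    using plane_inc_generic[OF pi fin] by (elim exE)
  then have fg: "inj_on f P" "inj_on g L" "\<And>p l. p \<in> P \<Longrightarrow> l \<in> L \<Longrightarrow> inc p l \<longleftrightarrow> on_line (f p) (g l)"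
    and gen: "\<forall>p\<in>P. \<forall>l\<in>L. \<forall>l'\<in>L. l \<noteq> l' \<longrightarrow> line_at (g l) (fst (f p)) = line_at (g l') (fst (f p)) \<longrightarrow> on_line (f p) (g l)"
    by simp_all
  define H where "H = 1 + (\<Sum>p\<in>P. \<bar>snd (f p)\<bar>) + (\<Sum>z\<in>P \<times> L. \<bar>line_at (g (snd z)) (fst (f (fst z)))\<bar>)"
  define X where "X = 1 + (\<Sum>p\<in>P. \<bar>fst (f p)\<bar>)"
  have s0: "(\<Sum>p\<in>P. \<bar>snd (f p)\<bar>) \<ge> 0" "(\<Sum>z\<in>P \<times> L. \<bar>line_at (g (snd z)) (fst (f (fst z)))\<bar>) \<ge> 0"
    by (simp_all add: sum_nonneg)
  interpret cells "f ` P" "g ` L" H "- X" X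
  proof
    show "finite (f ` P)" "finite (g ` L)" using fin by auto
    show "on_line p l" if a: "p \<in> f ` P" "l \<in> g ` L" "l' \<in> g ` L" "l \<noteq> l'" "line_at l (fst p) = line_at l' (fst p)" for p l l'
      proof -
      obtain p' k k' where "p' \<in> P" "p = f p'" "k \<in> L" "l = g k" "k' \<in> L" "l' = g k'" using a by blast
      moreover have "k \<noteq> k'" using a(4) calculation by blast
      ultimately show ?thesis using gen[rule_format, of p' k k'] a(5) by blast
    qed
    show "\<bar>snd p\<bar> < H" if p: "p \<in> f ` P" for p
    proof -
      obtain p' where p': "p' \<in> P" "p = f p'" using p by blast
      have "\<bar>snd (f p')\<bar> \<le> (\<Sum>p\<in>P. \<bar>snd (f p)\<bar>)" by (rule member_le_sum[OF p'(1)]) (use fin in auto)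
      then show ?thesis using s0 unfolding H_def p'(2) by linarith
    qed
    show "\<bar>line_at l (fst p)\<bar> < H" if pl: "p \<in> f ` P" "l \<in> g ` L" for p l
    proof -
      obtain z where z: "z \<in> P \<times> L" "p = f (fst z)" "l = g (snd z)" using pl by auto
      have "\<bar>line_at (g (snd z)) (fst (f (fst z)))\<bar> \<le> (\<Sum>z\<in>P \<times> L. \<bar>line_at (g (snd z)) (fst (f (fst z)))\<bar>)"
        by (rule member_le_sum[OF z(1)]) (use fin in auto)
      then show ?thesis using s0 unfolding H_def z(2,3) by linarith
    qed
    have X: "\<bar>fst p\<bar> < X" if p: "p \<in> f ` P" for p
    proof -
      obtain p' where p': "p' \<in> P" "p = f p'" using p by blast
      have "\<bar>fst (f p')\<bar> \<le> (\<Sum>p\<in>P. \<bar>fst (f p)\<bar>)" by (rule member_le_sum[OF p'(1)]) (use fin in auto)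
      then show ?thesis unfolding X_def p'(2) by linarith
    qed
    show "- X < fst p" "fst p < X" if "p \<in> f ` P" for p using X[OF that] by linarith+
  qed
  have cP: "card (f ` P) = card P" "card (g ` L) = card L" using fg by (auto simp: card_image)
  obtain Q' where Q': "Q' \<subseteq> f ` P" "B \<le> card Q'"
    "real (card {l \<in> g ` L. \<exists>q\<in>Q'. on_line q l}) \<le> 8 * real (card L) / real (s + 1) + 1"
    using rich_cell[OF B, of s] big unfolding cP by blast
  define Q where "Q = {p\<in>P. f p \<in> Q'}"
  have fQ: "f ` Q = Q'" using Q'(1) unfolding Q_def by blast
  have "card Q = card Q'" unfolding fQ[symmetric] by (rule card_image[symmetric]) (use fg(1) in \<open>auto simp: Q_def inj_on_def\<close>)
  moreover have "card (lines_meeting L inc Q) \<le> card {l \<in> g ` L. \<exists>q\<in>Q'. on_line q l}"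
  proof (rule card_inj_on_le[of g])
    show "inj_on g (lines_meeting L inc Q)" using fg(2) by (rule inj_on_subset) (auto simp: lines_meeting_def)
    show "g ` lines_meeting L inc Q \<subseteq> {l \<in> g ` L. \<exists>q\<in>Q'. on_line q l}"
      using fg(3) unfolding lines_meeting_def Q_def by auto
    show "finite {l \<in> g ` L. \<exists>q\<in>Q'. on_line q l}" using fin by simp
  qed
  ultimately show ?thesis using Q'
    by (intro exI[of _ Q]) (auto simp: Q_def)
qed

text \<open>The sample size is taken about as large as the hypothesis 6 (s + 3)^2 B \<le> card P of
  \<open>rich_cluster\<close> allows. The assumption 96 = 6 * 4^2 gives y \<ge> 4, whence s + 1
  \<ge> y - 3 \<ge> y / 4, and 80 comes from 8 * 4 * sqrt 6 \<le> 80.\<close>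

lemma low_hit_cluster:
  fixes B :: nat
  assumes pi: "plane_inc P L inc" and fin: "finite P" "finite L" and B: "B \<ge> 1"
    and big: "96 * B \<le> card P"
  shows "\<exists>Q\<subseteq>P. card Q = B \<and> real (card (lines_meeting L inc Q)) \<le> 80 * real (card L) * sqrt (B / card P) + 1"
proof -
  define y where "y = sqrt (card P / (6 * B))"
  have y4: "y \<ge> 4"
  proof -
    have "16 \<le> real (card P) / (6 * B)" using big B by (simp add: le_divide_eq)
    then have "sqrt 16 \<le> y" unfolding y_def by (rule real_sqrt_le_mono)
    then show ?thesis by simp
  qed
  have y2: "y\<^sup>2 = card P / (6 * B)" unfolding y_def by simp
  define s where "s = nat \<lfloor>y\<rfloor> - 3"
  have s: "real (s + 3) \<le> y" "y - 3 \<le> real (s + 1)" using y4 unfolding s_def by linarith+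
  have "real (6 * (s + 3)\<^sup>2 * B) \<le> real (card P)"
  proof -
    have "(real (s + 3))\<^sup>2 \<le> y\<^sup>2" using s(1) by (intro power_mono) auto
    then show ?thesis unfolding y2 using B by (simp add: field_simps)
  qed
  then have "6 * (s + 3)\<^sup>2 * B \<le> card P" by (simp only: of_nat_le_iff)
  then obtain Q0 where Q0: "Q0 \<subseteq> P" "B \<le> card Q0" "real (card (lines_meeting L inc Q0)) \<le> 8 * real (card L) / real (s + 1) + 1"
    using rich_cluster[OF pi fin B] by blast
  obtain Q where Q: "Q \<subseteq> Q0" "card Q = B" using obtain_subset_with_card_n[OF Q0(2)] by metis
  have "card (lines_meeting L inc Q) \<le> card (lines_meeting L inc Q0)"
    by (rule card_mono) (use fin Q in \<open>auto simp: lines_meeting_def\<close>)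
  then have "real (card (lines_meeting L inc Q)) \<le> 8 * real (card L) / real (s + 1) + 1" using Q0(3) by linarith
  also have "8 * real (card L) / real (s + 1) \<le> 8 * real (card L) / (y / 4)"
    using s(2) y4 by (intro divide_left_mono mult_pos_pos) auto
  also have "\<dots> = 32 * real (card L) * (1 / y)" by simp
  also have "1 / y = sqrt 6 * sqrt (B / card P)"
    unfolding y_def using B by (simp add: real_sqrt_divide real_sqrt_mult)
  also have "32 * real (card L) * (sqrt 6 * sqrt (B / card P)) \<le> 32 * real (card L) * (5/2 * sqrt (B / card P))"
  proof -
    have "sqrt 6 \<le> sqrt ((5/2)\<^sup>2)" by (rule real_sqrt_le_mono) (simp add: power2_eq_square)
    then have "sqrt 6 \<le> 5/2" by simp
    then show ?thesis by (intro mult_left_mono mult_right_mono) auto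
  qed
  finally have "real (card (lines_meeting L inc Q)) \<le> 80 * real (card L) * sqrt (B / card P) + 1" by simp
  then show ?thesis using Q Q0(1) by blast
qed

text \<open>The discrete counterpart of integrating u^(-1/2): the right-hand side telescopes when
  clusters are split off one by one.\<close>

lemma sqrt_step:
  assumes "(u::real) \<ge> 1"
  shows "sqrt (1 / u) \<le> 2 * (sqrt u - sqrt (u - 1))"
proof -
  have "sqrt u > 0" using assms by simp
  have "(sqrt u - sqrt (u - 1)) * (sqrt u + sqrt (u - 1)) = 1"
    using assms by (simp add: algebra_simps)
  moreover have "sqrt u + sqrt (u - 1) \<le> 2 * sqrt u" using assms by simp
  moreover have "sqrt u - sqrt (u - 1) \<ge> 0" using assms by simp
  ultimately have "1 \<le> (sqrt u - sqrt (u - 1)) * (2 * sqrt u)"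
    by (metis mult_left_mono)
  then show ?thesis using \<open>sqrt u > 0\<close> by (simp add: real_sqrt_divide field_simps)
qed

text \<open>Clusters of B points are split off greedily until fewer than 96 B points remain. With u
  = card P / B, each split lowers u by 1 and costs at most 80 * card L / sqrt u + 1 lines; the last,
  unsplit cluster accounts for the summand \<open>card L\<close>.\<close>

lemma cluster_partition:
  fixes B :: nat
  assumes "plane_inc P L inc" and "finite P" "finite L" and B: "B \<ge> 1"
  shows "\<exists>\<Q>. finite \<Q> \<and> \<Union>\<Q> = P \<and> disjoint \<Q> \<and> (\<forall>Q\<in>\<Q>. card Q \<le> 96 * B) \<and>
    real (card \<Q>) \<le> card P / B + 1 \<and>
    (\<Sum>Q\<in>\<Q>. real (card (lines_meeting L inc Q))) \<le> 160 * real (card L) * sqrt (card P / B) + card P / B + card L"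
  using assms(1,2)
proof (induction "card P" arbitrary: P rule: less_induct)
  case less
  have finL: "finite L" by fact
  show ?case
  proof (cases "card P < 96 * B")
    case True
    have "card (lines_meeting L inc P) \<le> card L" by (rule card_mono[OF finL]) (auto simp: lines_meeting_def)
    then show ?thesis using True
      by (intro exI[of _ "{P}"]) (auto simp: disjoint_def intro: add_increasing)
  next
    case False
    then have big: "96 * B \<le> card P" by simp
    obtain Q where Q: "Q \<subseteq> P" "card Q = B" "real (card (lines_meeting L inc Q)) \<le> 80 * real (card L) * sqrt (B / card P) + 1"
      using low_hit_cluster[OF less.prems finL B big] by blast
    define P' where "P' = P - Q"
    have P': "P' \<subseteq> P" "finite P'" "card P' = card P - B" unfolding P'_def
      using less.prems(2) Q by (auto simp: card_Diff_subset finite_subset)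
    have lt: "card P' < card P" using P'(3) big B by linarith
    obtain \<Q> where IH: "finite \<Q>" "\<Union>\<Q> = P'" "disjoint \<Q>" "\<forall>Q\<in>\<Q>. card Q \<le> 96 * B"
      "real (card \<Q>) \<le> card P' / B + 1"
      "(\<Sum>Q\<in>\<Q>. real (card (lines_meeting L inc Q))) \<le> 160 * real (card L) * sqrt (card P' / B) + card P' / B + card L"
      using less.hyps[OF lt plane_inc_subset[OF less.prems(1) P'(1) subset_refl] P'(2)] by blast
    have Qn: "Q \<notin> \<Q>"
    proof
      assume "Q \<in> \<Q>"
      then have "Q \<subseteq> P'" using IH(2) by blast
      then have "Q = {}" unfolding P'_def by blast
      then show False using Q(2) B by simp
    qed
    define u where "u = card P / B"
    have u: "u \<ge> 1" unfolding u_def using big B by (simp add: le_divide_eq)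
    have P'u: "card P' / B = u - 1"
      unfolding u_def P'(3) using big B by (simp add: of_nat_diff diff_divide_distrib)
    have Bu: "B / card P = 1 / u" unfolding u_def by simp
    show ?thesis
    proof (intro exI[of _ "insert Q \<Q>"] conjI)
      show "finite (insert Q \<Q>)" "\<Union> (insert Q \<Q>) = P" using IH(1,2) Q(1) unfolding P'_def by auto
      show "disjoint (insert Q \<Q>)" using IH(2,3) unfolding P'_def disjoint_def by auto
      show "\<forall>Q'\<in>insert Q \<Q>. card Q' \<le> 96 * B" using IH(4) Q(2) by auto
      show "real (card (insert Q \<Q>)) \<le> card P / B + 1"
        using IH(1,5) Qn P'u unfolding u_def[symmetric] by simp
      have "(\<Sum>Q\<in>insert Q \<Q>. real (card (lines_meeting L inc Q))) \<le>
        80 * real (card L) * sqrt (1 / u) + 1 + (160 * real (card L) * sqrt (u - 1) + (u - 1) + card L)"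
        using IH(1,6) Qn Q(3) unfolding P'u Bu by simp
      also have "80 * real (card L) * sqrt (1 / u) \<le> 80 * real (card L) * (2 * (sqrt u - sqrt (u - 1)))"
        by (intro mult_left_mono sqrt_step u) simp
      finally show "(\<Sum>Q\<in>insert Q \<Q>. real (card (lines_meeting L inc Q))) \<le> 160 * real (card L) * sqrt (card P / B) + card P / B + card L"
        unfolding u_def[symmetric] by (simp add: algebra_simps)
    qed
  qed
qed

section \<open>Counting incidences\<close>

definition num_inc :: "'p set \<Rightarrow> 'l set \<Rightarrow> ('p \<Rightarrow> 'l \<Rightarrow> bool) \<Rightarrow> nat" where
  "num_inc P L inc = card {(p, l). p \<in> P \<and> l \<in> L \<and> inc p l}"

lemma num_inc_points:
  assumes "finite P" "finite L"
  shows "num_inc P L inc = (\<Sum>p\<in>P. card {l\<in>L. inc p l})"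
proof -
  have "{(p, l). p \<in> P \<and> l \<in> L \<and> inc p l} = (SIGMA p:P. {l\<in>L. inc p l})" by auto
  then show ?thesis unfolding num_inc_def using assms by (simp add: card_SigmaI)
qed

lemma num_inc_dual: "num_inc L P (\<lambda>l p. inc p l) = num_inc P L inc"
  unfolding num_inc_def
  by (rule bij_betw_same_card[of prod.swap], rule bij_betw_byWitness[where f' = prod.swap]) auto

lemma num_inc_lines:
  assumes "finite P" "finite L"
  shows "num_inc P L inc = (\<Sum>l\<in>L. card {p\<in>P. inc p l})"
  by (subst num_inc_dual[symmetric]) (rule num_inc_points[OF assms(2,1)])

lemma num_inc_hit: "num_inc Q (lines_meeting L inc Q) inc = num_inc Q L inc"
  unfolding num_inc_def lines_meeting_def by (rule arg_cong[where f = card]) auto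

lemma num_inc_partition:
  assumes "finite P" "finite L" "finite \<Q>" "\<Union>\<Q> = P" "disjoint \<Q>"
  shows "num_inc P L inc = (\<Sum>Q\<in>\<Q>. num_inc Q L inc)"
proof -
  have fQ: "finite Q" if "Q \<in> \<Q>" for Q using assms(1,4) that by (meson Sup_upper finite_subset)
  have "num_inc P L inc = (\<Sum>p\<in>\<Union>\<Q>. card {l\<in>L. inc p l})" unfolding num_inc_points[OF assms(1,2)] assms(4) ..
  also have "\<dots> = (\<Sum>Q\<in>\<Q>. \<Sum>p\<in>Q. card {l\<in>L. inc p l})"
    by (subst sum.Union_disjoint) (use fQ assms(5) in \<open>auto simp: disjoint_def\<close>)
  also have "\<dots> = (\<Sum>Q\<in>\<Q>. num_inc Q L inc)"
    by (intro sum.cong refl num_inc_points[symmetric] fQ assms(2))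
  finally show ?thesis .
qed

text \<open>A line with r > 0 points of Q contributes 1 plus the r - 1 pairs formed by a fixed point
  and another one, and a pair of distinct points lies on one line only.\<close>

lemma num_inc_le_hit_square:
  assumes pi: "plane_inc Q L inc" and fin: "finite Q" "finite L"
  shows "num_inc Q L inc \<le> card (lines_meeting L inc Q) + (card Q)\<^sup>2"
proof -
  define H where "H = lines_meeting L inc Q"
  have H: "finite H" "H \<subseteq> L" unfolding H_def lines_meeting_def using fin by auto
  define pr where "pr l = {z \<in> Q \<times> Q. fst z \<noteq> snd z \<and> inc (fst z) l \<and> inc (snd z) l}" for l
  have le: "card {q\<in>Q. inc q l} \<le> 1 + card (pr l)" if l: "l \<in> H" for l
  proof -
    obtain q0 where q0: "q0 \<in> Q" "inc q0 l" using l unfolding H_def lines_meeting_def by blast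
    have "card ({q\<in>Q. inc q l} - {q0}) \<le> card (pr l)"
      by (rule card_inj_on_le[of "\<lambda>q. (q0, q)"]) (use q0 fin in \<open>auto simp: inj_on_def pr_def\<close>)
    then show ?thesis using q0 fin by (simp add: card_Diff_subset)
  qed
  have "num_inc Q L inc = (\<Sum>l\<in>H. card {q\<in>Q. inc q l})"
    unfolding H_def num_inc_hit[symmetric, of Q L inc] by (rule num_inc_lines) (use fin H in \<open>auto simp: H_def\<close>)
  also have "\<dots> \<le> (\<Sum>l\<in>H. 1 + card (pr l))" by (intro sum_mono le)
  also have "\<dots> = card H + (\<Sum>l\<in>H. card (pr l))"
    unfolding sum.distrib by simp
  also have "(\<Sum>l\<in>H. card (pr l)) = card (\<Union>l\<in>H. pr l)"
  proof (rule card_UN_disjoint[symmetric])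
    show "\<forall>l\<in>H. finite (pr l)" unfolding pr_def using fin by auto
    show "\<forall>l\<in>H. \<forall>l'\<in>H. l \<noteq> l' \<longrightarrow> pr l \<inter> pr l' = {}"
      using plane_inc_unique[OF pi] H(2) unfolding pr_def by fastforce
  qed (fact H)
  also have "\<dots> \<le> card (Q \<times> Q)" by (rule card_mono) (use fin in \<open>auto simp: pr_def\<close>)
  finally show ?thesis unfolding H_def by (simp add: card_cartesian_product power2_eq_square)
qed

text \<open>The trivial estimate inside clusters of about B points gives, up to constants and linear
  terms, m sqrt (n / B) + n B. The two terms balance for B^3 = m^2 / n, where both are (n m)^(2/3).
  The conclusion is a disjunction with a cube so that fractional powers do not occur in later
  estimates.\<close>

lemma szemeredi_trotter:
  assumes pi: "plane_inc P L inc" and fin: "finite P" "finite L"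
  shows "real (num_inc P L inc) \<le> 353 * (real (card P) + real (card L)) \<or>
    real (num_inc P L inc) ^ 3 \<le> 353 ^ 3 * (real (card P))\<^sup>2 * (real (card L))\<^sup>2"
proof -
  define n m I where "n = real (card P)" and "m = real (card L)" and "I = real (num_inc P L inc)"
  have nm0: "n \<ge> 0" "m \<ge> 0" "I \<ge> 0" unfolding n_def m_def I_def by auto
  have hitle: "card (lines_meeting L inc P) \<le> card L" by (rule card_mono) (use fin in \<open>auto simp: lines_meeting_def\<close>)
  have hitle': "card (lines_meeting P (\<lambda>l p. inc p l) L) \<le> card P" by (rule card_mono) (use fin in \<open>auto simp: lines_meeting_def\<close>)
  have 1: "I \<le> m + n\<^sup>2"
  proof -
    have "num_inc P L inc \<le> card L + (card P)\<^sup>2" using num_inc_le_hit_square[OF pi fin] hitle by linarith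
    then have "real (num_inc P L inc) \<le> real (card L + (card P)\<^sup>2)" by (simp only: of_nat_le_iff)
    then show ?thesis unfolding I_def n_def m_def by simp
  qed
  have 2: "I \<le> n + m\<^sup>2"
  proof -
    have "num_inc P L inc \<le> card P + (card L)\<^sup>2"
      using num_inc_le_hit_square[OF plane_inc_dual[OF pi] fin(2,1)] hitle' unfolding num_inc_dual[of L P inc] by linarith
    then have "real (num_inc P L inc) \<le> real (card P + (card L)\<^sup>2)" by (simp only: of_nat_le_iff)
    then show ?thesis unfolding I_def n_def m_def by simp
  qed
  show ?thesis
  proof (cases "m \<ge> n\<^sup>2 \<or> n \<ge> m\<^sup>2")
    case True
    then have "I \<le> 2 * (n + m)" using 1 2 nm0 by auto
    then show ?thesis using nm0 unfolding I_def n_def m_def by linarith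
  next
    case False
    then have c: "m < n\<^sup>2" "n < m\<^sup>2" by auto
    have n0: "n > 0" using c nm0 by (cases "n = 0") auto
    define z where "z = root 3 (m\<^sup>2 / n)"
    have z3: "z ^ 3 = m\<^sup>2 / n" unfolding z_def by (rule real_root_pow_pos2) (use nm0 in auto)
    have z1: "z \<ge> 1" unfolding z_def using c n0 by (simp add: le_divide_eq)
    \<comment> \<open>Rounding up at most doubles z, because z \<ge> 1 in the range n < m^2.\<close>
    define B where "B = nat \<lceil>z\<rceil>"
    have B: "B \<ge> 1" "z \<le> real B" "real B \<le> 2 * z" using z1 unfolding B_def by linarith+
    obtain \<Q> where \<Q>: "finite \<Q>" "\<Union>\<Q> = P" "disjoint \<Q>" "\<forall>Q\<in>\<Q>. card Q \<le> 96 * B"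
      "(\<Sum>Q\<in>\<Q>. real (card (lines_meeting L inc Q))) \<le> 160 * real (card L) * sqrt (card P / B) + card P / B + card L"
      using cluster_partition[OF pi fin B(1)] by blast
    have fQ: "finite Q" "Q \<subseteq> P" if "Q \<in> \<Q>" for Q using \<Q>(2) fin that by (auto intro: finite_subset)
    have "num_inc P L inc \<le> (\<Sum>Q\<in>\<Q>. card (lines_meeting L inc Q) + 96 * B * card Q)"
      unfolding num_inc_partition[OF fin \<Q>(1-3)]
    proof (rule sum_mono)
      fix Q assume Q: "Q \<in> \<Q>"
      have "num_inc Q L inc \<le> card (lines_meeting L inc Q) + (card Q)\<^sup>2"
        by (rule num_inc_le_hit_square[OF plane_inc_subset[OF pi fQ(2)[OF Q] subset_refl] fQ(1)[OF Q] fin(2)])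
      also have "(card Q)\<^sup>2 \<le> 96 * B * card Q" using \<Q>(4) Q by (simp add: power2_eq_square)
      finally show "num_inc Q L inc \<le> card (lines_meeting L inc Q) + 96 * B * card Q" by simp
    qed
    also have "\<dots> = (\<Sum>Q\<in>\<Q>. card (lines_meeting L inc Q)) + 96 * B * (\<Sum>Q\<in>\<Q>. card Q)"
      by (simp add: sum.distrib sum_distrib_left)
    also have "(\<Sum>Q\<in>\<Q>. card Q) = card P"
      using card_Union_disjoint[of \<Q>] \<Q>(2,3) fQ(1) by (simp add: disjoint_def pairwise_def disjnt_def)
    finally have "real (num_inc P L inc) \<le> real ((\<Sum>Q\<in>\<Q>. card (lines_meeting L inc Q)) + 96 * B * card P)"
      by (simp only: of_nat_le_iff)
    then have "I \<le> (\<Sum>Q\<in>\<Q>. real (card (lines_meeting L inc Q))) + 96 * real B * n"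
      unfolding I_def n_def by simp
    also have "\<dots> \<le> (160 * m * sqrt (n / B) + n / B + m) + 96 * (2 * z) * n"
      using \<Q>(5) B(3) nm0 unfolding n_def m_def by (intro add_mono mult_right_mono mult_left_mono) auto
    finally have I0: "I \<le> 160 * (m * sqrt (n / B)) + n / B + m + 192 * (n * z)" by (simp add: algebra_simps)
    have msq: "m * sqrt (n / B) \<le> n * z"
    proof (rule power2_le_imp_le)
      have "(m * sqrt (n / B))\<^sup>2 = m\<^sup>2 * (n / B)" using nm0 by (simp add: power_mult_distrib)
      also have "\<dots> \<le> m\<^sup>2 * (n / z)" using B z1 nm0 by (intro mult_left_mono divide_left_mono) auto
      also have "\<dots> = (n * z)\<^sup>2"
      proof -
        have "m\<^sup>2 = z ^ 3 * n" using z3 n0 by simp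
        then show ?thesis using z1 by (simp add: power2_eq_square power3_eq_cube)
      qed
      finally show "(m * sqrt (n / B))\<^sup>2 \<le> (n * z)\<^sup>2" .
      show "0 \<le> n * z" using nm0 z1 by simp
    qed
    have "n / B \<le> n / 1" using B(1) nm0 by (intro divide_left_mono) auto
    then have I: "I \<le> 352 * (n * z) + (n + m)" using I0 msq by simp
    show ?thesis
    proof (cases "n * z \<le> n + m")
      case True
      then have "I \<le> 353 * (n + m)" using I by simp
      then show ?thesis unfolding I_def n_def m_def by simp
    next
      case False
      then have "I \<le> 353 * (n * z)" using I by simp
      then have "I ^ 3 \<le> (353 * (n * z)) ^ 3" using nm0 by (intro power_mono) auto
      also have "\<dots> = 353 ^ 3 * n\<^sup>2 * m\<^sup>2"
        unfolding power_mult_distrib z3 using n0 by (simp add: power3_eq_cube power2_eq_square)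
      finally show ?thesis unfolding I_def n_def m_def by simp
    qed
  qed
qed

section \<open>Dense clusters and their closures\<close>

text \<open>Stated for an abstract incidence relation so that it serves points and, with the
  relation reversed, lines.\<close>

inductive_set inc_closure :: "'p set \<Rightarrow> 'l set \<Rightarrow> ('p \<Rightarrow> 'l \<Rightarrow> bool) \<Rightarrow> 'p set \<Rightarrow> 'p set"
  for P L inc Q where
  base: "q \<in> Q \<Longrightarrow> q \<in> P \<Longrightarrow> q \<in> inc_closure P L inc Q"
| step: "p \<in> P \<Longrightarrow> l \<in> L \<Longrightarrow> l' \<in> L \<Longrightarrow> l \<noteq> l' \<Longrightarrow> inc p l \<Longrightarrow> inc p l' \<Longrightarrow>
    a \<in> inc_closure P L inc Q \<Longrightarrow> b \<in> inc_closure P L inc Q \<Longrightarrow> a \<noteq> b \<Longrightarrow> inc a l \<Longrightarrow> inc b l \<Longrightarrow>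
    a' \<in> inc_closure P L inc Q \<Longrightarrow> b' \<in> inc_closure P L inc Q \<Longrightarrow> a' \<noteq> b' \<Longrightarrow> inc a' l' \<Longrightarrow> inc b' l' \<Longrightarrow>
    p \<in> inc_closure P L inc Q"

lemma inc_closure_subset: "inc_closure P L inc Q \<subseteq> P"
proof
  fix p assume "p \<in> inc_closure P L inc Q"
  then show "p \<in> P" by cases
qed

definition rich :: "'l set \<Rightarrow> ('p \<Rightarrow> 'l \<Rightarrow> bool) \<Rightarrow> 'p set \<Rightarrow> 'l set" where
  "rich L inc A = {l\<in>L. \<exists>a\<in>A. \<exists>b\<in>A. a \<noteq> b \<and> inc a l \<and> inc b l}"

lemma card_le_1I: "(\<And>x y. x \<in> A \<Longrightarrow> y \<in> A \<Longrightarrow> x = y) \<Longrightarrow> card A \<le> 1"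
  using card_le_Suc0_iff_eq[of A] by (cases "finite A") auto

text \<open>A point outside the closure lies on at most one rich line, since two of them would put
  it into the closure.\<close>

lemma num_inc_rich_closure:
  assumes fin: "finite P" "finite L"
  shows "num_inc P (rich L inc (inc_closure P L inc Q)) inc \<le> num_inc (inc_closure P L inc Q) (rich L inc (inc_closure P L inc Q)) inc + card P"
proof -
  define A where "A = inc_closure P L inc Q"
  define R where "R = rich L inc A"
  have A: "A \<subseteq> P" "finite A" unfolding A_def using inc_closure_subset fin finite_subset by metis+
  have R: "finite R" "R \<subseteq> L" unfolding R_def rich_def using fin by auto
  have out: "card {l\<in>R. inc p l} \<le> 1" if p: "p \<in> P - A" for p
  proof (rule card_le_1I)
    fix l l' assume l: "l \<in> {l\<in>R. inc p l}" "l' \<in> {l\<in>R. inc p l}"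
    show "l = l'"
    proof (rule ccontr)
      assume ne: "l \<noteq> l'"
      obtain a b where ab: "a \<in> A" "b \<in> A" "a \<noteq> b" "inc a l" "inc b l" "l \<in> L" using l unfolding R_def rich_def by blast
      obtain a' b' where ab': "a' \<in> A" "b' \<in> A" "a' \<noteq> b'" "inc a' l'" "inc b' l'" "l' \<in> L" using l unfolding R_def rich_def by blast
      have "p \<in> A" unfolding A_def
        by (rule inc_closure.step[of p P l L l' inc a Q b a' b']) (use p l ne ab ab' in \<open>auto simp: A_def\<close>)
      then show False using p by blast
    qed
  qed
  have "num_inc P R inc = (\<Sum>p\<in>P. card {l\<in>R. inc p l})" by (rule num_inc_points[OF fin(1) R(1)])
  also have "\<dots> = (\<Sum>p\<in>A. card {l\<in>R. inc p l}) + (\<Sum>p\<in>P-A. card {l\<in>R. inc p l})"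
    using sum.subset_diff[OF A(1) fin(1)] by (simp add: add.commute)
  also have "(\<Sum>p\<in>P-A. card {l\<in>R. inc p l}) \<le> (\<Sum>p\<in>P-A. 1)" by (intro sum_mono out)
  also have "\<dots> \<le> card P" using fin by (simp add: card_mono)
  finally show ?thesis using num_inc_points[OF A(2) R(1), of inc] unfolding A_def R_def by simp
qed

text \<open>Each line that is not rich carries at most one point of A.\<close>

lemma num_inc_le_rich:
  assumes fin: "finite A" "finite L"
  shows "num_inc A L inc \<le> num_inc A (rich L inc A) inc + card L"
proof -
  define R where "R = rich L inc A"
  have R: "finite R" "R \<subseteq> L" unfolding R_def rich_def using fin by auto
  have out: "card {p\<in>A. inc p l} \<le> 1" if "l \<in> L - R" for l
    by (rule card_le_1I) (use that in \<open>auto simp: R_def rich_def\<close>)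
  have "num_inc A L inc = (\<Sum>l\<in>R. card {p\<in>A. inc p l}) + (\<Sum>l\<in>L-R. card {p\<in>A. inc p l})"
    unfolding num_inc_lines[OF fin] using sum.subset_diff[OF R(2) fin(2)] by (simp add: add.commute)
  also have "(\<Sum>l\<in>L-R. card {p\<in>A. inc p l}) \<le> (\<Sum>l\<in>L-R. 1)" by (intro sum_mono out)
  also have "\<dots> \<le> card L" using fin by (simp add: card_mono)
  finally show ?thesis using num_inc_lines[OF fin(1) R(1), of inc] unfolding R_def by simp
qed

lemma finite_has_max:
  fixes f :: "'a \<Rightarrow> real"
  assumes "finite X" "X \<noteq> {}"
  obtains z where "z \<in> X" "\<And>y. y \<in> X \<Longrightarrow> f y \<le> f z"
proof -
  have "Max (f ` X) \<in> f ` X" using assms by (intro Max_in) auto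
  then obtain z where "z \<in> X" "f z = Max (f ` X)" by auto
  moreover have "f y \<le> Max (f ` X)" if "y \<in> X" for y using assms that by (intro Max_ge) auto
  ultimately show ?thesis using that by metis
qed

text \<open>The pair (P0, L0) maximises incidences - \<alpha> * points - \<beta> * lines. Deleting a
  point on fewer than \<alpha> lines, or a line with fewer than \<beta> points, would increase this
  value; comparison with (P, L) bounds the loss.\<close>

lemma prune_incidences:
  fixes \<alpha> \<beta> :: real
  assumes fin: "finite P" "finite L"
  obtains P0 L0 where "P0 \<subseteq> P" "L0 \<subseteq> L" "\<And>p. p \<in> P0 \<Longrightarrow> \<alpha> \<le> card {l\<in>L0. inc p l}"
    "\<And>l. l \<in> L0 \<Longrightarrow> \<beta> \<le> card {p\<in>P0. inc p l}"
    "real (num_inc P L inc) - \<alpha> * card P - \<beta> * card L \<le> real (num_inc P0 L0 inc) - \<alpha> * card P0 - \<beta> * card L0"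
proof -
  define \<Phi> where "\<Phi> z = real (num_inc (fst z) (snd z) inc) - \<alpha> * card (fst z) - \<beta> * card (snd z)" for z
  have "finite (Pow P \<times> Pow L)" "Pow P \<times> Pow L \<noteq> {}" using fin by auto
  then obtain z where z: "z \<in> Pow P \<times> Pow L" "\<And>y. y \<in> Pow P \<times> Pow L \<Longrightarrow> \<Phi> y \<le> \<Phi> z"
    by (rule finite_has_max[where f = \<Phi>]) auto
  define P0 L0 where "P0 = fst z" and "L0 = snd z"
  have sub: "P0 \<subseteq> P" "L0 \<subseteq> L" "finite P0" "finite L0" using z(1) fin finite_subset unfolding P0_def L0_def by auto
  have \<Phi>z: "\<Phi> z = real (num_inc P0 L0 inc) - \<alpha> * card P0 - \<beta> * card L0" unfolding \<Phi>_def P0_def L0_def ..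
  show ?thesis
  proof (rule that[of P0 L0])
    show "\<alpha> \<le> card {l\<in>L0. inc p l}" if p: "p \<in> P0" for p
    proof -
      have "num_inc P0 L0 inc = card {l\<in>L0. inc p l} + num_inc (P0 - {p}) L0 inc"
        using sub p by (simp add: num_inc_points sum.remove)
      moreover have "real (card P0) = real (card (P0 - {p})) + 1"
        using card.remove[OF sub(3) p] by simp
      moreover have "\<Phi> (P0 - {p}, L0) \<le> \<Phi> z" by (rule z(2)) (use sub in auto)
      ultimately show ?thesis unfolding \<Phi>z unfolding \<Phi>_def by (simp add: algebra_simps)
    qed
    show "\<beta> \<le> card {p\<in>P0. inc p l}" if l: "l \<in> L0" for l
    proof -
      have "num_inc P0 L0 inc = card {p\<in>P0. inc p l} + num_inc P0 (L0 - {l}) inc"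
        using sub l by (simp add: num_inc_lines sum.remove)
      moreover have "real (card L0) = real (card (L0 - {l})) + 1"
        using card.remove[OF sub(4) l] by simp
      moreover have "\<Phi> (P0, L0 - {l}) \<le> \<Phi> z" by (rule z(2)) (use sub in auto)
      ultimately show ?thesis unfolding \<Phi>z unfolding \<Phi>_def by (simp add: algebra_simps)
    qed
    show "real (num_inc P L inc) - \<alpha> * card P - \<beta> * card L \<le> real (num_inc P0 L0 inc) - \<alpha> * card P0 - \<beta> * card L0"
      using z(2)[of "(P, L)"] unfolding \<Phi>z unfolding \<Phi>_def by simp
  qed (use sub in auto)
qed

lemma prune_triples:
  fixes \<theta> :: real
  assumes fin: "finite Q" "finite T"
  obtains Q' where "Q' \<subseteq> Q" "\<And>q. q \<in> Q' \<Longrightarrow> \<theta> \<le> card {t\<in>T. t \<subseteq> Q' \<and> q \<in> t}"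
    "real (card {t\<in>T. t \<subseteq> Q}) - \<theta> * card Q \<le> real (card {t\<in>T. t \<subseteq> Q'}) - \<theta> * card Q'"
proof -
  define \<Phi> where "\<Phi> R = real (card {t\<in>T. t \<subseteq> R}) - \<theta> * card R" for R
  have "finite (Pow Q)" "Pow Q \<noteq> {}" using fin by auto
  then obtain Q' where "Q' \<in> Pow Q" "\<And>y. y \<in> Pow Q \<Longrightarrow> \<Phi> y \<le> \<Phi> Q'"
    by (rule finite_has_max[where f = \<Phi>]) auto
  then have z: "Q' \<subseteq> Q" "\<And>y. y \<subseteq> Q \<Longrightarrow> \<Phi> y \<le> \<Phi> Q'" by auto
  have fQ': "finite Q'" using z(1) fin finite_subset by blast
  show ?thesis
  proof (rule that[of Q'])
    show "\<theta> \<le> card {t\<in>T. t \<subseteq> Q' \<and> q \<in> t}" if q: "q \<in> Q'" for q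
    proof -
      have "{t\<in>T. t \<subseteq> Q'} = {t\<in>T. t \<subseteq> Q' \<and> q \<in> t} \<union> {t\<in>T. t \<subseteq> Q' - {q}}" by auto
      then have "card {t\<in>T. t \<subseteq> Q'} = card ({t\<in>T. t \<subseteq> Q' \<and> q \<in> t} \<union> {t\<in>T. t \<subseteq> Q' - {q}})" by (rule arg_cong)
      also have "\<dots> = card {t\<in>T. t \<subseteq> Q' \<and> q \<in> t} + card {t\<in>T. t \<subseteq> Q' - {q}}"
        by (rule card_Un_disjoint) (use fin in auto)
      finally have 1: "card {t\<in>T. t \<subseteq> Q'} = card {t\<in>T. t \<subseteq> Q' \<and> q \<in> t} + card {t\<in>T. t \<subseteq> Q' - {q}}" .
      have "real (card Q') = real (card (Q' - {q})) + 1" using card.remove[OF fQ' q] by simp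
      moreover have "\<Phi> (Q' - {q}) \<le> \<Phi> Q'" by (rule z(2)) (use z(1) in auto)
      ultimately show ?thesis using 1 unfolding \<Phi>_def by (simp add: algebra_simps)
    qed
    show "real (card {t\<in>T. t \<subseteq> Q}) - \<theta> * card Q \<le> real (card {t\<in>T. t \<subseteq> Q'}) - \<theta> * card Q'"
      using z(2)[of Q] unfolding \<Phi>_def by simp
  qed (fact z(1))
qed

section \<open>Systems of collinear triples\<close>

lemma disjoint_triples:
  assumes "finite A"
  shows "\<exists>T. finite T \<and> (\<forall>t\<in>T. t \<subseteq> A \<and> card t = 3) \<and> disjoint T \<and> card A \<le> 3 * card T + 2"
  using assms
proof (induction "card A" arbitrary: A rule: less_induct)
  case less
  show ?case
  proof (cases "card A \<le> 2")
    case True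
    then show ?thesis by (intro exI[of _ "{}"]) (auto simp: disjoint_def)
  next
    case False
    then have "3 \<le> card A" by simp
    then obtain t where t: "t \<subseteq> A" "card t = 3" by (rule obtain_subset_with_card_n)
    have ft: "finite t" using t less.prems finite_subset by blast
    have c: "card (A - t) = card A - 3" using t ft by (simp add: card_Diff_subset)
    have "card (A - t) < card A" using c False by linarith
    then obtain T where T: "finite T" "\<forall>t'\<in>T. t' \<subseteq> A - t \<and> card t' = 3" "disjoint T" "card (A - t) \<le> 3 * card T + 2"
      using less.hyps[of "A - t"] less.prems by auto
    have "t \<notin> T"
    proof
      assume "t \<in> T"
      then have "t = {}" using T(2) by blast
      then show False using t(2) by simp
    qed
    moreover have "disjoint (insert t T)" using T(2,3) unfolding disjoint_def by auto
    ultimately show ?thesis using T t c False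
      by (intro exI[of _ "insert t T"]) auto
  qed
qed

text \<open>Disjointness on each line is what the rank bound requires of the equations: two triples
  share at most one point, and two triples through a point lie on different lines.\<close>

definition triple_system :: "'l set \<Rightarrow> ('p \<Rightarrow> 'l \<Rightarrow> bool) \<Rightarrow> 'p set \<Rightarrow> 'p set set \<Rightarrow> bool" where
  "triple_system L inc Q T \<longleftrightarrow>
    (\<forall>t\<in>T. t \<subseteq> Q \<and> card t = 3 \<and> (\<exists>l\<in>L. \<forall>p\<in>t. inc p l)) \<and>
    (\<forall>t\<in>T. \<forall>t'\<in>T. \<forall>l\<in>L. (\<forall>p\<in>t \<union> t'. inc p l) \<longrightarrow> t \<noteq> t' \<longrightarrow> t \<inter> t' = {})"

lemma card3_obtain:
  assumes "card t = 3"
  obtains a b c where "t = {a, b, c}" "a \<noteq> b" "a \<noteq> c" "b \<noteq> c"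
  using assms by (auto simp: card_3_iff)

text \<open>The points of Q on each line are cut into disjoint triples with at most two points left
  over, so each line meeting Q wastes at most two incidences.\<close>

lemma cluster_triples:
  assumes pi: "plane_inc Q L inc" and fin: "finite Q" "finite L"
  shows "\<exists>T. finite T \<and> triple_system L inc Q T \<and> num_inc Q L inc \<le> 3 * card T + 2 * card (lines_meeting L inc Q)"
proof -
  define H where "H = lines_meeting L inc Q"
  have H: "finite H" "H \<subseteq> L" unfolding H_def lines_meeting_def using fin by auto
  have "\<forall>l. \<exists>T. finite T \<and> (\<forall>t\<in>T. t \<subseteq> {q\<in>Q. inc q l} \<and> card t = 3) \<and> disjoint T \<and> card {q\<in>Q. inc q l} \<le> 3 * card T + 2"
    by (intro allI disjoint_triples) (use fin in simp)
  then obtain F where F0: "\<forall>l. finite (F l) \<and> (\<forall>t\<in>F l. t \<subseteq> {q\<in>Q. inc q l} \<and> card t = 3) \<and>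
      disjoint (F l) \<and> card {q\<in>Q. inc q l} \<le> 3 * card (F l) + 2"
    by (elim choice[THEN exE])
  then have F: "finite (F l)" "t \<in> F l \<Longrightarrow> t \<subseteq> {q\<in>Q. inc q l} \<and> card t = 3"
    "disjoint (F l)" "card {q\<in>Q. inc q l} \<le> 3 * card (F l) + 2" for l t by simp_all
  have same: "l = l'" if t: "t \<in> F l" and l: "l \<in> L" "l' \<in> L" "\<And>p. p \<in> t \<Longrightarrow> inc p l'" for t l l'
  proof -
    obtain a b c where abc: "t = {a, b, c}" "a \<noteq> b" using F(2)[OF t] card3_obtain by metis
    then have "a \<in> Q" "b \<in> Q" "inc a l" "inc b l" "inc a l'" "inc b l'" using F(2)[OF t] l(3) by auto
    then show ?thesis using plane_inc_unique[OF pi _ _ l(1,2)] abc(2) by blast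
  qed
  define T where "T = (\<Union>l\<in>H. F l)"
  have "card T = (\<Sum>l\<in>H. card (F l))" unfolding T_def
  proof (rule card_UN_disjoint[OF H(1)])
    show "\<forall>l\<in>H. \<forall>l'\<in>H. l \<noteq> l' \<longrightarrow> F l \<inter> F l' = {}"
    proof (intro ballI impI)
      fix l l' assume l: "l \<in> H" "l' \<in> H" "l \<noteq> l'"
      have False if t: "t \<in> F l" "t \<in> F l'" for t
      proof -
        have "inc p l'" if "p \<in> t" for p using F(2)[OF t(2)] that by blast
        then have "l = l'" using same[OF t(1), of l'] l H(2) by blast
        then show False using l(3) by blast
      qed
      then show "F l \<inter> F l' = {}" by blast
    qed
    show "\<forall>l\<in>H. finite (F l)" using F(1) by blast
  qed
  then have "3 * card T + 2 * card H = (\<Sum>l\<in>H. 3 * card (F l) + 2)"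
    unfolding sum.distrib by (simp add: sum_distrib_left)
  moreover have "num_inc Q L inc = (\<Sum>l\<in>H. card {q\<in>Q. inc q l})"
    unfolding num_inc_hit[symmetric, of Q L inc] H_def[symmetric] by (rule num_inc_lines[OF fin(1) H(1)])
  ultimately have "num_inc Q L inc \<le> 3 * card T + 2 * card H" using F(4) by (simp add: sum_mono)
  moreover have "triple_system L inc Q T" unfolding triple_system_def
  proof (intro conjI ballI impI)
    fix t assume "t \<in> T"
    then obtain l where l: "l \<in> H" "t \<in> F l" unfolding T_def by blast
    show "t \<subseteq> Q" "card t = 3" using F(2)[OF l(2)] by auto
    show "\<exists>l\<in>L. \<forall>p\<in>t. inc p l" using F(2)[OF l(2)] l(1) H(2) by blast
  next
    fix t t' l assume t: "t \<in> T" "t' \<in> T" "l \<in> L" "\<forall>p\<in>t \<union> t'. inc p l" "t \<noteq> t'"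
    obtain k where k: "k \<in> H" "t \<in> F k" using t unfolding T_def by blast
    obtain k' where k': "k' \<in> H" "t' \<in> F k'" using t unfolding T_def by blast
    have "k = l" "k' = l" using same[OF k(2)] same[OF k'(2)] k k' H(2) t(3,4) by auto
    then show "t \<inter> t' = {}" using F(3)[of l] k k' t(5) unfolding disjoint_def by blast
  qed
  moreover have "finite T" unfolding T_def using H F by auto
  ultimately show ?thesis unfolding H_def by blast
qed

lemma triple_system_subset:
  "triple_system L inc Q T \<Longrightarrow> triple_system L inc Q' {t\<in>T. t \<subseteq> Q'}"
  unfolding triple_system_def by blast

text \<open>A point p of a triple t gives the incidence of p with a line containing t. Different
  triples on one line are disjoint, so no incidence arises twice.\<close>

lemma num_inc_rich_triples:
  assumes ts: "triple_system L inc Q T" and fin: "finite Q" "finite L" "finite T"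
  shows "3 * card T \<le> num_inc Q (rich L inc Q) inc"
proof -
  have "\<forall>t\<in>T. \<exists>l\<in>L. \<forall>p\<in>t. inc p l" using ts unfolding triple_system_def by blast
  then obtain f where f: "\<And>t. t \<in> T \<Longrightarrow> f t \<in> L" "\<And>t p. t \<in> T \<Longrightarrow> p \<in> t \<Longrightarrow> inc p (f t)" by metis
  have T: "t \<subseteq> Q" "card t = 3" if "t \<in> T" for t using ts that unfolding triple_system_def by auto
  have fr: "f t \<in> rich L inc Q" if t: "t \<in> T" for t
  proof -
    obtain a b c where abc: "t = {a, b, c}" "a \<noteq> b" using T(2)[OF t] card3_obtain by metis
    then show ?thesis using f(1)[OF t] f(2)[OF t] T(1)[OF t] unfolding rich_def by auto
  qed
  define S where "S = (SIGMA t : T. t)"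
  have "card S = (\<Sum>t\<in>T. card t)" unfolding S_def
    by (rule card_SigmaI) (use fin finite_subset[OF T(1) fin(1)] in auto)
  then have cS: "card S = 3 * card T" using T(2) by simp
  have "card S \<le> num_inc Q (rich L inc Q) inc" unfolding num_inc_def
  proof (rule card_inj_on_le[of "\<lambda>(t, p). (p, f t)"])
    show "inj_on (\<lambda>(t, p). (p, f t)) S"
    proof (rule inj_onI, clarsimp simp: S_def)
      fix t t' p assume a: "t \<in> T" "p \<in> t" "t' \<in> T" "p \<in> t'" "f t = f t'"
      have "\<forall>q\<in>t \<union> t'. inc q (f t)" using f(2)[OF a(1)] f(2)[OF a(3)] unfolding a(5) by blast
      then show "t = t'" using ts a f(1) unfolding triple_system_def by blast
    qed
    show "(\<lambda>(t, p). (p, f t)) ` S \<subseteq> {(p, l). p \<in> Q \<and> l \<in> rich L inc Q \<and> inc p l}"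
      using fr f(2) subsetD[OF T(1)] unfolding S_def by auto
    show "finite {(p, l). p \<in> Q \<and> l \<in> rich L inc Q \<and> inc p l}"
      by (rule finite_subset[of _ "Q \<times> L"]) (use fin in \<open>auto simp: rich_def\<close>)
  qed
  then show ?thesis using cS by simp
qed

section \<open>The dense cluster and the growth of its closure\<close>

text \<open>There are at most 2 n / B clusters. If each had fewer than B d / 2 incidences beyond
  twice the number of lines meeting it, all together would have fewer than n d + n d. Twice the
  number of lines is the waste in cutting lines into triples.\<close>

lemma dense_cluster:
  fixes n m d :: real and B :: nat
  assumes pi: "plane_inc P L inc" and fin: "finite P" "finite L"
    and n: "card P \<le> n" and m: "card L \<le> m" and I: "2 * n * d \<le> num_inc P L inc"
    and B: "1 \<le> B" "B \<le> n" and d: "d > 0"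
    and few: "160 * m * sqrt (n / B) + n / B + m \<le> n * d / 2"
  shows "\<exists>Q\<subseteq>P. card Q \<le> 96 * B \<and> B * d / 2 + 2 * real (card (lines_meeting L inc Q)) \<le> real (num_inc Q L inc)"
proof -
  obtain \<Q> where \<Q>: "finite \<Q>" "\<Union>\<Q> = P" "disjoint \<Q>" "\<forall>Q\<in>\<Q>. card Q \<le> 96 * B"
      "real (card \<Q>) \<le> card P / B + 1"
      "(\<Sum>Q\<in>\<Q>. real (card (lines_meeting L inc Q))) \<le> 160 * real (card L) * sqrt (card P / B) + card P / B + card L"
    using cluster_partition[OF pi fin B(1)] by blast
  have "(\<Sum>Q\<in>\<Q>. real (card (lines_meeting L inc Q))) \<le> 160 * m * sqrt (n / B) + n / B + m"
    using n m by (intro order_trans[OF \<Q>(6)] add_mono mult_mono divide_right_mono real_sqrt_le_mono) auto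
  then have hits: "(\<Sum>Q\<in>\<Q>. real (card (lines_meeting L inc Q))) \<le> n * d / 2" using few by linarith
  have cQ: "real (card \<Q>) \<le> 2 * n / B"
  proof -
    have "1 \<le> n / B" using B by simp
    moreover have "card P / B \<le> n / B" using n by (intro divide_right_mono) auto
    ultimately show ?thesis using \<Q>(5) by simp
  qed
  show ?thesis
  proof (rule ccontr)
    assume no: "\<not> ?thesis"
    have lt: "real (num_inc Q L inc) < B * d / 2 + 2 * real (card (lines_meeting L inc Q))" if "Q \<in> \<Q>" for Q
      using no \<Q>(2,4) that by (meson Sup_upper not_le)
    have n0: "n > 0" using B by linarith
    have ne: "\<Q> \<noteq> {}"
    proof
      assume "\<Q> = {}"
      then have "num_inc P L inc = 0" using \<Q>(2) unfolding num_inc_def by auto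
      moreover have "n * d > 0" using n0 d by simp
      ultimately show False using I by simp
    qed
    have "real (num_inc P L inc) = (\<Sum>Q\<in>\<Q>. real (num_inc Q L inc))"
      using num_inc_partition[OF fin \<Q>(1-3), of inc] by simp
    also have "\<dots> < (\<Sum>Q\<in>\<Q>. B * d / 2 + 2 * real (card (lines_meeting L inc Q)))"
      by (rule sum_strict_mono[OF \<Q>(1) ne lt])
    also have "\<dots> = real (card \<Q>) * (B * d / 2) + 2 * (\<Sum>Q\<in>\<Q>. real (card (lines_meeting L inc Q)))"
      by (simp add: sum.distrib sum_distrib_left)
    also have "\<dots> \<le> (2 * n / B) * (B * d / 2) + 2 * (n * d / 2)"
      using cQ hits d by (intro add_mono mult_right_mono mult_left_mono) auto
    also have "\<dots> = 2 * n * d" using B by simp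
    finally show False using I by simp
  qed
qed

text \<open>
  Here a is the number of points of a closed set A, l the number of lines with at least two points in A,
  X the number of incidences between them, and d and k are lower bounds for the number of lines through
  a point and of points on a line.  A point outside A lies on at most one of the l lines, whence
  k l \<le> X + n; a line outside the l lines carries at most one point of A, whence a d \<le> X + m.
\<close>
lemma closure_growth:
  fixes a l n m k d X K K3 \<Delta> :: real
  assumes pos: "n > 0" "m > 0" "k > 0" "d > 0" "a \<ge> 0" "l \<ge> 0" "K > 0" "K3 > 0" "\<Delta> > 0"
    and nd: "n * d = m * k"
    and k3: "\<Delta> ^ 3 * n\<^sup>2 \<le> 64 * k ^ 3 * m" and d3: "\<Delta> ^ 3 * m\<^sup>2 \<le> 64 * d ^ 3 * n"
    and kl: "k * l \<le> X + n" "2 * n \<le> k * l" and l: "d\<^sup>2 \<le> l"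
    and ad: "a * d \<le> X + m"
    and ST: "X \<le> K * (a + l) \<or> X ^ 3 \<le> K3 * a\<^sup>2 * l\<^sup>2"
    and big: "k \<ge> 4 * K" "k \<ge> 131072 * K3 / \<Delta> ^ 6"
  shows "n / (2 * K) \<le> a \<or> \<Delta> ^ 3 * n / (512 * K3) \<le> a"
proof -
  have X: "k * l / 2 \<le> X" using kl by linarith
  have l0: "l > 0" using l pos by (smt (verit) zero_less_power)
  from ST show ?thesis
  proof
    assume st: "X \<le> K * (a + l)"
    have "4 * K * l \<le> k * l" using big(1) l0 by (intro mult_right_mono) auto
    then have "k * l / 4 \<le> K * a" using X st by (simp add: algebra_simps)
    then have "n / 2 \<le> K * a" using kl(2) by simp
    then have "n / (2 * K) \<le> a" using pos by (simp add: field_simps)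
    then show ?thesis ..
  next
    assume st: "X ^ 3 \<le> K3 * a\<^sup>2 * l\<^sup>2"
    have "(k * l / 2) ^ 3 \<le> X ^ 3" using X pos by (intro power_mono) auto
    then have "(k ^ 3 * l) * l\<^sup>2 \<le> (8 * K3 * a\<^sup>2) * l\<^sup>2"
      using st by (simp add: power_mult_distrib power_divide power2_eq_square power3_eq_cube mult_ac)
    then have kl3: "k ^ 3 * l \<le> 8 * K3 * a\<^sup>2" using l0 by (simp add: mult_le_cancel_right)
    have a0: "a > 0"
    proof (rule ccontr)
      assume "\<not> a > 0"
      then have "a = 0" using pos by simp
      then show False using kl3 l0 pos by (simp add: mult_le_0_iff)
    qed
    \<comment> \<open>The product of the bounds \<open>k3\<close> and \<open>d3\<close> makes n m at
      most a multiple of k^3 d^3. With l \<ge> d^2 and k large (131072 = 32 * 4096) this forces a d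
      \<ge> 2 m, so that the estimate through the points of A becomes effective too.\<close>
    have "(\<Delta> ^ 3 * n\<^sup>2) * (\<Delta> ^ 3 * m\<^sup>2) \<le> (64 * k ^ 3 * m) * (64 * d ^ 3 * n)"
      by (rule mult_mono[OF k3 d3]) (use pos in auto)
    then have "(\<Delta> ^ 6 * n * m) * (n * m) \<le> (4096 * (k ^ 3 * d ^ 3)) * (n * m)"
      by (simp add: power2_eq_square power3_eq_cube eval_nat_numeral mult_ac)
    then have "\<Delta> ^ 6 * n * m \<le> 4096 * (k ^ 3 * d ^ 3)" using pos by simp
    then have "\<Delta> ^ 6 * n * m * d \<le> 4096 * (k ^ 3 * d ^ 3) * d" using pos by (intro mult_right_mono) auto
    moreover have "\<Delta> ^ 6 * n * m * d = \<Delta> ^ 6 * k * m\<^sup>2"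
      using nd by (metis (no_types, opaque_lifting) mult.assoc mult.commute power2_eq_square)
    moreover have "131072 * K3 * m\<^sup>2 \<le> \<Delta> ^ 6 * k * m\<^sup>2"
      using big(2) pos by (intro mult_right_mono) (auto simp: field_simps)
    ultimately have "32 * K3 * m\<^sup>2 \<le> k ^ 3 * d ^ 3 * d" by simp
    also have "\<dots> = k ^ 3 * d\<^sup>2 * d\<^sup>2" by (simp add: power2_eq_square power3_eq_cube mult_ac)
    also have "\<dots> \<le> k ^ 3 * l * d\<^sup>2" using l pos by (intro mult_right_mono mult_left_mono) auto
    also have "\<dots> \<le> 8 * K3 * a\<^sup>2 * d\<^sup>2" using kl3 pos by (intro mult_right_mono) auto
    finally have "(2 * m)\<^sup>2 \<le> (a * d)\<^sup>2" using pos by (simp add: power_mult_distrib)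
    then have "2 * m \<le> a * d" by (rule power2_le_imp_le) (use pos in auto)
    then have "a * d / 2 \<le> X" using ad by linarith
    then have "(a * d / 2) ^ 3 \<le> X ^ 3" using pos by (intro power_mono) auto
    then have "(a * d ^ 3) * a\<^sup>2 \<le> (8 * K3 * l\<^sup>2) * a\<^sup>2"
      using st by (simp add: power_mult_distrib power_divide power2_eq_square power3_eq_cube mult_ac)
    then have ad3: "a * d ^ 3 \<le> 8 * K3 * l\<^sup>2" using a0 by (simp add: mult_le_cancel_right)
    \<comment> \<open>The inequalities k^3 l \<le> 8 K3 a^2 and a d^3 \<le> 8 K3 l^2 are multiplied
      so that l cancels; this leaves d k^2 \<le> 8 K3 a, and d k^2 is at least of the order of n by
      \<open>k3\<close> and \<open>nd\<close>.\<close>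
    have "(k ^ 3 * l)\<^sup>2 \<le> (8 * K3 * a\<^sup>2)\<^sup>2" using kl3 pos by (intro power_mono) auto
    then have k6: "k ^ 6 * l\<^sup>2 \<le> 64 * K3\<^sup>2 * a ^ 4"
      by (simp add: power_mult_distrib flip: power_mult)
    have "(d * k\<^sup>2) ^ 3 * a = k ^ 6 * (a * d ^ 3)"
      by (simp add: power_mult_distrib mult_ac flip: power_mult)
    also have "\<dots> \<le> k ^ 6 * (8 * K3 * l\<^sup>2)" using ad3 pos by (intro mult_left_mono) auto
    also have "\<dots> = 8 * K3 * (k ^ 6 * l\<^sup>2)" by simp
    also have "\<dots> \<le> 8 * K3 * (64 * K3\<^sup>2 * a ^ 4)" using k6 pos by (intro mult_left_mono) auto
    also have "\<dots> = (8 * K3 * a) ^ 3 * a"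
      by (simp add: power2_eq_square power3_eq_cube eval_nat_numeral mult_ac)
    finally have "(d * k\<^sup>2) ^ 3 \<le> (8 * K3 * a) ^ 3" using a0 by simp
    then have dk: "d * k\<^sup>2 \<le> 8 * K3 * a" by (rule power_le_imp_le_base[of _ 2, unfolded Suc_eq_plus1, simplified]) (use pos in auto)
    have "\<Delta> ^ 3 * n * n \<le> 64 * (d * k\<^sup>2) * n"
    proof -
      have "64 * k ^ 3 * m = 64 * k\<^sup>2 * (m * k)" by (simp add: power2_eq_square power3_eq_cube)
      also have "\<dots> = 64 * (d * k\<^sup>2) * n" unfolding nd[symmetric] by simp
      finally show ?thesis using k3 by (simp add: power2_eq_square mult_ac)
    qed
    then have "\<Delta> ^ 3 * n \<le> 64 * (d * k\<^sup>2)" using pos by simp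
    then have "\<Delta> ^ 3 * n / (512 * K3) \<le> a" using dk pos by (simp add: field_simps)
    then show ?thesis ..
  qed
qed

text \<open>The constants depend on one another in this order: \<mu> is such that \<mu> d^2 lines
  with k points each give at least 2 n; M, the ratio of B to d, is so large that a dense cluster of
  size B spans \<mu> d^2 lines; X bounds d and k from below and absorbs linear terms;
  \<open>C1\<close> enforces X and leaves room for clusters of 2 M d points. The last conclusion, a
  lower bound for the degrees in P0, is for the passage from lines back to points in the dual
  case.\<close>

lemma extremal_cluster:
  fixes \<Delta> :: real
  assumes \<Delta>: "\<Delta> > 0"
  shows "\<exists>C1 c \<rho> :: real. C1 \<ge> 1 \<and> c > 0 \<and> \<rho> > 0 \<and> (\<forall>(P :: 'p set) (L :: 'l set) inc.
    plane_inc P L inc \<longrightarrow> finite P \<longrightarrow> finite L \<longrightarrow> P \<noteq> {} \<longrightarrow> card P \<le> card L \<longrightarrow>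
    real (card L) \<le> (real (card P))\<^sup>2 / C1 \<longrightarrow> real (card P) \<le> (real (card L))\<^sup>2 / C1 \<longrightarrow>
    \<Delta> ^ 3 * (real (card P))\<^sup>2 * (real (card L))\<^sup>2 \<le> real (num_inc P L inc) ^ 3 \<longrightarrow>
    (\<exists>P0 L0 Q T \<kappa>. P0 \<subseteq> P \<and> L0 \<subseteq> L \<and> Q \<subseteq> P0 \<and> finite T \<and> triple_system L0 inc Q T \<and> 2 \<le> \<kappa> \<and>
      (\<forall>q\<in>Q. \<kappa> \<le> real (card {t\<in>T. q \<in> t})) \<and> real (card Q) \<le> \<rho> * \<kappa> \<and>
      c * real (card P) \<le> real (card (inc_closure P0 L0 inc Q)) \<and>
      (\<forall>p\<in>P0. real (num_inc P L inc) \<le> 4 * real (card P) * real (card {l\<in>L. inc p l}))))"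
proof -
  define K K3 :: real where "K = 353" and "K3 = 353 ^ 3"
  have K: "K > 0" "K3 > 0" unfolding K_def K3_def by simp_all
  define \<mu> where "\<mu> = 1 + 128 / \<Delta> ^ 3"
  have \<mu>: "\<mu> \<ge> 1" "\<mu> * \<Delta> ^ 3 \<ge> 128" using \<Delta> unfolding \<mu>_def by (simp_all add: field_simps)
  define M where "M = 1 + 960\<^sup>2 * 64 / \<Delta> ^ 3 + 8 * K * \<mu> + 64 * 96\<^sup>2 * K3 * \<mu>\<^sup>2"
  have Mt: "960\<^sup>2 * 64 / \<Delta> ^ 3 \<ge> 0" "8 * K * \<mu> \<ge> 0" "64 * 96\<^sup>2 * K3 * \<mu>\<^sup>2 \<ge> 0" using \<Delta> K \<mu> by auto
  have M: "M \<ge> 1" "M \<ge> 960\<^sup>2 * 64 / \<Delta> ^ 3" "M \<ge> 8 * K * \<mu>" "M \<ge> 64 * 96\<^sup>2 * K3 * \<mu>\<^sup>2"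
    using Mt unfolding M_def by linarith+
  define X where "X = 2304 + 768 * K + 131072 * K3 / \<Delta> ^ 6"
  have Xt: "131072 * K3 / \<Delta> ^ 6 \<ge> 0" using \<Delta> K by auto
  have X: "X \<ge> 2304" "X \<ge> 768 * K" "X \<ge> 131072 * K3 / \<Delta> ^ 6" "X \<ge> 4 * K"
    using Xt K unfolding X_def by linarith+
  define C1 where "C1 = 1 + 64 * X ^ 3 / \<Delta> ^ 3 + (2 * M) ^ 3 * K3"
  have Ct: "64 * X ^ 3 / \<Delta> ^ 3 \<ge> 0" "(2 * M) ^ 3 * K3 \<ge> 0" using \<Delta> X(1) M(1) K by auto
  have C1: "C1 \<ge> 1" "C1 \<ge> 64 * X ^ 3 / \<Delta> ^ 3" "C1 \<ge> (2 * M) ^ 3 * K3" using Ct unfolding C1_def by linarith+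
  define c where "c = min (1 / (2 * K)) (\<Delta> ^ 3 / (512 * K3))"
  have c0: "c > 0" unfolding c_def using K \<Delta> by simp
  \<comment> \<open>221184 = 192 * 1152: the cluster has at most 96 B \<le> 192 M d points, and
    \<kappa> is d / 1152.\<close>
  define \<rho> where "\<rho> = 221184 * M"
  have \<rho>0: "\<rho> > 0" unfolding \<rho>_def using M(1) by simp
  show ?thesis
  proof (rule exI[of _ C1], rule exI[of _ c], rule exI[of _ \<rho>], intro conjI allI impI C1(1) c0 \<rho>0)
    fix P :: "'p set" and L :: "'l set" and inc
    assume pi: "plane_inc P L inc" and fin: "finite P" "finite L" and ne: "P \<noteq> {}" and PL: "card P \<le> card L"
      and L1: "real (card L) \<le> (real (card P))\<^sup>2 / C1" and P1: "real (card P) \<le> (real (card L))\<^sup>2 / C1"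
      and I3: "\<Delta> ^ 3 * (real (card P))\<^sup>2 * (real (card L))\<^sup>2 \<le> real (num_inc P L inc) ^ 3"
    define n m I where "n = real (card P)" and "m = real (card L)" and "I = real (num_inc P L inc)"
    have n0: "n > 0" unfolding n_def using ne fin by (simp add: card_gt_0_iff)
    have nm: "n \<le> m" unfolding n_def m_def using PL by simp
    have m0: "m > 0" using n0 nm by simp
    have L1': "C1 * m \<le> n\<^sup>2" and P1': "C1 * n \<le> m\<^sup>2"
      using L1 P1 C1(1) unfolding n_def m_def by (simp_all add: field_simps)
    have I3': "\<Delta> ^ 3 * n\<^sup>2 * m\<^sup>2 \<le> I ^ 3" using I3 unfolding n_def m_def I_def .
    \<comment> \<open>A quarter of the average degrees, so that pruning at these thresholds loses at
      most half of the incidences.\<close>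
    define d k where "d = I / (4 * n)" and "k = I / (4 * m)"
    have Ind: "I = 4 * n * d" "I = 4 * m * k" unfolding d_def k_def using n0 m0 by auto
    have nd: "n * d = m * k" using Ind by simp
    have k3: "\<Delta> ^ 3 * n\<^sup>2 \<le> 64 * k ^ 3 * m"
    proof -
      have "(\<Delta> ^ 3 * n\<^sup>2) * m\<^sup>2 \<le> (64 * k ^ 3 * m) * m\<^sup>2"
        using I3' unfolding Ind(2) by (simp add: power_mult_distrib power2_eq_square power3_eq_cube mult_ac)
      then show ?thesis using m0 by simp
    qed
    have d3: "\<Delta> ^ 3 * m\<^sup>2 \<le> 64 * d ^ 3 * n"
    proof -
      have "(\<Delta> ^ 3 * m\<^sup>2) * n\<^sup>2 \<le> (64 * d ^ 3 * n) * n\<^sup>2"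
        using I3' unfolding Ind(1) by (simp add: power_mult_distrib power2_eq_square power3_eq_cube mult_ac)
      then show ?thesis using n0 by simp
    qed
    have C1X: "64 * X ^ 3 \<le> \<Delta> ^ 3 * C1" using C1(2) \<Delta> by (simp add: field_simps)
    have I0: "I \<ge> 0" unfolding I_def by simp
    have kX: "k \<ge> X"
    proof (rule power_le_imp_le_base[of _ 2])
      have "(64 * X ^ 3) * m \<le> (\<Delta> ^ 3 * C1) * m" using C1X m0 by (intro mult_right_mono) auto
      also have "\<dots> \<le> \<Delta> ^ 3 * n\<^sup>2" using L1' \<Delta> by (simp add: mult.assoc)
      also have "\<dots> \<le> (64 * k ^ 3) * m" using k3 by simp
      finally show "X ^ Suc 2 \<le> k ^ Suc 2" using m0 by (simp add: eval_nat_numeral)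
      show "0 \<le> k" unfolding k_def using I0 m0 by simp
    qed
    have dX: "d \<ge> X"
    proof (rule power_le_imp_le_base[of _ 2])
      have "(64 * X ^ 3) * n \<le> (\<Delta> ^ 3 * C1) * n" using C1X n0 by (intro mult_right_mono) auto
      also have "\<dots> \<le> \<Delta> ^ 3 * m\<^sup>2" using P1' \<Delta> by (simp add: mult.assoc)
      also have "\<dots> \<le> (64 * d ^ 3) * n" using d3 by simp
      finally show "X ^ Suc 2 \<le> d ^ Suc 2" using n0 by (simp add: eval_nat_numeral)
      show "0 \<le> d" unfolding d_def using I0 n0 by simp
    qed
    have k0: "k > 0" and d0: "d > 0" using kX dX X(1) by linarith+
    \<comment> \<open>Szemeredi-Trotter for the whole configuration bounds d^3 n by a multiple of
      m^2; its linear alternative is excluded by d, k > K. Then m \<le> n^2 / C1 makes d small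
      compared with n.\<close>
    have dM: "2 * M * d \<le> n"
    proof -
      have "2 * I = 4 * n * d + 4 * m * k" using Ind by simp
      moreover have "n * K < n * d" "m * K < m * k" using X(4) kX dX K n0 m0 by auto
      moreover have "n * K > 0" "m * K > 0" "K * (n + m) = n * K + m * K" using n0 m0 K by (simp_all add: algebra_simps)
      ultimately have "K * (n + m) < I" by linarith
      then have "I ^ 3 \<le> K3 * n\<^sup>2 * m\<^sup>2"
        using szemeredi_trotter[OF pi fin] unfolding I_def n_def m_def K_def K3_def by linarith
      then have "(64 * d ^ 3 * n) * n\<^sup>2 \<le> (K3 * m\<^sup>2) * n\<^sup>2"
        unfolding Ind(1) by (simp add: power_mult_distrib power2_eq_square power3_eq_cube mult_ac)
      then have 1: "64 * d ^ 3 * n \<le> K3 * m\<^sup>2" using n0 by simp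
      have "(C1 * m)\<^sup>2 \<le> (n\<^sup>2)\<^sup>2" using L1' C1(1) m0 by (intro power_mono) auto
      then have "C1\<^sup>2 * m\<^sup>2 \<le> n ^ 3 * n" by (simp add: power_mult_distrib power2_eq_square power3_eq_cube mult_ac)
      moreover have "C1 * m\<^sup>2 \<le> C1\<^sup>2 * m\<^sup>2" using C1(1) by (intro mult_right_mono) (auto simp: power2_eq_square)
      ultimately have 2: "C1 * m\<^sup>2 \<le> n ^ 3 * n" by linarith
      have "((2 * M * d) ^ 3) * n = (2 * M) ^ 3 * (d ^ 3 * n)" by (simp add: power_mult_distrib)
      also have "\<dots> \<le> (2 * M) ^ 3 * (K3 * m\<^sup>2)"
      proof (rule mult_left_mono)
        have "0 \<le> d ^ 3 * n" using n0 d0 by simp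
        then show "d ^ 3 * n \<le> K3 * m\<^sup>2" using 1 by linarith
      qed (use M(1) in simp)
      also have "\<dots> \<le> C1 * m\<^sup>2" using C1(3) by (simp add: mult_right_mono flip: mult.assoc)
      also note 2
      finally have "(2 * M * d) ^ Suc 2 \<le> n ^ Suc 2" using n0 by (simp add: eval_nat_numeral)
      then show ?thesis by (rule power_le_imp_le_base) (use n0 in simp)
    qed
    define B where "B = nat \<lceil>M * d\<rceil>"
    have Md: "M * d \<ge> 1" using M(1) dX X(1) mult_mono[of 1 M 1 d] by simp
    have B: "B \<ge> 1" "M * d \<le> real B" "real B \<le> 2 * M * d" using Md unfolding B_def by linarith+
    have Bn: "real B \<le> n" using B(3) dM by simp
    have B0: "real B > 0" using B(1) by simp

    obtain P0 L0 where P0: "P0 \<subseteq> P" "L0 \<subseteq> L" "\<And>p. p \<in> P0 \<Longrightarrow> d \<le> card {l\<in>L0. inc p l}"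
        "\<And>l. l \<in> L0 \<Longrightarrow> k \<le> card {p\<in>P0. inc p l}"
        "real (num_inc P L inc) - d * card P - k * card L \<le> real (num_inc P0 L0 inc) - d * card P0 - k * card L0"
      using prune_incidences[OF fin, where \<alpha> = d and \<beta> = k and inc = inc] by blast
    have fin0: "finite P0" "finite L0" using P0(1,2) fin finite_subset by auto
    have cP0: "real (card P0) \<le> n" "real (card L0) \<le> m"
      unfolding n_def m_def using P0(1,2) fin by (simp_all add: card_mono)
    have pi0: "plane_inc P0 L0 inc" by (rule plane_inc_subset[OF pi P0(1,2)])
    have I0': "2 * n * d \<le> num_inc P0 L0 inc"
    proof -
      have "d * card P0 \<ge> 0" "k * card L0 \<ge> 0" using d0 k0 by auto
      then have "I - n * d - m * k \<le> num_inc P0 L0 inc" using P0(5) unfolding I_def n_def m_def by (simp add: mult.commute)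
      then show ?thesis using Ind(1) nd by linarith
    qed
    \<comment> \<open>Each of the three terms is at most n d / 6. The first is compared after
      squaring, by \<open>d3\<close> and the choice of M, with 960 = 6 * 160.\<close>
    have few: "160 * m * sqrt (n / B) + n / B + m \<le> n * d / 2"
    proof -
      have "n / B \<le> n / 1" using B(1) n0 by (intro divide_left_mono) auto
      then have "n / B \<le> n" by simp
      also have "n \<le> n * d / 6" using dX X(1) n0 by simp
      finally have 1: "n / B \<le> n * d / 6" .
      have 2: "m \<le> n * d / 6" unfolding nd using kX X(1) m0 by simp
      have "160 * m * sqrt (n / B) \<le> n * d / 6"
      proof (rule power2_le_imp_le)
        have "960\<^sup>2 * 64 \<le> M * \<Delta> ^ 3" using M(2) \<Delta> by (simp add: field_simps)
        then have "960\<^sup>2 * 64 * m\<^sup>2 \<le> M * \<Delta> ^ 3 * m\<^sup>2" by (rule mult_right_mono) simp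
        also have "\<dots> \<le> M * (64 * d ^ 3 * n)" using d3 M(1) by (simp add: mult.assoc)
        finally have "960\<^sup>2 * m\<^sup>2 \<le> (M * d) * (d\<^sup>2 * n)" by (simp add: power2_eq_square power3_eq_cube mult_ac)
        also have "\<dots> \<le> B * (d\<^sup>2 * n)" using B(2) n0 by (intro mult_right_mono) auto
        finally have "960\<^sup>2 * m\<^sup>2 * (n / B) \<le> B * (d\<^sup>2 * n) * (n / B)" using n0 by (intro mult_right_mono) auto
        also have "\<dots> = (n * d)\<^sup>2" using B0 by (simp add: power2_eq_square)
        finally have "960\<^sup>2 * m\<^sup>2 * (n / B) \<le> (n * d)\<^sup>2" .
        then show "(160 * m * sqrt (n / B))\<^sup>2 \<le> (n * d / 6)\<^sup>2"
          using n0 by (simp add: power_mult_distrib power_divide)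
        show "0 \<le> n * d / 6" using n0 d0 by simp
      qed
      then show ?thesis using 1 2 by linarith
    qed
    obtain Q0 where Q0: "Q0 \<subseteq> P0" "card Q0 \<le> 96 * B" "B * d / 2 + 2 * real (card (lines_meeting L0 inc Q0)) \<le> real (num_inc Q0 L0 inc)"
      using dense_cluster[OF pi0 fin0 cP0 I0' B(1) Bn d0 few] by blast
    have finQ0: "finite Q0" using Q0(1) fin0 finite_subset by blast
    obtain T0 where T0: "finite T0" "triple_system L0 inc Q0 T0" "num_inc Q0 L0 inc \<le> 3 * card T0 + 2 * card (lines_meeting L0 inc Q0)"
      using cluster_triples[OF plane_inc_subset[OF pi0 Q0(1) subset_refl] finQ0 fin0(2)] by blast
    have cT0: "B * d / 6 \<le> card T0"
    proof -
      have "real (num_inc Q0 L0 inc) \<le> real (3 * card T0 + 2 * card (lines_meeting L0 inc Q0))" using T0(3) by (simp only: of_nat_le_iff)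
      then show ?thesis using Q0(3) by simp
    qed
    \<comment> \<open>At least B d / 6 triples live on at most 96 B points; with this threshold
      pruning removes at most B d / 12 of them.\<close>
    define \<kappa> where "\<kappa> = d / 1152"
    obtain Q where Q: "Q \<subseteq> Q0" "\<And>q. q \<in> Q \<Longrightarrow> \<kappa> \<le> card {t\<in>T0. t \<subseteq> Q \<and> q \<in> t}"
      "real (card {t\<in>T0. t \<subseteq> Q0}) - \<kappa> * card Q0 \<le> real (card {t\<in>T0. t \<subseteq> Q}) - \<kappa> * card Q"
      using prune_triples[OF finQ0 T0(1), where \<theta> = \<kappa>] by blast
    define T where "T = {t\<in>T0. t \<subseteq> Q}"
    have finQ: "finite Q" "finite T" using Q(1) finQ0 finite_subset T0(1) unfolding T_def by auto
    have tsT: "triple_system L0 inc Q T" unfolding T_def by (rule triple_system_subset[OF T0(2)])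
    have cQ: "real (card Q) \<le> 96 * real B"
    proof -
      have "card Q \<le> 96 * B" using card_mono[OF finQ0 Q(1)] Q0(2) by linarith
      then have "real (card Q) \<le> real (96 * B)" by (simp only: of_nat_le_iff)
      then show ?thesis by simp
    qed
    have cT: "B * d / 12 \<le> card T"
    proof -
      have "{t\<in>T0. t \<subseteq> Q0} = T0" using T0(2) unfolding triple_system_def by blast
      moreover have "\<kappa> * card Q0 \<le> \<kappa> * (96 * B)" unfolding \<kappa>_def
        using Q0(2) d0 by (intro mult_left_mono) (auto simp flip: of_nat_mult)
      moreover have "\<kappa> * card Q \<ge> 0" unfolding \<kappa>_def using d0 by simp
      ultimately have "card T0 - \<kappa> * (96 * B) \<le> card T" using Q(3) unfolding T_def by simp
      then show ?thesis using cT0 unfolding \<kappa>_def by (simp add: mult.commute[of d])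
    qed
    define E where "E = real (card (rich L0 inc Q))"
    have E0: "E \<ge> 0" unfolding E_def by simp
    \<comment> \<open>At least B d / 4 incidences connect at most 96 B points with the E rich lines.
      Szemeredi-Trotter inside the cluster then bounds E below by d^2 times a factor that grows with
      M.\<close>
    have E: "\<mu> * d\<^sup>2 \<le> E"
    proof -
      define R where "R = rich L0 inc Q"
      have R: "finite R" "R \<subseteq> L0" unfolding R_def rich_def using fin0 by auto
      have "3 * card T \<le> num_inc Q R inc" unfolding R_def by (rule num_inc_rich_triples[OF tsT finQ(1) fin0(2) finQ(2)])
      then have "real (3 * card T) \<le> num_inc Q R inc" by (simp only: of_nat_le_iff)
      then have J: "B * d / 4 \<le> num_inc Q R inc" using cT by simp
      have QP: "Q \<subseteq> P0" using Q(1) Q0(1) by blast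
      from szemeredi_trotter[OF plane_inc_subset[OF pi0 QP R(2)] finQ(1) R(1)] show ?thesis
      proof
        assume "real (num_inc Q R inc) \<le> 353 * (real (card Q) + real (card R))"
        with J have "B * d / 4 \<le> 353 * (real (card Q) + real (card R))" by (rule order_trans)
        also have "\<dots> \<le> K * (96 * real B + E)"
          unfolding K_def E_def R_def using cQ by (intro mult_left_mono add_mono) auto
        finally have "B * d / 4 \<le> K * (96 * real B + E)" .
        moreover have "B * (768 * K) \<le> B * d" using X(2) dX by (intro mult_left_mono) auto
        ultimately have "B * d / 8 \<le> K * E" by (simp add: algebra_simps)
        moreover have "(M * d) * d \<le> B * d" using B(2) d0 by (intro mult_right_mono) auto
        moreover have "(8 * K * \<mu>) * d\<^sup>2 \<le> M * d\<^sup>2" using M(3) by (intro mult_right_mono) auto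
        ultimately have "K * (\<mu> * d\<^sup>2) \<le> K * E" by (simp add: power2_eq_square mult_ac)
        then show ?thesis using K by simp
      next
        assume "real (num_inc Q R inc) ^ 3 \<le> 353 ^ 3 * (real (card Q))\<^sup>2 * (real (card R))\<^sup>2"
        also have "\<dots> \<le> K3 * (96 * real B)\<^sup>2 * E\<^sup>2" unfolding K3_def E_def R_def
          using cQ by (intro mult_right_mono mult_left_mono power_mono) auto
        finally have "real (num_inc Q R inc) ^ 3 \<le> K3 * (96 * real B)\<^sup>2 * E\<^sup>2" .
        moreover have "(B * d / 4) ^ 3 \<le> real (num_inc Q R inc) ^ 3" by (rule power_mono[OF J]) (use d0 in simp)
        ultimately have "(B * d / 4) ^ 3 \<le> K3 * (96 * real B)\<^sup>2 * E\<^sup>2" by (rule order_trans[rotated])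
        then have "(B * d ^ 3) * (real B)\<^sup>2 \<le> (64 * 96\<^sup>2 * K3 * E\<^sup>2) * (real B)\<^sup>2"
          by (simp add: power_mult_distrib power_divide power2_eq_square power3_eq_cube mult_ac)
        then have 1: "B * d ^ 3 \<le> 64 * 96\<^sup>2 * K3 * E\<^sup>2" using B0 by simp
        have "64 * 96\<^sup>2 * K3 * (\<mu> * d\<^sup>2)\<^sup>2 = (64 * 96\<^sup>2 * K3 * \<mu>\<^sup>2) * d ^ 4"
          by (simp add: power_mult_distrib flip: power_mult)
        also have "\<dots> \<le> M * d ^ 4" using M(4) by (intro mult_right_mono) auto
        also have "\<dots> = (M * d) * d ^ 3" by (simp add: eval_nat_numeral mult_ac)
        also have "\<dots> \<le> B * d ^ 3" using B(2) d0 by (intro mult_right_mono) auto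
        also note 1
        finally have "(\<mu> * d\<^sup>2)\<^sup>2 \<le> E\<^sup>2" using K by simp
        then show ?thesis by (rule power2_le_imp_le) (rule E0)
      qed
    qed
    define A where "A = inc_closure P0 L0 inc Q"
    define R where "R = rich L0 inc A"
    have A: "A \<subseteq> P0" "finite A" unfolding A_def using inc_closure_subset fin0 finite_subset by metis+
    have R: "finite R" "R \<subseteq> L0" unfolding R_def rich_def using fin0 by auto
    have QP: "Q \<subseteq> P0" using Q(1) Q0(1) by blast
    have QA: "Q \<subseteq> A" 
    proof
      fix q assume "q \<in> Q"
      then show "q \<in> A" unfolding A_def using QP by (intro inc_closure.base) auto
    qed
    define a l Y where "a = real (card A)" and "l = real (card R)" and "Y = real (num_inc A R inc)"
    have El: "E \<le> l"
    proof -
      have "rich L0 inc Q \<subseteq> R" using QA unfolding R_def rich_def by blast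
      then show ?thesis unfolding E_def l_def using R(1) by (simp add: card_mono)
    qed
    have dl: "\<mu> * d\<^sup>2 \<le> l" using E El by simp
    have "d\<^sup>2 \<le> \<mu> * d\<^sup>2" using \<mu>(1) mult_right_mono[of 1 \<mu> "d\<^sup>2"] by simp
    then have dl': "d\<^sup>2 \<le> l" using dl by linarith
    \<comment> \<open>The estimate gives k l \<ge> 2 m; the assumption n \<le> m turns this into
      what the growth of the closure requires.\<close>
    have kl2: "2 * n \<le> k * l"
    proof -
      have "128 * m \<le> (\<mu> * \<Delta> ^ 3) * m" using \<mu>(2) m0 by (intro mult_right_mono) auto
      then have "128 * m * m \<le> \<mu> * (\<Delta> ^ 3 * m\<^sup>2)" using m0 by (simp add: power2_eq_square)
      also have "\<dots> \<le> \<mu> * (64 * d ^ 3 * n)" using d3 \<mu>(1) by (intro mult_left_mono) auto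
      also have "\<dots> = 64 * (k * (\<mu> * d\<^sup>2)) * m"
      proof -
        have "d ^ 3 * n = d\<^sup>2 * (n * d)" by (simp add: power2_eq_square power3_eq_cube)
        then show ?thesis unfolding nd by (simp add: mult_ac)
      qed
      finally have "(2 * m) * (64 * m) \<le> (k * (\<mu> * d\<^sup>2)) * (64 * m)" by (simp add: mult_ac)
      then have "2 * m \<le> k * (\<mu> * d\<^sup>2)" by (rule mult_right_le_imp_le) (use m0 in simp)
      also have "\<dots> \<le> k * l" using dl k0 by (intro mult_left_mono) auto
      finally show ?thesis using nm by simp
    qed
    have kl: "k * l \<le> Y + n"
    proof -
      have "k * l = (\<Sum>l\<in>R. k)" unfolding l_def by simp
      also have "\<dots> \<le> (\<Sum>l\<in>R. real (card {p\<in>P0. inc p l}))" using P0(4) R(2) by (intro sum_mono) auto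
      also have "\<dots> = real (num_inc P0 R inc)" by (simp add: num_inc_lines[OF fin0(1) R(1)])
      also have "\<dots> \<le> real (num_inc A R inc + card P0)"
        using num_inc_rich_closure[OF fin0, of inc Q] unfolding A_def R_def by (simp only: of_nat_le_iff)
      finally show ?thesis using cP0 unfolding Y_def by simp
    qed
    have ad: "a * d \<le> Y + m"
    proof -
      have "a * d = (\<Sum>p\<in>A. d)" unfolding a_def by simp
      also have "\<dots> \<le> (\<Sum>p\<in>A. real (card {l\<in>L0. inc p l}))" using P0(3) A(1) by (intro sum_mono) auto
      also have "\<dots> = real (num_inc A L0 inc)" by (simp add: num_inc_points[OF A(2) fin0(2)])
      also have "\<dots> \<le> real (num_inc A R inc + card L0)"
        using num_inc_le_rich[OF A(2) fin0(2), of inc] unfolding R_def by (simp only: of_nat_le_iff)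
      finally show ?thesis using cP0 unfolding Y_def by simp
    qed
    have ST: "Y \<le> K * (a + l) \<or> Y ^ 3 \<le> K3 * a\<^sup>2 * l\<^sup>2"
      using szemeredi_trotter[OF plane_inc_subset[OF pi0 A(1) R(2)] A(2) R(1)]
      unfolding Y_def K_def K3_def a_def l_def .
    have "n / (2 * K) \<le> a \<or> \<Delta> ^ 3 * n / (512 * K3) \<le> a"
      by (rule closure_growth[OF n0 m0 k0 d0 _ _ K \<Delta> nd k3 d3 kl kl2 dl' ad ST])
         (use kX X in \<open>auto simp: a_def l_def\<close>)
    then have "c * n \<le> a"
    proof
      assume "n / (2 * K) \<le> a"
      moreover have "c * n \<le> 1 / (2 * K) * n" unfolding c_def using n0 by (intro mult_right_mono) auto
      ultimately show ?thesis by simp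
    next
      assume "\<Delta> ^ 3 * n / (512 * K3) \<le> a"
      moreover have "c * n \<le> \<Delta> ^ 3 / (512 * K3) * n" unfolding c_def using n0 by (intro mult_right_mono) auto
      ultimately show ?thesis by simp
    qed
    have deg: "real (num_inc P L inc) \<le> 4 * real (card P) * real (card {l\<in>L. inc p l})" if p: "p \<in> P0" for p
    proof -
      have "card {l\<in>L0. inc p l} \<le> card {l\<in>L. inc p l}" using P0(2) fin by (intro card_mono) auto
      then have "d \<le> card {l\<in>L. inc p l}" using P0(3)[OF p] by linarith
      then have "4 * n * d \<le> 4 * n * card {l\<in>L. inc p l}" using n0 by (intro mult_left_mono) auto
      then show ?thesis unfolding Ind(1)[symmetric] unfolding I_def n_def .
    qed
    have cQ\<kappa>: "real (card Q) \<le> \<rho> * \<kappa>"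
      using cQ B(3) unfolding \<rho>_def \<kappa>_def by simp
    have degT: "\<kappa> \<le> real (card {t\<in>T. q \<in> t})" if "q \<in> Q" for q
    proof -
      have "{t\<in>T. q \<in> t} = {t\<in>T0. t \<subseteq> Q \<and> q \<in> t}" unfolding T_def by blast
      then show ?thesis using Q(2)[OF that] by simp
    qed
    have \<kappa>2: "2 \<le> \<kappa>" unfolding \<kappa>_def using dX X(1) by simp
    show "\<exists>P0 L0 Q T \<kappa>. P0 \<subseteq> P \<and> L0 \<subseteq> L \<and> Q \<subseteq> P0 \<and> finite T \<and> triple_system L0 inc Q T \<and> 2 \<le> \<kappa> \<and>
      (\<forall>q\<in>Q. \<kappa> \<le> real (card {t\<in>T. q \<in> t})) \<and> real (card Q) \<le> \<rho> * \<kappa> \<and>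
      c * real (card P) \<le> real (card (inc_closure P0 L0 inc Q)) \<and>
      (\<forall>p\<in>P0. real (num_inc P L inc) \<le> 4 * real (card P) * real (card {l\<in>L. inc p l}))"
      using P0(1,2) QP finQ(2) tsT \<kappa>2 degT cQ\<kappa> \<open>c * n \<le> a\<close> deg
      unfolding n_def a_def A_def
      by (intro exI[of _ P0] exI[of _ L0] exI[of _ Q] exI[of _ T] exI[of _ \<kappa>]) blast
  qed
qed

section \<open>Infinitesimal flexes of a configuration\<close>

definition cross :: "complex \<times> complex \<Rightarrow> complex \<times> complex \<Rightarrow> complex" where
  "cross u w = fst u * snd w - snd u * fst w"

lemma cross_diff_right: "cross u (w - z) = cross u w - cross u z"
  by (simp add: cross_def algebra_simps)

lemma cross_diff_left: "cross (u - w) z = cross u z - cross w z"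
  by (simp add: cross_def algebra_simps)

lemma cross_zero [simp]: "cross 0 w = 0" "cross w 0 = 0"
  by (simp_all add: cross_def)

lemma cross_commute: "cross u w = - cross w u"
  by (simp add: cross_def)

lemma cross_trans:
  assumes "u \<noteq> 0" "cross u w = 0" "cross u z = 0"
  shows "cross w z = 0"
proof -
  have e: "fst u * snd w = snd u * fst w" "fst u * snd z = snd u * fst z"
    using assms unfolding cross_def by auto
  have "fst u * cross w z = 0" "snd u * cross w z = 0"
    using e unfolding cross_def by - (algebra, algebra)
  moreover have "fst u \<noteq> 0 \<or> snd u \<noteq> 0" using assms(1) by (auto simp: prod_eq_iff)
  ultimately show ?thesis by auto
qed

lemma cross_parallel:
  assumes "u \<noteq> 0" "cross u w = 0"
  shows "\<exists>\<tau>. w = (\<tau> * fst u, \<tau> * snd u)"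
proof (cases "fst u = 0")
  case True
  then have "snd u \<noteq> 0" using assms(1) by (auto simp: prod_eq_iff)
  then show ?thesis using assms(2) True
    by (intro exI[of _ "snd w / snd u"]) (auto simp: cross_def prod_eq_iff)
next
  case False
  then show ?thesis using assms(2)
    by (intro exI[of _ "fst w / fst u"]) (auto simp: cross_def prod_eq_iff field_simps)
qed

lemma collinear3_crs: "collinear3 p q w \<longleftrightarrow> cross (q - p) (w - p) = 0"
  by (simp add: collinear3_def cross_def)

lemma flex_crs: "flex p q w p' q' w' \<longleftrightarrow> cross (q' - p') (w - p) + cross (q - p) (w' - p') = 0"
  by (simp add: flex_def cross_def algebra_simps)

definition real_collinear :: "real \<times> real \<Rightarrow> real \<times> real \<Rightarrow> real \<times> real \<Rightarrow> bool" where
  "real_collinear a b c \<longleftrightarrow> (fst b - fst a) * (snd c - snd a) - (snd b - snd a) * (fst c - fst a) = 0"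

lemma line_collinear:
  assumes "is_line l" "a \<in> l" "b \<in> l" "c \<in> l"
  shows "real_collinear a b c"
proof -
  obtain s t u where l: "(s, t) \<noteq> (0, 0)" "l = {(x, y). s * x + t * y = u}"
    using assms(1) unfolding is_line_def by blast
  have e: "s * fst a + t * snd a = u" "s * fst b + t * snd b = u" "s * fst c + t * snd c = u"
    using assms l(2) by auto
  define \<beta> \<beta>' \<gamma> \<gamma>' where d: "\<beta> = fst b - fst a" "\<beta>' = snd b - snd a" "\<gamma> = fst c - fst a" "\<gamma>' = snd c - snd a"
  have e': "s * \<beta> = - t * \<beta>'" "s * \<gamma> = - t * \<gamma>'" using e unfolding d by (simp_all add: algebra_simps)
  have e2: "t * \<beta>' = - s * \<beta>" "t * \<gamma>' = - s * \<gamma>" using e' by simp_all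
  have "s * (\<beta> * \<gamma>' - \<beta>' * \<gamma>) = (s * \<beta>) * \<gamma>' - \<beta>' * (s * \<gamma>)" by (simp add: algebra_simps)
  also have "\<dots> = 0" unfolding e' by simp
  finally have 1: "s * (\<beta> * \<gamma>' - \<beta>' * \<gamma>) = 0" .
  have "t * (\<beta> * \<gamma>' - \<beta>' * \<gamma>) = \<beta> * (t * \<gamma>') - (t * \<beta>') * \<gamma>" by (simp add: algebra_simps)
  also have "\<dots> = 0" unfolding e2 by simp
  finally have "t * (\<beta> * \<gamma>' - \<beta>' * \<gamma>) = 0" .
  with 1 have "s * (\<beta> * \<gamma>' - \<beta>' * \<gamma>) = 0" "t * (\<beta> * \<gamma>' - \<beta>' * \<gamma>) = 0" by blast+
  then show ?thesis using l(1) unfolding real_collinear_def d by auto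
qed

lemma line_through:
  assumes "is_line l" "p \<in> l" "a \<in> l" "p \<noteq> a" "real_collinear p a q"
  shows "q \<in> l"
proof -
  obtain s t u where l: "(s, t) \<noteq> (0, 0)" "l = {(x, y). s * x + t * y = u}"
    using assms(1) unfolding is_line_def by blast
  have e: "s * fst p + t * snd p = u" "s * fst a + t * snd a = u" using assms l(2) by auto
  have r: "(fst a - fst p) * (snd q - snd p) - (snd a - snd p) * (fst q - fst p) = 0"
    using assms(5) unfolding real_collinear_def .
  have e': "s * (fst a - fst p) + t * (snd a - snd p) = 0" using e by (simp add: algebra_simps)
  have f: "s * fst q + t * snd q - u = s * (fst q - fst p) + t * (snd q - snd p)" using e by (simp add: algebra_simps)
  have "(fst a - fst p) * (s * fst q + t * snd q - u) = (fst q - fst p) * (s * (fst a - fst p) + t * (snd a - snd p)) +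
      t * ((fst a - fst p) * (snd q - snd p) - (snd a - snd p) * (fst q - fst p))"
    unfolding f by (simp add: algebra_simps)
  moreover have "(snd a - snd p) * (s * fst q + t * snd q - u) = (snd q - snd p) * (s * (fst a - fst p) + t * (snd a - snd p)) -
      s * ((fst a - fst p) * (snd q - snd p) - (snd a - snd p) * (fst q - fst p))"
    unfolding f by (simp add: algebra_simps)
  ultimately have "(fst a - fst p) * (s * fst q + t * snd q - u) = 0" "(snd a - snd p) * (s * fst q + t * snd q - u) = 0"
    unfolding e' r by simp_all
  moreover have "fst a - fst p \<noteq> 0 \<or> snd a - snd p \<noteq> 0" using assms(4) by (auto simp: prod_eq_iff)
  ultimately have "s * fst q + t * snd q = u" by auto
  then show ?thesis unfolding l(2) by (cases q) auto
qed

lemma two_lines_not_collinear: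
  assumes "is_line l" "is_line l'" "l \<noteq> l'" "p \<in> l" "p \<in> l'" "a \<in> l" "a' \<in> l'" "p \<noteq> a" "p \<noteq> a'"
  shows "\<not> real_collinear p a a'"
proof
  assume r: "real_collinear p a a'"
  have "a' \<in> l" by (rule line_through[OF assms(1,4,6,8) r])
  have "l \<subseteq> l'" using line_collinear[OF assms(1,4) \<open>a' \<in> l\<close>] line_through[OF assms(2,5,7,9)] by blast
  moreover have "l' \<subseteq> l" using line_collinear[OF assms(2,5,7)] line_through[OF assms(1,4) \<open>a' \<in> l\<close> assms(9)] by blast
  ultimately show False using assms(3) by blast
qed

text \<open>The open conditions under which the rank argument works. Points are indexed by their
  original real positions, so collinearity of the indices is the original collinearity.\<close>

definition nondeg :: "(real \<times> real) set \<Rightarrow> (real \<times> real \<Rightarrow> complex \<times> complex) \<Rightarrow> bool" where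
  "nondeg P x \<longleftrightarrow> (\<forall>s\<in>P. \<forall>t\<in>P. s \<noteq> t \<longrightarrow> x s \<noteq> x t) \<and>
     (\<forall>a\<in>P. \<forall>b\<in>P. \<forall>c\<in>P. \<not> real_collinear a b c \<longrightarrow> \<not> collinear3 (x a) (x b) (x c))"

definition realizes :: "(real \<times> real) set \<Rightarrow> (real \<times> real) set set \<Rightarrow> (real \<times> real \<Rightarrow> complex \<times> complex) \<Rightarrow> bool" where
  "realizes P L x \<longleftrightarrow> (\<forall>a b c. {a, b, c} \<in> triples_on_lines P L \<longrightarrow> collinear3 (x a) (x b) (x c))"

definition flexes :: "(real \<times> real) set \<Rightarrow> (real \<times> real) set set \<Rightarrow> (real \<times> real \<Rightarrow> complex \<times> complex) \<Rightarrow>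
    (real \<times> real \<Rightarrow> complex \<times> complex) \<Rightarrow> bool" where
  "flexes P L x v \<longleftrightarrow> (\<forall>a b c. {a, b, c} \<in> triples_on_lines P L \<longrightarrow> flex (x a) (x b) (x c) (v a) (v b) (v c))"

definition lin_comb :: "(nat \<Rightarrow> complex) \<Rightarrow> nat \<Rightarrow> (nat \<Rightarrow> 'a \<Rightarrow> complex \<times> complex) \<Rightarrow> 'a \<Rightarrow> complex \<times> complex" where
  "lin_comb c k v s = (\<Sum>j<k. c j * fst (v j s), \<Sum>j<k. c j * snd (v j s))"

lemma cross_lin_comb: "cross u (lin_comb c k v s) = (\<Sum>j<k. c j * cross u (v j s))"
  by (simp add: cross_def lin_comb_def sum_distrib_left sum_subtractf[symmetric] algebra_simps)

lemma flexes_lin_comb: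
  assumes "\<And>j. j < k \<Longrightarrow> flexes P L x (v j)"
  shows "flexes P L x (lin_comb c k v)"
  unfolding flexes_def
proof (intro allI impI)
  fix p q w assume t: "{p, q, w} \<in> triples_on_lines P L"
  \<comment> \<open>The flex equation grouped by velocities, in which form it is visibly linear in
    them.\<close>
  have e: "flex P Q W P' Q' W' \<longleftrightarrow> cross (Q - P) W' - cross (W - P) Q' + cross (W - Q) P' = 0" for P Q W P' Q' W'
    by (simp add: flex_def cross_def algebra_simps)
  have "cross (x q - x p) (v j w) - cross (x w - x p) (v j q) + cross (x w - x q) (v j p) = 0" if "j < k" for j
    using assms[OF that] t unfolding flexes_def e by blast
  then have "(\<Sum>j<k. c j * (cross (x q - x p) (v j w) - cross (x w - x p) (v j q) + cross (x w - x q) (v j p))) = 0"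
    by simp
  then show "flex (x p) (x q) (x w) (lin_comb c k v p) (lin_comb c k v q) (lin_comb c k v w)"
    unfolding e cross_lin_comb by (simp add: algebra_simps sum.distrib sum_subtractf)
qed

section \<open>Reduction of rigidity to a bound on independent flexes\<close>

lemma poly_fun_diff: "poly_fun S f \<Longrightarrow> poly_fun S g \<Longrightarrow> poly_fun S (\<lambda>x. f x - g x)"
  using pf_add[OF _ pf_mult[OF pf_const[of S "-1"]], of f g] by simp

lemma poly_common_nonzero:
  assumes "finite FF" "\<And>f. f \<in> FF \<Longrightarrow> poly_fun S f \<and> f x0 \<noteq> 0"
  shows "\<exists>b. poly_fun S b \<and> b x0 \<noteq> 0 \<and> (\<forall>x. b x \<noteq> 0 \<longrightarrow> (\<forall>f\<in>FF. f x \<noteq> 0))"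
  using assms
proof (induction FF rule: finite_induct)
  case empty
  show ?case by (intro exI[of _ "\<lambda>_. 1"]) (auto intro: pf_const)
next
  case (insert f FF)
  then obtain b where b: "poly_fun S b" "b x0 \<noteq> 0" "\<forall>x. b x \<noteq> 0 \<longrightarrow> (\<forall>f\<in>FF. f x \<noteq> 0)" by auto
  have f: "poly_fun S f" "f x0 \<noteq> 0" using insert.prems by auto
  show ?case
    by (intro exI[of _ "\<lambda>x. f x * b x"]) (use b f in \<open>auto intro: pf_mult\<close>)
qed

text \<open>b is a product of finitely many polynomials, one for each condition. For the
  distinctness of two points the factor is the difference in a coordinate in which the original
  points differ, so it does not vanish at the configuration.\<close>

lemma nondeg_poly:
  assumes fin: "finite P"
  shows "\<exists>b. poly_fun P b \<and> b (config_point P) \<noteq> 0 \<and> (\<forall>x. b x \<noteq> 0 \<longrightarrow> nondeg P x)"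
proof -
  define F1 where "F1 = (\<lambda>(s, t). (\<lambda>x :: real \<times> real \<Rightarrow> complex \<times> complex. fst (x s) - fst (x t))) ` {(s, t) \<in> P \<times> P. fst s \<noteq> fst t}"
  define F2 where "F2 = (\<lambda>(s, t). (\<lambda>x :: real \<times> real \<Rightarrow> complex \<times> complex. snd (x s) - snd (x t))) ` {(s, t) \<in> P \<times> P. snd s \<noteq> snd t}"
  define F3 where "F3 = (\<lambda>(a, b, c). (\<lambda>x :: real \<times> real \<Rightarrow> complex \<times> complex.
      (fst (x b) - fst (x a)) * (snd (x c) - snd (x a)) - (snd (x b) - snd (x a)) * (fst (x c) - fst (x a)))) ` {(a, b, c) \<in> P \<times> P \<times> P. \<not> real_collinear a b c}"
  have "finite {(s, t) \<in> P \<times> P. fst s \<noteq> fst t}" "finite {(s, t) \<in> P \<times> P. snd s \<noteq> snd t}"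
    "finite {(a, b, c) \<in> P \<times> P \<times> P. \<not> real_collinear a b c}"
    by (rule finite_subset[of _ "P \<times> P"], use fin in auto)
       (rule finite_subset[of _ "P \<times> P"], use fin in auto, rule finite_subset[of _ "P \<times> P \<times> P"], use fin in auto)
  then have finF: "finite (F1 \<union> F2 \<union> F3)" unfolding F1_def F2_def F3_def by simp
  have nz: "poly_fun P f \<and> f (config_point P) \<noteq> 0" if fF: "f \<in> F1 \<union> F2 \<union> F3" for f
  proof -
    consider "f \<in> F1" | "f \<in> F2" | "f \<in> F3" using fF by blast
    then show ?thesis
    proof cases
      case 1
      then show ?thesis unfolding F1_def by (auto simp: config_point_def intro!: poly_fun_diff pf_fst)
    next
      case 2
      then show ?thesis unfolding F2_def by (auto simp: config_point_def intro!: poly_fun_diff pf_snd)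
    next
      case 3
      then obtain a b c where abc: "a \<in> P" "b \<in> P" "c \<in> P" "\<not> real_collinear a b c"
        "f = (\<lambda>x. (fst (x b) - fst (x a)) * (snd (x c) - snd (x a)) - (snd (x b) - snd (x a)) * (fst (x c) - fst (x a)))"
        unfolding F3_def by auto
      have "poly_fun P f" unfolding abc(5) using abc(1-3)
        by (intro poly_fun_diff pf_mult pf_fst pf_snd)
      moreover have "f (config_point P) = complex_of_real ((fst b - fst a) * (snd c - snd a) - (snd b - snd a) * (fst c - fst a))"
        unfolding abc(5) config_point_def using abc(1-3) by simp
      ultimately show ?thesis using abc(4) unfolding real_collinear_def by (simp only: of_real_eq_0_iff) simp
    qed
  qed
  obtain b where b: "poly_fun P b" "b (config_point P) \<noteq> 0" "\<forall>x. b x \<noteq> 0 \<longrightarrow> (\<forall>f\<in>F1 \<union> F2 \<union> F3. f x \<noteq> 0)"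
    using poly_common_nonzero[OF finF nz] by blast
  have "nondeg P x" if bx: "b x \<noteq> 0" for x
  proof -
    have F: "\<And>f. f \<in> F1 \<Longrightarrow> f x \<noteq> 0" "\<And>f. f \<in> F2 \<Longrightarrow> f x \<noteq> 0" "\<And>f. f \<in> F3 \<Longrightarrow> f x \<noteq> 0" using b(3) bx by auto
    have "x s \<noteq> x t" if st: "s \<in> P" "t \<in> P" "s \<noteq> t" for s t
    proof (cases "fst s = fst t")
      case True
      then have "snd s \<noteq> snd t" using st by (simp add: prod_eq_iff)
      then have "(\<lambda>x. snd (x s) - snd (x t)) \<in> F2" unfolding F2_def using st by (intro image_eqI[of _ _ "(s, t)"]) auto
      from F(2)[OF this] show ?thesis by auto
    next
      case False
      then have "(\<lambda>x. fst (x s) - fst (x t)) \<in> F1" unfolding F1_def using st by (intro image_eqI[of _ _ "(s, t)"]) auto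
      from F(1)[OF this] show ?thesis by auto
    qed
    moreover have "\<not> collinear3 (x p) (x q) (x w)" if "p \<in> P" "q \<in> P" "w \<in> P" "\<not> real_collinear p q w" for p q w
    proof -
      have "(\<lambda>x. (fst (x q) - fst (x p)) * (snd (x w) - snd (x p)) - (snd (x q) - snd (x p)) * (fst (x w) - fst (x p))) \<in> F3"
        unfolding F3_def using that by (intro image_eqI[of _ _ "(p, q, w)"]) auto
      from F(3)[OF this] show ?thesis unfolding collinear3_def .
    qed
    ultimately show ?thesis unfolding nondeg_def by blast
  qed
  then show ?thesis using b by blast
qed

text \<open>A component through the configuration meets the open set of nondegenerate assignments. A
  chain of length k with top Z therefore yields a nondegenerate point of Z with k independent
  flexes.\<close>

lemma rigid_config_criterion:
  assumes fin: "finite P" and lines: "\<And>l. l \<in> L \<Longrightarrow> is_line l"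
    and bound: "\<And>x v k. nondeg P x \<Longrightarrow> realizes P L x \<Longrightarrow> (\<And>j. j < k \<Longrightarrow> flexes P L x (v j)) \<Longrightarrow>
      (\<And>c. (\<And>s. s \<in> P \<Longrightarrow> lin_comb c k v s = 0) \<Longrightarrow> (\<forall>j<k. c j = 0)) \<Longrightarrow> k \<le> r"
  shows "rigid_config r P L"
  unfolding rigid_config_def rigid_wrt_def
proof (intro conjI allI impI)
  define T where "T = triples_on_lines P L"
  have TP: "a \<in> P" "b \<in> P" "c \<in> P" if "{a, b, c} \<in> T" for a b c using that unfolding T_def triples_on_lines_def by auto
  show "config_point P \<in> K_var P (triples_on_lines P L)"
    unfolding K_var_def
  proof (intro CollectI conjI allI impI)
    show "config_point P \<in> ext_space P" unfolding ext_space_def config_point_def by simp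
    fix a b c assume t: "{a, b, c} \<in> triples_on_lines P L"
    then obtain l where l: "l \<in> L" "a \<in> l" "b \<in> l" "c \<in> l" unfolding triples_on_lines_def by auto
    have abc: "a \<in> P" "b \<in> P" "c \<in> P" using TP t unfolding T_def by blast+
    have "complex_of_real ((fst b - fst a) * (snd c - snd a) - (snd b - snd a) * (fst c - fst a)) = 0"
      using line_collinear[OF lines[OF l(1)] l(2-4)] unfolding real_collinear_def by (simp only: of_real_0)
    then show "collinear3 (config_point P a) (config_point P b) (config_point P c)"
      unfolding collinear3_def config_point_def using abc by simp
  qed
  fix Z assume Z: "irreducible_component P (K_var P (triples_on_lines P L)) Z \<and> config_point P \<in> Z"
  have ZK: "Z \<subseteq> K_var P T" "zariski_closed P Z" "zariski_irreducible P Z" "config_point P \<in> Z"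
    using Z unfolding irreducible_component_def T_def by auto
  obtain b where b: "poly_fun P b" "b (config_point P) \<noteq> 0" "\<And>x. b x \<noteq> 0 \<Longrightarrow> nondeg P x"
    using nondeg_poly[OF fin] by blast
  have main: "k \<le> r" if ch: "\<And>i. i \<le> k \<Longrightarrow> zariski_closed P (Ch i) \<and> zariski_irreducible P (Ch i)"
      "\<And>i. i < k \<Longrightarrow> Ch i \<subset> Ch (Suc i)" and top: "Ch k = Z" for Ch k
  proof -
    obtain x v where x: "x \<in> Ch k" "b x \<noteq> 0"
      and v: "\<forall>j<k. \<forall>p\<in>P. \<forall>q\<in>P. \<forall>w\<in>P. (\<forall>y\<in>Ch k. collinear3 (y p) (y q) (y w)) \<longrightarrow>
         flex (x p) (x q) (x w) (v j p) (v j q) (v j w)"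
      and indep: "\<forall>c. (\<forall>s\<in>P. (\<Sum>j<k. c j * fst (v j s)) = 0 \<and> (\<Sum>j<k. c j * snd (v j s)) = 0) \<longrightarrow> (\<forall>j<k. c j = 0)"
      using chain_flexes[OF fin, of k Ch b "config_point P"] ch b ZK(4) unfolding top by auto
    have col: "collinear3 (y p) (y q) (y w)" if "{p, q, w} \<in> T" "y \<in> Ch k" for p q w y
      using that ZK(1) unfolding top K_var_def by blast
    show ?thesis
    proof (rule bound[of x k v])
      show "nondeg P x" by (rule b(3)[OF x(2)])
      show "realizes P L x" unfolding realizes_def using col x(1) unfolding T_def by blast
      show "flexes P L x (v j)" if j: "j < k" for j unfolding flexes_def
      proof (intro allI impI)
        fix p q w assume t: "{p, q, w} \<in> triples_on_lines P L"
        then have "{p, q, w} \<in> T" unfolding T_def .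
        then show "flex (x p) (x q) (x w) (v j p) (v j q) (v j w)"
          using v j TP col by blast
      qed
      show "\<forall>j<k. c j = 0" if "\<And>s. s \<in> P \<Longrightarrow> lin_comb c k v s = 0" for c
        using indep that unfolding lin_comb_def by (simp add: prod_eq_iff)
    qed
  qed
  show "zariski_dim_le P Z r"
    unfolding zariski_dim_le_def
  proof (intro allI impI, elim conjE)
    fix Ch k
    assume ch: "\<forall>i\<le>k. zariski_closed P (Ch i) \<and> zariski_irreducible P (Ch i) \<and> Ch i \<subseteq> Z" "\<forall>i<k. Ch i \<subset> Ch (Suc i)"
    show "k \<le> r"
    proof (cases "Ch k = Z")
      case True
      then show ?thesis using main[of k Ch] ch by blast
    next
      case False
      \<comment> \<open>The open condition is known to be satisfied somewhere on Z only, so a chain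
        stopping short of Z is first prolonged by Z.\<close>
      define Ch' where "Ch' = Ch(Suc k := Z)"
      have "Suc k \<le> r"
      proof (rule main[of "Suc k" Ch'])
        show "zariski_closed P (Ch' i) \<and> zariski_irreducible P (Ch' i)" if "i \<le> Suc k" for i
          using that ch(1) ZK unfolding Ch'_def by (cases "i = Suc k") auto
        show "Ch' i \<subset> Ch' (Suc i)" if "i < Suc k" for i
        proof (cases "i = k")
          case True
          then show ?thesis using False ch(1) unfolding Ch'_def by auto
        next
          case False
          then show ?thesis using that ch(2) unfolding Ch'_def by auto
        qed
        show "Ch' (Suc k) = Z" unfolding Ch'_def by simp
      qed
      then show ?thesis by simp
    qed
  qed
qed

section \<open>Flexes of a closed cluster and of its dual\<close>

lemma line_unique:
  assumes "is_line l" "is_line l'" "p \<in> l" "q \<in> l" "p \<in> l'" "q \<in> l'" "p \<noteq> q"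
  shows "l = l'"
proof (rule ccontr)
  assume "l \<noteq> l'"
  then have "\<not> real_collinear p q q"
    using two_lines_not_collinear[OF assms(1,2) _ assms(3,5,4,6,7,7)] by blast
  then show False unfolding real_collinear_def by simp
qed

locale flex_config =
  fixes P :: "(real \<times> real) set" and L :: "(real \<times> real) set set" and x :: "real \<times> real \<Rightarrow> complex \<times> complex"
  assumes lines: "\<And>l. l \<in> L \<Longrightarrow> is_line l" and nd: "nondeg P x" and re: "realizes P L x"
begin

lemma distinct_x: "a \<in> P \<Longrightarrow> b \<in> P \<Longrightarrow> a \<noteq> b \<Longrightarrow> x a - x b \<noteq> 0"
  using nd unfolding nondeg_def by auto

lemma triple_on_line:
  assumes "l \<in> L" "{a, b, c} \<subseteq> P \<inter> l" "a \<noteq> b" "a \<noteq> c" "b \<noteq> c"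
  shows "{a, b, c} \<in> triples_on_lines P L"
  using assms unfolding triples_on_lines_def by auto

lemma collinear_x:
  assumes "l \<in> L" "{a, b, c} \<subseteq> P \<inter> l"
  shows "cross (x b - x a) (x c - x a) = 0"
proof (cases "a \<noteq> b \<and> a \<noteq> c \<and> b \<noteq> c")
  case True
  then show ?thesis using triple_on_line[OF assms] re unfolding realizes_def collinear3_crs by blast
next
  case False
  then show ?thesis by (auto simp: cross_def)
qed

lemma flex_x:
  assumes "flexes P L x v" "l \<in> L" "{a, b, c} \<subseteq> P \<inter> l"
  shows "cross (v b - v a) (x c - x a) + cross (x b - x a) (v c - v a) = 0"
proof (cases "a \<noteq> b \<and> a \<noteq> c \<and> b \<noteq> c")
  case True
  then show ?thesis using triple_on_line[OF assms(2,3)] assms(1) unfolding flexes_def flex_crs by blast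
next
  case False
  then show ?thesis by (auto simp: cross_def)
qed

lemma crossing_x:
  assumes "l \<in> L" "l' \<in> L" "l \<noteq> l'" "p \<in> P" "a \<in> P" "a' \<in> P" "p \<in> l" "p \<in> l'" "a \<in> l" "a' \<in> l'" "p \<noteq> a" "p \<noteq> a'"
  shows "cross (x a - x p) (x a' - x p) \<noteq> 0"
  using two_lines_not_collinear[OF lines[OF assms(1)] lines[OF assms(2)] assms(3,7,8,9,10,11,12)]
    nd assms(4-6) unfolding nondeg_def collinear3_crs by blast

text \<open>If two points of a line do not move, the velocity of a third one is parallel to the
  image of the line. Images of two different lines through p are not parallel by nondegeneracy, so
  the velocity of p is 0.\<close>

lemma inc_closure_flex_zero:
  assumes P: "P = inc_closure P0 L0 (\<in>) Q" and L0: "L0 \<subseteq> L" and v: "flexes P L x v"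
    and zero: "\<And>q. q \<in> Q \<Longrightarrow> v q = 0" and p: "p \<in> P"
  shows "v p = 0"
  using p unfolding P
proof (induction rule: inc_closure.induct)
  case (base q)
  then show ?case using zero by blast
next
  case (step p l l' a b a' b')
  have inP: "p \<in> P" "a \<in> P" "b \<in> P" "a' \<in> P" "b' \<in> P"
    unfolding P using step.hyps by (auto intro: inc_closure.step[of p P0 l L0 l' "(\<in>)" a Q b a' b'])
  have L: "l \<in> L" "l' \<in> L" using step.hyps L0 by auto
  show ?case
  proof (cases "p \<in> {a, b, a', b'}")
    case True
    then show ?thesis using step.IH by auto
  next
    case False
    have par: "cross (x a - x p) (v p) = 0"
      if l: "l \<in> L" "p \<in> l" "a \<in> l" "b \<in> l" "a \<in> P" "b \<in> P" "a \<noteq> b" "v a = 0" "v b = 0" for l a b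
    proof -
      have "cross (x b - x a) (v p) = 0" using flex_x[OF v l(1), of a b p] l inP(1) by simp
      moreover have "cross (x b - x a) (x p - x a) = 0" by (rule collinear_x[OF l(1)]) (use l inP(1) in auto)
      moreover have "x b - x a \<noteq> 0" by (rule distinct_x) (use l in auto)
      ultimately have "cross (x p - x a) (v p) = 0" by (metis cross_trans)
      then show ?thesis by (simp add: cross_diff_left)
    qed
    have 1: "cross (x a - x p) (v p) = 0"
      by (rule par[of l a b]) (use step.hyps step.IH inP L in auto)
    have 2: "cross (x a' - x p) (v p) = 0"
      by (rule par[of l' a' b']) (use step.hyps step.IH inP L in auto)
    have 3: "cross (x a - x p) (x a' - x p) \<noteq> 0"
      by (rule crossing_x[OF L]) (use step.hyps inP False in auto)
    show ?thesis
    proof (rule ccontr)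
      assume "v p \<noteq> 0"
      then have "cross (x a - x p) (x a' - x p) = 0"
        using cross_trans[of "v p"] 1 2 cross_commute by (metis neg_0_equal_iff_equal)
      then show False using 3 by blast
    qed
  qed
qed

text \<open>The flex equation of a, b, c says that the cross products of each velocity with the
  opposite side add up to 0; this is one equation of a block design. Triples at a common point lie
  on different lines, which makes their coefficient vectors nonparallel. A combination of flexes
  vanishing on Q vanishes on the closure, so independence on P restricts to Q.\<close>

lemma primal_rank:
  assumes P: "P = inc_closure P0 L0 (\<in>) Q" and L0: "L0 \<subseteq> L" and Q: "Q \<subseteq> P0" "finite Q" and T: "triple_system L0 (\<in>) Q T"
    and \<kappa>: "2 \<le> \<kappa>" "\<And>q. q \<in> Q \<Longrightarrow> \<kappa> \<le> real (card {t\<in>T. q \<in> t})" and \<rho>: "real (card Q) \<le> \<rho> * \<kappa>"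
    and v: "\<And>j. j < k \<Longrightarrow> flexes P L x (v j)"
    and indep: "\<And>c. (\<And>s. s \<in> P \<Longrightarrow> lin_comb c k v s = 0) \<Longrightarrow> (\<forall>j<k. c j = 0)"
  shows "real k \<le> 100 * \<rho>\<^sup>2"
proof -
  have QP: "Q \<subseteq> P" using Q unfolding P by (auto intro: inc_closure.base)
  have ts: "\<forall>t\<in>T. t \<subseteq> Q \<and> card t = 3 \<and> (\<exists>l\<in>L0. \<forall>p\<in>t. p \<in> l)"
    and ts2: "\<forall>t\<in>T. \<forall>t'\<in>T. \<forall>l\<in>L0. (\<forall>p\<in>t \<union> t'. p \<in> l) \<longrightarrow> t \<noteq> t' \<longrightarrow> t \<inter> t' = {}"
    using T unfolding triple_system_def by simp_all
  have line0: "\<exists>l\<in>L0. t \<subseteq> l" if "t \<in> T" for t using ts that by (meson subsetI)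
  have t: "t \<subseteq> Q" "card t = 3" "\<exists>l\<in>L. t \<subseteq> l" if "t \<in> T" for t
    using ts that line0[OF that] L0 by (simp, simp, blast)
  have disj: "t = t'" if h: "t \<in> T" "t' \<in> T" "l \<in> L" "t \<union> t' \<subseteq> l" "p \<in> t" "p \<in> t'" for t t' l p
  proof (rule ccontr)
    assume ne: "t \<noteq> t'"
    obtain l0 where l0: "l0 \<in> L0" "t \<subseteq> l0" using line0[OF h(1)] by (elim bexE)
    obtain a b c where abc: "t = {a, b, c}" "a \<noteq> b" using card3_obtain[OF t(2)[OF h(1)]] by metis
    have "l = l0" by (rule line_unique[of l l0 a b]) (use lines h(3,4) l0 L0 abc in auto)
    then have "\<forall>p\<in>t \<union> t'. p \<in> l0" using h(4) by blast
    then have "t \<inter> t' = {}" using ts2[rule_format, OF h(1,2) l0(1)] ne by simp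
    then show False using h(5,6) by blast
  qed
  have "\<forall>t\<in>T. \<exists>z. t = {fst z, fst (snd z), snd (snd z)} \<and> fst z \<noteq> fst (snd z) \<and> fst z \<noteq> snd (snd z) \<and> fst (snd z) \<noteq> snd (snd z)"
  proof
    fix t assume "t \<in> T"
    then obtain a b c where "t = {a, b, c}" "a \<noteq> b" "a \<noteq> c" "b \<noteq> c" using card3_obtain[OF t(2)] by metis
    then show "\<exists>z. t = {fst z, fst (snd z), snd (snd z)} \<and> fst z \<noteq> fst (snd z) \<and> fst z \<noteq> snd (snd z) \<and> fst (snd z) \<noteq> snd (snd z)"
      by (intro exI[of _ "(a, b, c)"]) auto
  qed
  from bchoice[OF this] obtain z where z0: "\<forall>t\<in>T. t = {fst (z t), fst (snd (z t)), snd (snd (z t))} \<and> fst (z t) \<noteq> fst (snd (z t)) \<and>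
      fst (z t) \<noteq> snd (snd (z t)) \<and> fst (snd (z t)) \<noteq> snd (snd (z t))"
    by (elim exE)
  note z = bspec[OF z0]
  \<comment> \<open>The side of the triple opposite to p, in cyclic orientation; the last branch is
    meant for the third point.\<close>
  define w where "w t p = (if p = fst (z t) then x (fst (snd (z t))) - x (snd (snd (z t)))
      else if p = fst (snd (z t)) then x (snd (snd (z t))) - x (fst (z t))
      else x (fst (z t)) - x (fst (snd (z t))))" for t p
  have w: "\<exists>b c. b \<in> t \<and> c \<in> t \<and> b \<noteq> c \<and> b \<noteq> p \<and> c \<noteq> p \<and> w t p = x b - x c" if h: "t \<in> T" "p \<in> t" for t p
  proof -
    define a b c where "a = fst (z t)" and "b = fst (snd (z t))" and "c = snd (snd (z t))"
    have e: "t = {a, b, c}" "a \<noteq> b" "a \<noteq> c" "b \<noteq> c" using z[OF h(1)] unfolding a_def b_def c_def by blast+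
    have we: "w t p = (if p = a then x b - x c else if p = b then x c - x a else x a - x b)"
      unfolding w_def a_def b_def c_def ..
    consider "p = a" | "p = b" | "p = c" using h(2) e(1) by blast
    then show ?thesis
    proof cases
      case 1
      then show ?thesis using e(2-4) we by - (rule exI[of _ b], rule exI[of _ c], simp add: e(1))
    next
      case 2
      then show ?thesis using e(2-4) we by - (rule exI[of _ c], rule exI[of _ a], simp add: e(1))
    next
      case 3
      then show ?thesis using e(2-4) we by - (rule exI[of _ a], rule exI[of _ b], simp add: e(1))
    qed
  qed
  \<comment> \<open>\<open>w t p\<close> turned by a right angle, so that pairing with a velocity is
    \<open>cross\<close>.\<close>
  define \<alpha> where "\<alpha> t p e = (if e then snd (w t p) else - fst (w t p))" for t p and e :: bool
  define W where "W j p e = (if e then fst (v j p) else snd (v j p))" for j p and e :: bool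
  have "real k \<le> 100 * (real (card Q))\<^sup>2 / \<kappa>\<^sup>2"
  proof (rule rank_bound[where T = T and \<alpha> = \<alpha> and w = W])
    show "finite Q" "2 \<le> \<kappa>" by fact+
    show "t \<subseteq> Q \<and> card t = 3" if "t \<in> T" for t using t that by blast
    show "\<kappa> \<le> real (card {t \<in> T. p \<in> t})" if "p \<in> Q" for p by (rule \<kappa>(2)[OF that])
    show "ta = t'" if a: "ta \<in> T" "t' \<in> T" "{p, q} \<subseteq> ta" "{p, q} \<subseteq> t'" "p \<noteq> q" for ta t' p q
    proof -
      obtain l l' where l: "l \<in> L" "ta \<subseteq> l" "l' \<in> L" "t' \<subseteq> l'" using t(3) a(1,2) by blast
      have "l = l'" by (rule line_unique[of l l' p q]) (use lines l a in auto)
      then show ?thesis using disj[OF a(1,2) l(1), of p] l a(3,4) by blast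
    qed
    show "cross2 (\<alpha> ta p) (\<alpha> t' p) \<noteq> 0" if a: "ta \<in> T" "t' \<in> T" "ta \<noteq> t'" "p \<in> ta" "p \<in> t'" for ta t' p
    proof -
      obtain l l' where l: "l \<in> L" "ta \<subseteq> l" "l' \<in> L" "t' \<subseteq> l'" using t(3) a(1,2) by blast
      have ll: "l \<noteq> l'" using disj[OF a(1,2) l(1), of p] l a by blast
      obtain b c where bc: "b \<in> ta" "c \<in> ta" "b \<noteq> c" "b \<noteq> p" "c \<noteq> p" "w ta p = x b - x c" using w[OF a(1,4)] by blast
      obtain b' c' where bc': "b' \<in> t'" "c' \<in> t'" "b' \<noteq> c'" "b' \<noteq> p" "c' \<noteq> p" "w t' p = x b' - x c'" using w[OF a(2,5)] by blast
      have tP: "ta \<subseteq> P" "t' \<subseteq> P" using t(1) a QP by blast+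
      have par: "cross (x b - x c) (x b - x p) = 0" if "l \<in> L" "{b, c, p} \<subseteq> P \<inter> l" for l b c
        using collinear_x[OF that(1), of p b c] that(2) by (simp add: cross_def algebra_simps)
      have 1: "cross (x b - x c) (x b - x p) = 0" by (rule par[OF l(1)]) (use bc a l tP in auto)
      have 2: "cross (x b' - x c') (x b' - x p) = 0" by (rule par[OF l(3)]) (use bc' a l tP in auto)
      have n1: "x b - x c \<noteq> 0" by (rule distinct_x) (use bc tP in auto)
      have n2: "x b' - x c' \<noteq> 0" by (rule distinct_x) (use bc' tP in auto)
      have n3: "cross (x b - x p) (x b' - x p) \<noteq> 0"
        by (rule crossing_x[OF l(1,3) ll]) (use bc bc' a l tP in auto)
      have "cross (x b - x c) (x b' - x c') \<noteq> 0"
      proof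
        assume 0: "cross (x b - x c) (x b' - x c') = 0"
        have "cross (x b - x p) (x b' - x c') = 0" by (rule cross_trans[OF n1 1 0])
        then have "cross (x b' - x c') (x b - x p) = 0" by (subst cross_commute) simp
        then have "cross (x b - x p) (x b' - x p) = 0" using cross_trans[OF n2 _ 2] by blast
        then show False using n3 by blast
      qed
      moreover have "cross2 (\<alpha> ta p) (\<alpha> t' p) = cross (w ta p) (w t' p)"
        unfolding cross2_def \<alpha>_def cross_def by simp
      ultimately show ?thesis unfolding bc(6) bc'(6) by simp
    qed
    show "(\<Sum>p\<in>ta. \<alpha> ta p True * W j p True + \<alpha> ta p False * W j p False) = 0" if a: "j < k" "ta \<in> T" for j ta
    proof -
      define a b c where abc: "a = fst (z ta)" "b = fst (snd (z ta))" "c = snd (snd (z ta))"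
      have e: "ta = {a, b, c}" "a \<noteq> b" "a \<noteq> c" "b \<noteq> c" using z[OF a(2)] unfolding abc by blast+
      have wabc: "w ta a = x b - x c" "w ta b = x c - x a" "w ta c = x a - x b"
        using e(2-4) unfolding w_def abc[symmetric] by auto
      obtain l where l: "l \<in> L" "ta \<subseteq> l" using t(3) a(2) by blast
      have "ta \<subseteq> P \<inter> l" using t(1)[OF a(2)] QP l by blast
      then have "{a, b, c} \<subseteq> P \<inter> l" using e(1) by simp
      then have "cross (v j b - v j a) (x c - x a) + cross (x b - x a) (v j c - v j a) = 0"
        by (rule flex_x[OF v[OF a(1)] l(1)])
      then have "cross (v j a) (x b - x c) + cross (v j b) (x c - x a) + cross (v j c) (x a - x b) = 0"
        by (simp add: cross_def algebra_simps)
      moreover have "\<alpha> ta p True * W j p True + \<alpha> ta p False * W j p False = cross (v j p) (w ta p)" for p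
        unfolding \<alpha>_def W_def cross_def by simp
      ultimately show ?thesis unfolding e(1) using e(2-4) wabc e(1) by (simp add: add.assoc)
    qed
    show "\<forall>j<k. c j = 0" if a: "\<forall>p\<in>Q. \<forall>e. (\<Sum>j<k. c j * W j p e) = 0" for c
    proof (rule indep)
      fix s assume s: "s \<in> P"
      have zQ: "lin_comb c k v q = 0" if "q \<in> Q" for q
      proof -
        have "(\<Sum>j<k. c j * W j q True) = 0" "(\<Sum>j<k. c j * W j q False) = 0" using a that by blast+
        then show ?thesis unfolding lin_comb_def W_def by (simp add: prod_eq_iff)
      qed
      have V: "flexes P L x (lin_comb c k v)" by (rule flexes_lin_comb) (rule v)
      show "lin_comb c k v s = 0" by (rule inc_closure_flex_zero[OF P L0 V zQ s])
    qed
  qed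
  also have "\<dots> \<le> 100 * (\<rho> * \<kappa>)\<^sup>2 / \<kappa>\<^sup>2"
    using \<rho> by (intro divide_right_mono mult_left_mono power_mono) auto
  also have "\<dots> = 100 * \<rho>\<^sup>2" using \<kappa>(1) by (simp add: power_mult_distrib)
  finally show ?thesis .
qed

text \<open>
  The motion of a line l is recorded by the normal displacements of two of its points s and t; the normal
  displacement of every other point of l is interpolated from these with parameter \<tau>.  Three concurrent
  lines give one linear equation between their motions.
\<close>
lemma dual_rank:
  assumes L0: "L0 \<subseteq> L" and P0: "P0 \<subseteq> PP" and \<Lambda>: "\<Lambda> = inc_closure L0 P0 (\<lambda>l p. p \<in> l) Q"
    and P: "P = {p\<in>PP. \<exists>l\<in>\<Lambda>. \<exists>l'\<in>\<Lambda>. l \<noteq> l' \<and> p \<in> l \<and> p \<in> l'}"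
    and Q: "Q \<subseteq> L0" "finite Q" and T: "finite T" "triple_system P0 (\<lambda>l p. p \<in> l) Q T"
    and \<kappa>: "2 \<le> \<kappa>" "\<And>q. q \<in> Q \<Longrightarrow> \<kappa> \<le> real (card {t\<in>T. q \<in> t})" and \<rho>: "real (card Q) \<le> \<rho> * \<kappa>"
    and v: "\<And>j. j < k \<Longrightarrow> flexes P L x (v j)"
    and indep: "\<And>c. (\<And>s. s \<in> P \<Longrightarrow> lin_comb c k v s = 0) \<Longrightarrow> (\<forall>j<k. c j = 0)"
  shows "real k \<le> 100 * \<rho>\<^sup>2"
proof -
  have Q\<Lambda>: "Q \<subseteq> \<Lambda>"
  proof
    fix l assume "l \<in> Q"
    then show "l \<in> \<Lambda>" unfolding \<Lambda> using Q(1) by (intro inc_closure.base) auto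
  qed
  have \<Lambda>L: "\<Lambda> \<subseteq> L" unfolding \<Lambda> using inc_closure_subset[of L0 P0 "\<lambda>l p. p \<in> l" Q] L0 by (rule subset_trans)
  have inP: "p \<in> P" if "p \<in> PP" "l \<in> \<Lambda>" "l' \<in> \<Lambda>" "l \<noteq> l'" "p \<in> l" "p \<in> l'" for p l l'
    unfolding P using that by blast
  have line: "is_line l" if "l \<in> \<Lambda>" for l using lines \<Lambda>L that by blast
  have ts: "\<forall>t\<in>T. t \<subseteq> Q \<and> card t = 3 \<and> (\<exists>p\<in>P0. \<forall>l\<in>t. p \<in> l)"
    and ts2: "\<forall>t\<in>T. \<forall>t'\<in>T. \<forall>p\<in>P0. (\<forall>l\<in>t \<union> t'. p \<in> l) \<longrightarrow> t \<noteq> t' \<longrightarrow> t \<inter> t' = {}"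
    using T(2) unfolding triple_system_def by simp_all
  have "\<forall>t\<in>T. \<exists>p. p \<in> P0 \<and> (\<forall>l\<in>t. p \<in> l)" using ts by blast
  from bchoice[OF this] obtain pp where pp0: "\<forall>t\<in>T. pp t \<in> P0 \<and> (\<forall>l\<in>t. pp t \<in> l)" by (elim exE)
  have tQ: "t \<subseteq> Q" "card t = 3" if "t \<in> T" for t using ts that by simp_all
  have ppl: "pp t \<in> P0" "l \<in> t \<Longrightarrow> pp t \<in> l" if "t \<in> T" for t l using pp0 that by simp_all
  have ppP: "pp t \<in> P" if h: "t \<in> T" for t
  proof -
    obtain a b c where abc: "t = {a, b, c}" "a \<noteq> b" using card3_obtain[OF tQ(2)[OF h]] by metis
    have "a \<in> \<Lambda>" "b \<in> \<Lambda>" using abc tQ(1)[OF h] Q\<Lambda> by auto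
    moreover have "pp t \<in> a" "pp t \<in> b" using ppl(2)[OF h] abc by auto
    ultimately show ?thesis using inP[of "pp t" a b] ppl(1)[OF h] P0 abc(2) by blast
  qed
  have ppne: "pp t \<noteq> pp t'" if h: "t \<in> T" "t' \<in> T" "t \<noteq> t'" "l \<in> t" "l \<in> t'" for t t' l
  proof
    assume eq: "pp t = pp t'"
    have "\<forall>l\<in>t \<union> t'. pp t \<in> l" using ppl(2)[OF h(1)] ppl(2)[OF h(2)] eq by auto
    then have "t \<inter> t' = {}" using ts2[rule_format, OF h(1,2) ppl(1)[OF h(1)]] h(3) by simp
    then show False using h(4,5) by blast
  qed
  \<comment> \<open>A line of Q belongs to at least two triples, whose points of concurrency differ;
    a line added by the closure was added through two points, each lying on two lines of
    \<Lambda>.\<close>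
  have two: "\<exists>z. fst z \<in> P \<and> snd z \<in> P \<and> fst z \<in> l \<and> snd z \<in> l \<and> fst z \<noteq> snd z" if h: "l \<in> \<Lambda>" for l
    using h unfolding \<Lambda>
  proof cases
    case base
    have "2 \<le> card {t\<in>T. l \<in> t}" using \<kappa>(2)[OF base(1)] \<kappa>(1) by linarith
    then have "\<not> card {t\<in>T. l \<in> t} \<le> 1" by simp
    then obtain t t' where t: "t \<in> T" "l \<in> t" "t' \<in> T" "l \<in> t'" "t \<noteq> t'"
      using card_le_1I[of "{t\<in>T. l \<in> t}"] by blast
    then show ?thesis using ppP ppl(2) ppne[of t t' l] by (intro exI[of _ "(pp t, pp t')"]) auto
  next
    case (step p p' a b a' b')
    have "p \<in> P" using step P0 by (intro inP[of p a b]) (auto simp: \<Lambda>)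
    moreover have "p' \<in> P" using step P0 by (intro inP[of p' a' b']) (auto simp: \<Lambda>)
    ultimately show ?thesis using step by (intro exI[of _ "(p, p')"]) auto
  qed
  then have "\<forall>l\<in>\<Lambda>. \<exists>z. fst z \<in> P \<and> snd z \<in> P \<and> fst z \<in> l \<and> snd z \<in> l \<and> fst z \<noteq> snd z" by (intro ballI)
  from bchoice[OF this] obtain z where z0: "\<forall>l\<in>\<Lambda>. fst (z l) \<in> P \<and> snd (z l) \<in> P \<and> fst (z l) \<in> l \<and> snd (z l) \<in> l \<and> fst (z l) \<noteq> snd (z l)"
    by (elim exE)
  define s t where "s l = fst (z l)" and "t l = snd (z l)" for l
  have st: "s l \<in> P" "t l \<in> P" "s l \<in> l" "t l \<in> l" "s l \<noteq> t l" if "l \<in> \<Lambda>" for l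
    using bspec[OF z0 that] unfolding s_def t_def by simp_all
  define u where "u l = x (t l) - x (s l)" for l
  have u0: "u l \<noteq> 0" if "l \<in> \<Lambda>" for l unfolding u_def using st[OF that] by (intro distinct_x) auto
  have par: "cross (u l) (x p - x (s l)) = 0" if "l \<in> \<Lambda>" "p \<in> P" "p \<in> l" for l p
    unfolding u_def by (rule collinear_x[of l]) (use that st[OF that(1)] \<Lambda>L in auto)
  have par2: "cross (u l) (x p - x q) = 0" if "l \<in> \<Lambda>" "p \<in> P" "p \<in> l" "q \<in> P" "q \<in> l" for l p q
    using par[OF that(1-3)] par[OF that(1,4,5)] by (simp add: cross_diff_right)
  have nonpar: "cross (u l) (u l') \<noteq> 0" if h: "l \<in> \<Lambda>" "l' \<in> \<Lambda>" "l \<noteq> l'" "p \<in> P" "p \<in> l" "p \<in> l'" for l l' p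
  proof
    assume 0: "cross (u l) (u l') = 0"
    have "\<exists>a\<in>P. a \<in> k \<and> a \<noteq> p" if "k \<in> \<Lambda>" for k using st[OF that] by metis
    then obtain a a' where a: "a \<in> P" "a \<in> l" "a \<noteq> p" "a' \<in> P" "a' \<in> l'" "a' \<noteq> p" using h(1,2) by blast
    have "cross (x a - x p) (u l') = 0"
      by (rule cross_trans[OF u0[OF h(1)] par2[OF h(1) a(1,2) h(4,5)] 0])
    then have "cross (u l') (x a - x p) = 0" by (subst cross_commute) simp
    then have "cross (x a - x p) (x a' - x p) = 0"
      using cross_trans[OF u0[OF h(2)] _ par2[OF h(2) a(4,5) h(4,6)]] by blast
    moreover have "cross (x a - x p) (x a' - x p) \<noteq> 0"
      by (rule crossing_x[of l l' p a a']) (use a h \<Lambda>L in auto)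
    ultimately show False by blast
  qed
  have ex\<tau>: "\<exists>\<tau>. x p - x (s l) = (\<tau> * fst (u l), \<tau> * snd (u l))" if "l \<in> \<Lambda>" "p \<in> P" "p \<in> l" for l p
    by (rule cross_parallel[OF u0[OF that(1)] par[OF that]])
  define \<tau> where "\<tau> l p = (SOME \<tau>. x p - x (s l) = (\<tau> * fst (u l), \<tau> * snd (u l)))" for l p
  have \<tau>: "x p - x (s l) = (\<tau> l p * fst (u l), \<tau> l p * snd (u l))" if "l \<in> \<Lambda>" "p \<in> P" "p \<in> l" for l p
    unfolding \<tau>_def by (rule someI_ex[OF ex\<tau>[OF that]])
  have \<tau>inj: "\<tau> l p \<noteq> \<tau> l q" if h: "l \<in> \<Lambda>" "p \<in> P" "p \<in> l" "q \<in> P" "q \<in> l" "p \<noteq> q" for l p q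
  proof
    assume eq: "\<tau> l p = \<tau> l q"
    have "x p - x (s l) = x q - x (s l)" unfolding \<tau>[OF h(1-3)] \<tau>[OF h(1,4,5)] eq ..
    then show False using distinct_x[OF h(2,4,6)] by simp
  qed
  have interp: "cross (u l) (V p) = (1 - \<tau> l p) * cross (u l) (V (s l)) + \<tau> l p * cross (u l) (V (t l))"
    if V: "flexes P L x V" and h: "l \<in> \<Lambda>" "p \<in> P" "p \<in> l" for V l p
  proof -
    have "cross (V (t l) - V (s l)) (x p - x (s l)) + cross (u l) (V p - V (s l)) = 0"
      unfolding u_def by (rule flex_x[OF V, of l]) (use h st[OF h(1)] \<Lambda>L in auto)
    then show ?thesis unfolding \<tau>[OF h] by (simp add: cross_def algebra_simps)
  qed
  \<comment> \<open>The directions of two lines through p span the plane, so a velocity with zero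
    normal component for both is 0.\<close>
  have zero_at: "V p = 0"
    if h: "l \<in> \<Lambda>" "l' \<in> \<Lambda>" "l \<noteq> l'" "p \<in> P" "p \<in> l" "p \<in> l'"
      and "cross (u l) (V p) = 0" "cross (u l') (V p) = 0" for V l l' p
  proof (rule ccontr)
    assume "V p \<noteq> 0"
    moreover have "cross (V p) (u l) = 0" "cross (V p) (u l') = 0" using that(7,8) by (simp_all add: cross_commute[of "V p"])
    ultimately have "cross (u l) (u l') = 0" by (rule cross_trans)
    then show False using nonpar[OF h] by blast
  qed
  \<comment> \<open>The dual propagation: two fixed lines through a point fix it, and the normal
    displacement along a line is affine in \<tau>, so it vanishes on the whole line once it vanishes
    at two of its points.\<close>
  have closure: "cross (u l) (V (s l)) = 0 \<and> cross (u l) (V (t l)) = 0"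
    if V: "flexes P L x V" and z: "\<And>l. l \<in> Q \<Longrightarrow> cross (u l) (V (s l)) = 0 \<and> cross (u l) (V (t l)) = 0" and l: "l \<in> \<Lambda>" for V l
    using l unfolding \<Lambda>
  proof (induction rule: inc_closure.induct)
    case (base q)
    then show ?case using z by blast
  next
    case (step l p p' a b a' b')
    have ab: "a \<in> \<Lambda>" "b \<in> \<Lambda>" "a' \<in> \<Lambda>" "b' \<in> \<Lambda>" using step.hyps unfolding \<Lambda> by simp_all
    have l\<Lambda>: "l \<in> \<Lambda>" unfolding \<Lambda>
      by (rule inc_closure.step[of l L0 p P0 p' "\<lambda>l p. p \<in> l" a Q b a' b']) (use step.hyps in auto)
    have pP: "p \<in> P" "p' \<in> P" using step.hyps ab P0 by (auto intro: inP[of p a b] inP[of p' a' b'])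
    have cz: "cross (u k) (V q) = 0" if "k \<in> \<Lambda>" "q \<in> P" "q \<in> k" "cross (u k) (V (s k)) = 0 \<and> cross (u k) (V (t k)) = 0" for k q
      using interp[OF V that(1-3)] that(4) by simp
    have Vp: "V p = 0"
      by (rule zero_at[OF ab(1,2) _ pP(1)]) (use step.hyps step.IH ab pP cz in auto)
    have Vp': "V p' = 0"
      by (rule zero_at[OF ab(3,4) _ pP(2)]) (use step.hyps step.IH ab pP cz in auto)
    define A B where "A = cross (u l) (V (s l))" and "B = cross (u l) (V (t l))"
    have 1: "(1 - \<tau> l p) * A + \<tau> l p * B = 0"
      using interp[OF V l\<Lambda> pP(1)] step.hyps Vp unfolding A_def B_def by simp
    have 2: "(1 - \<tau> l p') * A + \<tau> l p' * B = 0"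
      using interp[OF V l\<Lambda> pP(2)] step.hyps Vp' unfolding A_def B_def by simp
    have "(\<tau> l p' - \<tau> l p) * (B - A) = ((1 - \<tau> l p') * A + \<tau> l p' * B) - ((1 - \<tau> l p) * A + \<tau> l p * B)"
      by (simp add: algebra_simps)
    then have "(\<tau> l p' - \<tau> l p) * (B - A) = 0" unfolding 1 2 by simp
    moreover have "\<tau> l p \<noteq> \<tau> l p'" by (rule \<tau>inj[OF l\<Lambda>]) (use step.hyps pP in auto)
    ultimately have "B = A" by simp
    then show ?case using 1 unfolding A_def[symmetric] B_def[symmetric] by (simp add: algebra_simps)
  qed
  have "\<forall>ta\<in>T. \<exists>z. ta = {fst z, fst (snd z), snd (snd z)} \<and> fst z \<noteq> fst (snd z) \<and> fst z \<noteq> snd (snd z) \<and> fst (snd z) \<noteq> snd (snd z)"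
  proof
    fix ta assume "ta \<in> T"
    then obtain a b c where "ta = {a, b, c}" "a \<noteq> b" "a \<noteq> c" "b \<noteq> c" using card3_obtain[OF tQ(2)] by metis
    then show "\<exists>z. ta = {fst z, fst (snd z), snd (snd z)} \<and> fst z \<noteq> fst (snd z) \<and> fst z \<noteq> snd (snd z) \<and> fst (snd z) \<noteq> snd (snd z)"
      by (intro exI[of _ "(a, b, c)"]) auto
  qed
  from bchoice[OF this] obtain e where e0: "\<forall>ta\<in>T. ta = {fst (e ta), fst (snd (e ta)), snd (snd (e ta))} \<and> fst (e ta) \<noteq> fst (snd (e ta)) \<and>
      fst (e ta) \<noteq> snd (snd (e ta)) \<and> fst (snd (e ta)) \<noteq> snd (snd (e ta))"
    by (elim exE)
  \<comment> \<open>Coefficients of the linear relation between three vectors of the plane, cross (u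
    b) (u c) * u a + cross (u c) (u a) * u b + cross (u a) (u b) * u c = 0. Paired with the velocity
    of the common point it relates the normal displacements of the three lines.\<close>
  define co where "co ta l = (if l = fst (e ta) then cross (u (fst (snd (e ta)))) (u (snd (snd (e ta))))
      else if l = fst (snd (e ta)) then cross (u (snd (snd (e ta)))) (u (fst (e ta)))
      else cross (u (fst (e ta))) (u (fst (snd (e ta)))))" for ta l
  have co0: "co ta l \<noteq> 0" if h: "ta \<in> T" for ta l
  proof -
    define a b c where abc: "a = fst (e ta)" "b = fst (snd (e ta))" "c = snd (snd (e ta))"
    have ea: "ta = {a, b, c}" "a \<noteq> b" "a \<noteq> c" "b \<noteq> c" using bspec[OF e0 h] unfolding abc by blast+
    have m: "a \<in> \<Lambda>" "b \<in> \<Lambda>" "c \<in> \<Lambda>" using tQ(1)[OF h] Q\<Lambda> ea(1) by auto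
    have q: "pp ta \<in> a" "pp ta \<in> b" "pp ta \<in> c" using ppl(2)[OF h] ea(1) by auto
    note p = ppP[OF h]
    have "cross (u b) (u c) \<noteq> 0" "cross (u c) (u a) \<noteq> 0" "cross (u a) (u b) \<noteq> 0"
      using nonpar[OF m(2,3) ea(4) p q(2,3)] nonpar[OF m(3,1) ea(3)[symmetric] p q(3,1)] nonpar[OF m(1,2) ea(2) p q(1,2)] by blast+
    then show ?thesis unfolding co_def abc[symmetric] by simp
  qed
  \<comment> \<open>The weights interpolate the normal displacement at the point of concurrency.
    Different triples on a line have different points there, hence different \<tau> and nonparallel
    coefficient vectors.\<close>
  define \<alpha> where "\<alpha> ta l b = co ta l * (if b then 1 - \<tau> l (pp ta) else \<tau> l (pp ta))" for ta l and b :: bool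
  define W where "W j l b = (if b then cross (u l) (v j (s l)) else cross (u l) (v j (t l)))" for j l and b :: bool
  have "real k \<le> 100 * (real (card Q))\<^sup>2 / \<kappa>\<^sup>2"
  proof (rule rank_bound[where T = T and \<alpha> = \<alpha> and w = W])
    show "finite Q" "2 \<le> \<kappa>" by fact+
    show "ta \<subseteq> Q \<and> card ta = 3" if "ta \<in> T" for ta using tQ that by blast
    show "\<kappa> \<le> real (card {ta \<in> T. l \<in> ta})" if "l \<in> Q" for l by (rule \<kappa>(2)[OF that])
    show "ta = t'" if a: "ta \<in> T" "t' \<in> T" "{l, l'} \<subseteq> ta" "{l, l'} \<subseteq> t'" "l \<noteq> l'" for ta t' l l'
    proof (rule ccontr)
      assume ne: "ta \<noteq> t'"
      have m: "l \<in> \<Lambda>" "l' \<in> \<Lambda>" using a(3) tQ(1)[OF a(1)] Q\<Lambda> by auto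
      have "pp ta \<noteq> pp t'" by (rule ppne[OF a(1,2) ne, of l]) (use a in auto)
      then have "l = l'"
        by (intro line_unique[OF line[OF m(1)] line[OF m(2)], of "pp ta" "pp t'"]) (use ppl(2)[OF a(1)] ppl(2)[OF a(2)] a in auto)
      then show False using a(5) by blast
    qed
    show "cross2 (\<alpha> ta l) (\<alpha> t' l) \<noteq> 0" if a: "ta \<in> T" "t' \<in> T" "ta \<noteq> t'" "l \<in> ta" "l \<in> t'" for ta t' l
    proof -
      have m: "l \<in> \<Lambda>" using a(4) tQ(1)[OF a(1)] Q\<Lambda> by auto
      have "\<tau> l (pp ta) \<noteq> \<tau> l (pp t')"
        by (rule \<tau>inj[OF m ppP[OF a(1)] ppl(2)[OF a(1,4)] ppP[OF a(2)] ppl(2)[OF a(2,5)] ppne[OF a]])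
      moreover have "cross2 (\<alpha> ta l) (\<alpha> t' l) = co ta l * co t' l * (\<tau> l (pp t') - \<tau> l (pp ta))"
        unfolding cross2_def \<alpha>_def by (simp add: algebra_simps)
      ultimately show ?thesis using co0[OF a(1)] co0[OF a(2)] by simp
    qed
    show "(\<Sum>l\<in>ta. \<alpha> ta l True * W j l True + \<alpha> ta l False * W j l False) = 0" if a: "j < k" "ta \<in> T" for j ta
    proof -
      define a1 b c where abc: "a1 = fst (e ta)" "b = fst (snd (e ta))" "c = snd (snd (e ta))"
      have ea: "ta = {a1, b, c}" "a1 \<noteq> b" "a1 \<noteq> c" "b \<noteq> c" using bspec[OF e0 a(2)] unfolding abc by blast+
      have cs: "co ta a1 = cross (u b) (u c)" "co ta b = cross (u c) (u a1)" "co ta c = cross (u a1) (u b)"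
        using ea(2-4) unfolding co_def abc[symmetric] by auto
      have "\<alpha> ta l True * W j l True + \<alpha> ta l False * W j l False = co ta l * cross (u l) (v j (pp ta))" if l: "l \<in> ta" for l
      proof -
        have m: "l \<in> \<Lambda>" using l tQ(1)[OF a(2)] Q\<Lambda> by auto
        show ?thesis unfolding interp[OF v[OF a(1)] m ppP[OF a(2)] ppl(2)[OF a(2) l]] \<alpha>_def W_def
          by (simp add: algebra_simps)
      qed
      then have "(\<Sum>l\<in>ta. \<alpha> ta l True * W j l True + \<alpha> ta l False * W j l False) = (\<Sum>l\<in>ta. co ta l * cross (u l) (v j (pp ta)))"
        by (rule sum.cong[OF refl])
      also have "\<dots> = co ta a1 * cross (u a1) (v j (pp ta)) + (co ta b * cross (u b) (v j (pp ta)) + co ta c * cross (u c) (v j (pp ta)))"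
        unfolding ea(1) using ea(2-4) by simp
      also have "\<dots> = 0" unfolding cs by (simp add: cross_def algebra_simps)
      finally show ?thesis .
    qed
    show "\<forall>j<k. c j = 0" if a: "\<forall>l\<in>Q. \<forall>b. (\<Sum>j<k. c j * W j l b) = 0" for c
    proof (rule indep)
      fix q assume q: "q \<in> P"
      have V: "flexes P L x (lin_comb c k v)" by (rule flexes_lin_comb) (rule v)
      have zQ: "cross (u l) (lin_comb c k v (s l)) = 0 \<and> cross (u l) (lin_comb c k v (t l)) = 0" if "l \<in> Q" for l
      proof -
        have "(\<Sum>j<k. c j * W j l True) = 0" "(\<Sum>j<k. c j * W j l False) = 0" using a that by blast+
        then show ?thesis unfolding cross_lin_comb W_def by simp
      qed
      obtain l l' where l: "l \<in> \<Lambda>" "l' \<in> \<Lambda>" "l \<noteq> l'" "q \<in> l" "q \<in> l'" using q unfolding P by blast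
      have "cross (u h) (lin_comb c k v q) = 0" if h: "h \<in> \<Lambda>" "q \<in> h" for h
        using interp[OF V h(1) q h(2)] closure[OF V zQ h(1)] by simp
      then show "lin_comb c k v q = 0" using zero_at[OF l(1-3) q l(4,5)] l by blast
    qed
  qed
  also have "\<dots> \<le> 100 * (\<rho> * \<kappa>)\<^sup>2 / \<kappa>\<^sup>2"
    using \<rho> by (intro divide_right_mono mult_left_mono power_mono) auto
  also have "\<dots> = 100 * \<rho>\<^sup>2" using \<kappa>(1) by (simp add: power_mult_distrib)
  finally show ?thesis .
qed

end

section \<open>Rigid subconfigurations\<close>

text \<open>A shear x + e y, with finitely many values of e excluded, makes every line of L the
  graph of an affine function. The equivalence \<open>inc\<close> holds for all points of the plane,
  so g determines the line as a set and is injective.\<close>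

lemma plane_inc_lines:
  assumes fin: "finite L" and lines: "\<And>l. l \<in> L \<Longrightarrow> is_line l"
  shows "plane_inc P L (\<in>)"
proof -
  have "\<forall>l\<in>L. \<exists>z. (fst z, fst (snd z)) \<noteq> (0, 0) \<and> l = {(x, y). fst z * x + fst (snd z) * y = snd (snd z)}"
  proof
    fix l assume "l \<in> L"
    then obtain a b c where "(a, b) \<noteq> (0, 0)" "l = {(x, y). a * x + b * y = c}"
      using lines unfolding is_line_def by blast
    then show "\<exists>z. (fst z, fst (snd z)) \<noteq> (0, 0) \<and> l = {(x, y). fst z * x + fst (snd z) * y = snd (snd z)}"
      by (intro exI[of _ "(a, b, c)"]) simp
  qed
  from bchoice[OF this] obtain z where
    z0: "\<forall>l\<in>L. (fst (z l), fst (snd (z l))) \<noteq> (0, 0) \<and> l = {(x, y). fst (z l) * x + fst (snd (z l)) * y = snd (snd (z l))}"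
    by (elim exE)
  define a b c where "a l = fst (z l)" and "b l = fst (snd (z l))" and "c l = snd (snd (z l))" for l
  have ab: "(a l, b l) \<noteq> (0, 0)" and mem: "p \<in> l \<longleftrightarrow> a l * fst p + b l * snd p = c l" if "l \<in> L" for l p
  proof -
    have *: "(a l, b l) \<noteq> (0, 0) \<and> l = {(x, y). a l * x + b l * y = c l}"
      using bspec[OF z0 that] unfolding a_def b_def c_def .
    then show "(a l, b l) \<noteq> (0, 0)" by blast
    have "p \<in> l \<longleftrightarrow> p \<in> {(x, y). a l * x + b l * y = c l}" using * by metis
    then show "p \<in> l \<longleftrightarrow> a l * fst p + b l * snd p = c l" by (simp add: case_prod_beta)
  qed
  define bad where "bad = (\<Union>l\<in>L. {e. b l - a l * e = 0})"
  have "finite {e. b l - a l * e = 0}" if "l \<in> L" for l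
  proof (cases "a l = 0")
    case True
    then show ?thesis using ab[OF that] by simp
  next
    case False
    then have "{e. b l - a l * e = 0} \<subseteq> {b l / a l}" by (auto simp: field_simps)
    then show ?thesis using finite_subset by blast
  qed
  then have "finite bad" unfolding bad_def using fin by blast
  then obtain e where "e \<notin> bad" using infinite_UNIV_char_0[where 'a = real] ex_new_if_finite by blast
  then have e: "b l - a l * e \<noteq> 0" if "l \<in> L" for l using that unfolding bad_def by blast
  define f where "f p = (fst p + e * snd p, snd p)" for p :: "real \<times> real"
  define g where "g l = (- a l / (b l - a l * e), c l / (b l - a l * e))" for l
  have inc: "p \<in> l \<longleftrightarrow> on_line (f p) (g l)" if l: "l \<in> L" for p l
  proof -
    have "on_line (f p) (g l) \<longleftrightarrow> snd p = (- a l * (fst p + e * snd p) + c l) / (b l - a l * e)"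
      unfolding on_line_def line_at_def f_def g_def fst_conv snd_conv
      by (simp only: add_divide_distrib times_divide_eq_left)
    also have "\<dots> \<longleftrightarrow> snd p * (b l - a l * e) = - a l * (fst p + e * snd p) + c l"
      using e[OF l] by (simp add: eq_divide_eq)
    also have "\<dots> \<longleftrightarrow> a l * fst p + b l * snd p = c l" by (auto simp: algebra_simps)
    finally show ?thesis using mem[OF l] by simp
  qed
  show ?thesis
  proof (rule plane_incI[where f = f and g = g])
    show "inj_on f P" unfolding f_def inj_on_def by (auto simp: prod_eq_iff)
    show "inj_on g L"
    proof (rule inj_onI)
      fix l l' assume l: "l \<in> L" "l' \<in> L" "g l = g l'"
      have "p \<in> l \<longleftrightarrow> p \<in> l'" for p using inc[OF l(1)] inc[OF l(2)] l(3) by simp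
      then show "l = l'" by blast
    qed
    show "p \<in> l \<longleftrightarrow> on_line (f p) (g l)" if "l \<in> L" for p l by (rule inc[OF that])
  qed
qed

lemma cube_powr_two_thirds: "x > 0 \<Longrightarrow> (x powr (2 / 3)) ^ 3 = x\<^sup>2" for x :: real
  by (simp add: powr_power)

text \<open>The passage from a positive proportion of lines to a positive proportion of points. The
  lines of \<Lambda> carry at least c I / 4 incidences, and points on only one of them account for
  at most n \<le> c I / 8. The rest falls on the points counted here, and Szemeredi-Trotter shows
  that few points cannot carry so many incidences.\<close>

lemma rich_dual_points:
  fixes c \<Delta> n m :: real
  assumes pi: "plane_inc P \<Lambda> inc" and fin: "finite P" "finite \<Lambda>"
    and n: "real (card P) = n" "n > 0" and m: "real (card \<Lambda>) \<le> m" "c * m \<le> real (card \<Lambda>)" "m > 0"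
    and c: "c > 0" and \<Delta>: "\<Delta> > 0" and I: "\<Delta> ^ 3 * n\<^sup>2 * m\<^sup>2 \<le> I ^ 3" "I \<ge> 0"
    and deg: "\<And>l. l \<in> \<Lambda> \<Longrightarrow> I \<le> 4 * m * real (card {p\<in>P. inc p l})"
    and big: "8 * n \<le> c * I" "16 * 353 * m \<le> c * I"
  shows "min (1 / (2 * 353)) (sqrt (c ^ 3 * \<Delta> ^ 3 / (512 * 353 ^ 3))) * n \<le>
    real (card {p\<in>P. \<exists>l\<in>\<Lambda>. \<exists>l'\<in>\<Lambda>. l \<noteq> l' \<and> inc p l \<and> inc p l'})"
proof -
  define P' where "P' = {p\<in>P. \<exists>l\<in>\<Lambda>. \<exists>l'\<in>\<Lambda>. l \<noteq> l' \<and> inc p l \<and> inc p l'}"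
  have P': "P' \<subseteq> P" "finite P'" unfolding P'_def using fin by auto
  define a Y where "a = real (card P')" and "Y = real (num_inc P' \<Lambda> inc)"
  have a0: "a \<ge> 0" unfolding a_def by simp
  have rich: "P' = rich P (\<lambda>l p. inc p l) \<Lambda>" unfolding P'_def rich_def by auto
  have "num_inc \<Lambda> P (\<lambda>l p. inc p l) \<le> num_inc \<Lambda> P' (\<lambda>l p. inc p l) + card P"
    unfolding rich by (rule num_inc_le_rich[OF fin(2,1)])
  then have "num_inc P \<Lambda> inc \<le> num_inc P' \<Lambda> inc + card P"
    unfolding num_inc_dual[of \<Lambda> P inc] num_inc_dual[of \<Lambda> P' inc] .
  then have "real (num_inc P \<Lambda> inc) \<le> real (num_inc P' \<Lambda> inc + card P)" by (simp only: of_nat_le_iff)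
  then have 1: "real (num_inc P \<Lambda> inc) \<le> Y + n" unfolding Y_def using n by simp
  have "(c * m) * I \<le> real (card \<Lambda>) * I" using m(2) I(2) by (rule mult_right_mono)
  also have "\<dots> = (\<Sum>l\<in>\<Lambda>. I)" by simp
  also have "\<dots> \<le> (\<Sum>l\<in>\<Lambda>. 4 * m * real (card {p\<in>P. inc p l}))" by (intro sum_mono deg)
  also have "\<dots> = 4 * m * real (num_inc P \<Lambda> inc)" by (simp add: num_inc_lines[OF fin] sum_distrib_left)
  finally have "(c * I) * m \<le> (4 * real (num_inc P \<Lambda> inc)) * m" by (simp add: mult_ac)
  then have "c * I \<le> 4 * real (num_inc P \<Lambda> inc)" using m(3) by simp
  then have Y: "c * I / 8 \<le> Y" using 1 big(1) by linarith
  have "1 / (2 * 353) * n \<le> a \<or> sqrt (c ^ 3 * \<Delta> ^ 3 / (512 * 353 ^ 3)) * n \<le> a"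
    using szemeredi_trotter[OF plane_inc_subset[OF pi P'(1) subset_refl] P'(2) fin(2)]
  proof
    assume "real (num_inc P' \<Lambda> inc) \<le> 353 * (real (card P') + real (card \<Lambda>))"
    also have "\<dots> \<le> 353 * (a + m)" unfolding a_def using m(1) by simp
    finally have "c * I / 16 \<le> 353 * a" using Y big(2) unfolding Y_def by (simp add: algebra_simps)
    then have "1 / (2 * 353) * n \<le> a" using big(1) by simp
    then show ?thesis ..
  next
    assume "real (num_inc P' \<Lambda> inc) ^ 3 \<le> 353 ^ 3 * (real (card P'))\<^sup>2 * (real (card \<Lambda>))\<^sup>2"
    also have "\<dots> \<le> 353 ^ 3 * a\<^sup>2 * m\<^sup>2" unfolding a_def using m(1) by (intro mult_left_mono power_mono) auto
    finally have "Y ^ 3 \<le> 353 ^ 3 * a\<^sup>2 * m\<^sup>2" unfolding Y_def .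
    moreover have "(c * I / 8) ^ 3 \<le> Y ^ 3" using Y c I(2) by (intro power_mono) auto
    ultimately have "(c * I / 8) ^ 3 \<le> 353 ^ 3 * a\<^sup>2 * m\<^sup>2" by linarith
    then have "c ^ 3 * I ^ 3 \<le> 512 * 353 ^ 3 * a\<^sup>2 * m\<^sup>2" by (simp add: power_mult_distrib power_divide)
    moreover have "c ^ 3 * (\<Delta> ^ 3 * n\<^sup>2 * m\<^sup>2) \<le> c ^ 3 * I ^ 3" using I(1) c by (intro mult_left_mono) auto
    ultimately have "(c ^ 3 * \<Delta> ^ 3 * n\<^sup>2) * m\<^sup>2 \<le> (512 * 353 ^ 3 * a\<^sup>2) * m\<^sup>2" by (simp add: mult_ac)
    then have "c ^ 3 * \<Delta> ^ 3 * n\<^sup>2 \<le> 512 * 353 ^ 3 * a\<^sup>2" using m(3) by simp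
    then have le: "c ^ 3 * \<Delta> ^ 3 / (512 * 353 ^ 3) * n\<^sup>2 \<le> a\<^sup>2" by simp
    have "sqrt (c ^ 3 * \<Delta> ^ 3 / (512 * 353 ^ 3)) * n \<le> a"
    proof (rule power2_le_imp_le[OF _ a0])
      have "0 \<le> c ^ 3 * \<Delta> ^ 3 / (512 * 353 ^ 3)" using c \<Delta> by simp
      then show "(sqrt (c ^ 3 * \<Delta> ^ 3 / (512 * 353 ^ 3)) * n)\<^sup>2 \<le> a\<^sup>2"
        using le by (simp only: power_mult_distrib real_sqrt_pow2)
    qed
    then show ?thesis ..
  qed
  moreover have "min A B * n \<le> A * n" "min A B * n \<le> B * n" for A B
    using n(2) by (intro mult_right_mono; simp)+
  ultimately have "min (1 / (2 * 353)) (sqrt (c ^ 3 * \<Delta> ^ 3 / (512 * 353 ^ 3))) * n \<le> a"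
    by (meson order_trans)
  then show ?thesis unfolding a_def P'_def .
qed

theorem theorem1p3:
  fixes \<Delta> :: real
  assumes "\<Delta> > 0"
  shows "\<exists>C1 c :: real. \<exists>r :: nat. C1 \<ge> 1 \<and> c > 0 \<and>
    (\<forall>P L. finite P \<and> finite L \<and> (\<forall>l\<in>L. is_line l) \<and>
       real (card L) \<le> real (card P) ^ 2 / C1 \<and> real (card P) \<le> real (card L) ^ 2 / C1 \<and>
       real (card (incidences P L)) \<ge> \<Delta> * real (card P) powr (2/3) * real (card L) powr (2/3)
       \<longrightarrow> (\<exists>P' \<subseteq> P. real (card P') \<ge> c * real (card P) \<and> rigid_config r P' L))"
proof -
  obtain C1a ca \<rho>a :: real where A: "C1a \<ge> 1" "ca > 0" "\<rho>a > 0" and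
    Aex: "\<forall>(P :: (real \<times> real) set) (L :: (real \<times> real) set set) inc.
    plane_inc P L inc \<longrightarrow> finite P \<longrightarrow> finite L \<longrightarrow> P \<noteq> {} \<longrightarrow> card P \<le> card L \<longrightarrow>
    real (card L) \<le> (real (card P))\<^sup>2 / C1a \<longrightarrow> real (card P) \<le> (real (card L))\<^sup>2 / C1a \<longrightarrow>
    \<Delta> ^ 3 * (real (card P))\<^sup>2 * (real (card L))\<^sup>2 \<le> real (num_inc P L inc) ^ 3 \<longrightarrow>
    (\<exists>P0 L0 Q T \<kappa>. P0 \<subseteq> P \<and> L0 \<subseteq> L \<and> Q \<subseteq> P0 \<and> finite T \<and> triple_system L0 inc Q T \<and> 2 \<le> \<kappa> \<and>
      (\<forall>q\<in>Q. \<kappa> \<le> real (card {t\<in>T. q \<in> t})) \<and> real (card Q) \<le> \<rho>a * \<kappa> \<and>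
      ca * real (card P) \<le> real (card (inc_closure P0 L0 inc Q)) \<and>
      (\<forall>p\<in>P0. real (num_inc P L inc) \<le> 4 * real (card P) * real (card {l\<in>L. inc p l})))"
    using extremal_cluster[OF assms, where 'p = "real \<times> real" and 'l = "(real \<times> real) set"] by (elim exE conjE)
  \<comment> \<open>The same statement with the types of points and lines exchanged, for the dual
    configuration.\<close>
  obtain C1b cb \<rho>b :: real where B: "C1b \<ge> 1" "cb > 0" "\<rho>b > 0" and
    Bex: "\<forall>(P :: (real \<times> real) set set) (L :: (real \<times> real) set) inc.
    plane_inc P L inc \<longrightarrow> finite P \<longrightarrow> finite L \<longrightarrow> P \<noteq> {} \<longrightarrow> card P \<le> card L \<longrightarrow>
    real (card L) \<le> (real (card P))\<^sup>2 / C1b \<longrightarrow> real (card P) \<le> (real (card L))\<^sup>2 / C1b \<longrightarrow>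
    \<Delta> ^ 3 * (real (card P))\<^sup>2 * (real (card L))\<^sup>2 \<le> real (num_inc P L inc) ^ 3 \<longrightarrow>
    (\<exists>P0 L0 Q T \<kappa>. P0 \<subseteq> P \<and> L0 \<subseteq> L \<and> Q \<subseteq> P0 \<and> finite T \<and> triple_system L0 inc Q T \<and> 2 \<le> \<kappa> \<and>
      (\<forall>q\<in>Q. \<kappa> \<le> real (card {t\<in>T. q \<in> t})) \<and> real (card Q) \<le> \<rho>b * \<kappa> \<and>
      cb * real (card P) \<le> real (card (inc_closure P0 L0 inc Q)) \<and>
      (\<forall>p\<in>P0. real (num_inc P L inc) \<le> 4 * real (card P) * real (card {l\<in>L. inc p l})))"
    using extremal_cluster[OF assms, where 'p = "(real \<times> real) set" and 'l = "real \<times> real"] by (elim exE conjE)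
  \<comment> \<open>Together with C1 \<ge> (X / \<Delta>)^3 this gives I \<ge> X n and I \<ge> X m,
    which implies the two size conditions of \<open>rich_dual_points\<close>.\<close>
  define X where "X = 16 * 353 / cb"
  have X0: "X > 0" unfolding X_def using B by simp
  define C1 where "C1 = max C1a (max C1b ((X / \<Delta>) ^ 3))"
  have C1: "C1 \<ge> 1" "C1 \<ge> C1a" "C1 \<ge> C1b" "C1 \<ge> (X / \<Delta>) ^ 3" unfolding C1_def using A by auto
  define cd where "cd = min (1 / (2 * 353)) (sqrt (cb ^ 3 * \<Delta> ^ 3 / (512 * 353 ^ 3)))"
  have cd0: "cd > 0" unfolding cd_def using B assms by simp
  define c where "c = min ca cd"
  have c0: "c > 0" unfolding c_def using A cd0 by simp
  define r where "r = nat \<lceil>100 * \<rho>a\<^sup>2\<rceil> + nat \<lceil>100 * \<rho>b\<^sup>2\<rceil>"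
  have ra: "k \<le> r" if "real k \<le> 100 * \<rho>a\<^sup>2" for k using that unfolding r_def by linarith
  have rb: "k \<le> r" if "real k \<le> 100 * \<rho>b\<^sup>2" for k using that unfolding r_def by linarith
  have main: "\<exists>P' \<subseteq> P. real (card P') \<ge> c * real (card P) \<and> rigid_config r P' L"
    if fin: "finite P" "finite L" and lines: "\<forall>l\<in>L. is_line l"
      and L1: "real (card L) \<le> real (card P) ^ 2 / C1" and P1: "real (card P) \<le> real (card L) ^ 2 / C1"
      and I1: "real (card (incidences P L)) \<ge> \<Delta> * real (card P) powr (2/3) * real (card L) powr (2/3)" for P L
  proof (cases "P = {}")
    case True
    have "rigid_config r {} L"
    proof (rule rigid_config_criterion)
      show "finite ({} :: (real \<times> real) set)" by simp
      show "is_line l" if "l \<in> L" for l using lines that by blast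
      fix x v k
      assume indep: "\<And>c. (\<And>s. s \<in> {} \<Longrightarrow> lin_comb c k v s = (0 :: complex \<times> complex)) \<Longrightarrow> (\<forall>j<k. c j = 0)"
      \<comment> \<open>Over no points at all every combination is 0, including the one with all
        coefficients 1, so independence forces k = 0.\<close>
      have "\<forall>j<k. (1 :: complex) = 0" by (rule indep) simp
      then show "k \<le> r" by (cases k) auto
    qed
    then show ?thesis using True by auto
  next
    case False
    have pi: "plane_inc P L (\<in>)" by (rule plane_inc_lines[OF fin(2)]) (use lines in blast)
    define n m I where "n = real (card P)" and "m = real (card L)" and "I = real (num_inc P L (\<in>))"
    have n0: "n > 0" unfolding n_def using False fin by (simp add: card_gt_0_iff)
    have m0: "m > 0"
    proof (rule ccontr)
      assume "\<not> m > 0"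
      then have "m = 0" unfolding m_def by simp
      then show False using P1 n0 unfolding n_def m_def by simp
    qed
    have II: "real (card (incidences P L)) = I" unfolding I_def num_inc_def incidences_def ..
    have I0: "I \<ge> 0" unfolding I_def by simp
    \<comment> \<open>The hypothesis is cubed once; from here on the estimates are free of
      fractional powers.\<close>
    have I3: "\<Delta> ^ 3 * n\<^sup>2 * m\<^sup>2 \<le> I ^ 3"
    proof -
      have "(\<Delta> * n powr (2/3) * m powr (2/3)) ^ 3 \<le> I ^ 3"
        using I1 assms unfolding II n_def m_def by (intro power_mono) auto
      then show ?thesis unfolding power_mult_distrib cube_powr_two_thirds[OF n0] cube_powr_two_thirds[OF m0] .
    qed
    have weaken: "x \<le> y / C" if "x \<le> y / C1" "C \<le> C1" "C \<ge> 1" "y \<ge> 0" for x y C :: real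
    proof -
      have "y / C1 \<le> y / C" using that by (intro divide_left_mono) auto
      then show ?thesis using that by linarith
    qed
    show ?thesis
    proof (cases "card P \<le> card L")
      case True
      obtain P0 L0 Q T \<kappa> where h: "P0 \<subseteq> P" "L0 \<subseteq> L" "Q \<subseteq> P0" "finite T" "triple_system L0 (\<in>) Q T" "2 \<le> \<kappa>"
        "\<forall>q\<in>Q. \<kappa> \<le> real (card {t\<in>T. q \<in> t})" "real (card Q) \<le> \<rho>a * \<kappa>"
        "ca * real (card P) \<le> real (card (inc_closure P0 L0 (\<in>) Q))"
        using Aex[rule_format, OF pi fin False True weaken[OF L1 C1(2) A(1)] weaken[OF P1 C1(2) A(1)]
          I3[unfolded n_def m_def I_def]] by auto
      define P' where "P' = inc_closure P0 L0 (\<in>) Q"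
      have P': "P' \<subseteq> P" unfolding P'_def using inc_closure_subset[of P0 L0 "(\<in>)" Q] h(1) by (rule subset_trans)
      have "rigid_config r P' L"
      proof (rule rigid_config_criterion)
        show "finite P'" by (rule finite_subset[OF P' fin(1)])
        show "is_line l" if "l \<in> L" for l using lines that by blast
        fix x v k
        assume a: "nondeg P' x" "realizes P' L x" "\<And>j. j < k \<Longrightarrow> flexes P' L x (v j)"
          "\<And>c. (\<And>s. s \<in> P' \<Longrightarrow> lin_comb c k v s = 0) \<Longrightarrow> (\<forall>j<k. c j = 0)"
        interpret flex_config P' L x by unfold_locales (use lines a in auto)
        show "k \<le> r"
        proof (rule ra, rule primal_rank[where Q = Q and T = T and \<kappa> = \<kappa>])
          show "P' = inc_closure P0 L0 (\<in>) Q" by (rule P'_def)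
          show "L0 \<subseteq> L" "Q \<subseteq> P0" "triple_system L0 (\<in>) Q T" by (rule h(2,3,5))+
          show "finite Q" by (rule finite_subset[OF subset_trans[OF h(3,1)] fin(1)])
          show "2 \<le> \<kappa>" by (rule h(6))
          show "\<kappa> \<le> real (card {t\<in>T. q \<in> t})" if "q \<in> Q" for q by (rule bspec[OF h(7) that])
          show "real (card Q) \<le> \<rho>a * \<kappa>" by (rule h(8))
          show "flexes P' L x (v j)" if "j < k" for j by (rule a(3)[OF that])
          show "\<forall>j<k. c j = 0" if "\<And>s. s \<in> P' \<Longrightarrow> lin_comb c k v s = 0" for c by (rule a(4)[OF that])
        qed
      qed
      moreover have "c * real (card P) \<le> real (card P')"
      proof -
        have "c * real (card P) \<le> ca * real (card P)" unfolding c_def by (intro mult_right_mono) auto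
        then show ?thesis using h(9) unfolding P'_def by linarith
      qed
      ultimately show ?thesis using P' by blast
    next
      case nle: False
      have Lne: "L \<noteq> {}" using m0 unfolding m_def by auto
      have le: "card L \<le> card P" using nle by simp
      have I3': "\<Delta> ^ 3 * (real (card L))\<^sup>2 * (real (card P))\<^sup>2 \<le> real (num_inc L P (\<lambda>l p. p \<in> l)) ^ 3"
        unfolding num_inc_dual[of L P "(\<in>)"] using I3 unfolding n_def m_def I_def by (simp add: mult_ac)
      obtain L0 P0 Q T \<kappa> where h: "L0 \<subseteq> L" "P0 \<subseteq> P" "Q \<subseteq> L0" "finite T" "triple_system P0 (\<lambda>l p. p \<in> l) Q T" "2 \<le> \<kappa>"
        "\<forall>q\<in>Q. \<kappa> \<le> real (card {t\<in>T. q \<in> t})" "real (card Q) \<le> \<rho>b * \<kappa>"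
        "cb * real (card L) \<le> real (card (inc_closure L0 P0 (\<lambda>l p. p \<in> l) Q))"
        "\<forall>l\<in>L0. real (num_inc L P (\<lambda>l p. p \<in> l)) \<le> 4 * real (card L) * real (card {p\<in>P. p \<in> l})"
        using Bex[rule_format, OF plane_inc_dual[OF pi] fin(2,1) Lne le weaken[OF P1 C1(3) B(1)] weaken[OF L1 C1(3) B(1)] I3']
        by auto
      define \<Lambda> where "\<Lambda> = inc_closure L0 P0 (\<lambda>l p. p \<in> l) Q"
      have \<Lambda>0: "\<Lambda> \<subseteq> L0" unfolding \<Lambda>_def by (rule inc_closure_subset)
      have \<Lambda>: "\<Lambda> \<subseteq> L" by (rule subset_trans[OF \<Lambda>0 h(1)])
      have fin\<Lambda>: "finite \<Lambda>" by (rule finite_subset[OF \<Lambda> fin(2)])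
      \<comment> \<open>Two lines through each point are required because the motion of a point is
        recovered from the normal displacements of two lines containing it.\<close>
      define P' where "P' = {p\<in>P. \<exists>l\<in>\<Lambda>. \<exists>l'\<in>\<Lambda>. l \<noteq> l' \<and> p \<in> l \<and> p \<in> l'}"
      have P': "P' \<subseteq> P" unfolding P'_def by blast
      have "rigid_config r P' L"
      proof (rule rigid_config_criterion)
        show "finite P'" by (rule finite_subset[OF P' fin(1)])
        show "is_line l" if "l \<in> L" for l using lines that by blast
        fix x v k
        assume a: "nondeg P' x" "realizes P' L x" "\<And>j. j < k \<Longrightarrow> flexes P' L x (v j)"
          "\<And>c. (\<And>s. s \<in> P' \<Longrightarrow> lin_comb c k v s = 0) \<Longrightarrow> (\<forall>j<k. c j = 0)"
        interpret flex_config P' L x by unfold_locales (use lines a in auto)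
        show "k \<le> r"
        proof (rule rb, rule dual_rank[where Q = Q and T = T and \<kappa> = \<kappa> and PP = P])
          show "\<Lambda> = inc_closure L0 P0 (\<lambda>l p. p \<in> l) Q" by (rule \<Lambda>_def)
          show "P' = {p\<in>P. \<exists>l\<in>\<Lambda>. \<exists>l'\<in>\<Lambda>. l \<noteq> l' \<and> p \<in> l \<and> p \<in> l'}" by (rule P'_def)
          show "L0 \<subseteq> L" "P0 \<subseteq> P" "Q \<subseteq> L0" "finite T" "triple_system P0 (\<lambda>l p. p \<in> l) Q T" by (rule h(1-5))+
          show "finite Q" by (rule finite_subset[OF subset_trans[OF h(3,1)] fin(2)])
          show "2 \<le> \<kappa>" by (rule h(6))
          show "\<kappa> \<le> real (card {t\<in>T. q \<in> t})" if "q \<in> Q" for q by (rule bspec[OF h(7) that])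
          show "real (card Q) \<le> \<rho>b * \<kappa>" by (rule h(8))
          show "flexes P' L x (v j)" if "j < k" for j by (rule a(3)[OF that])
          show "\<forall>j<k. c j = 0" if "\<And>s. s \<in> P' \<Longrightarrow> lin_comb c k v s = 0" for c by (rule a(4)[OF that])
        qed
      qed
      moreover have "c * real (card P) \<le> real (card P')"
      proof -
        have C1X: "X ^ 3 \<le> \<Delta> ^ 3 * C1" using C1(4) assms by (simp add: power_divide field_simps)
        \<comment> \<open>Used with (y, z) equal to (n, m) and to (m, n): (X y)^3 \<le> \<Delta>^3
          y^2 (C1 y) \<le> \<Delta>^3 y^2 z^2 \<le> I^3.\<close>
        have large: "X * y \<le> I" if yz: "{y, z} = {n, m}" "C1 * y \<le> z\<^sup>2" for y z
        proof (rule power_le_imp_le_base[of _ 2])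
          have y0: "y > 0" and prod: "n\<^sup>2 * m\<^sup>2 = y\<^sup>2 * z\<^sup>2" using yz(1) n0 m0 by (auto simp: doubleton_eq_iff)
          have "(X * y) ^ 3 = X ^ 3 * (y\<^sup>2 * y)" by (simp add: power_mult_distrib power2_eq_square power3_eq_cube)
          also have "\<dots> \<le> (\<Delta> ^ 3 * C1) * (y\<^sup>2 * y)" using C1X y0 by (intro mult_right_mono) auto
          also have "\<dots> = \<Delta> ^ 3 * y\<^sup>2 * (C1 * y)" by (simp add: mult_ac)
          also have "\<dots> \<le> \<Delta> ^ 3 * y\<^sup>2 * z\<^sup>2" using yz(2) assms by (intro mult_left_mono) auto
          also have "\<dots> \<le> I ^ 3" using I3 prod by (simp add: mult.assoc)
          finally show "(X * y) ^ Suc 2 \<le> I ^ Suc 2" by (simp add: eval_nat_numeral)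
        qed (rule I0)
        have Xn: "X * n \<le> I" by (rule large[of n m]) (use P1 C1(1) in \<open>auto simp: n_def m_def field_simps\<close>)
        have Xm: "X * m \<le> I" by (rule large[of m n]) (use L1 C1(1) in \<open>auto simp: n_def m_def field_simps\<close>)
        have cbX: "cb * X = 16 * 353" unfolding X_def using B by simp
        have b1: "8 * n \<le> cb * I"
        proof -
          have "cb * (X * n) \<le> cb * I" using Xn B by (intro mult_left_mono) auto
          then show ?thesis using cbX n0 by (simp add: mult.assoc[symmetric])
        qed
        have b2: "16 * 353 * m \<le> cb * I"
        proof -
          have "cb * (X * m) \<le> cb * I" using Xm B by (intro mult_left_mono) auto
          then show ?thesis using cbX by (simp add: mult.assoc[symmetric])
        qed
        have "cd * n \<le> real (card P')"
          unfolding cd_def P'_def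
        proof (rule rich_dual_points[where m = m and I = I])
          show "plane_inc P \<Lambda> (\<in>)" by (rule plane_inc_subset[OF pi subset_refl \<Lambda>])
          show "real (card \<Lambda>) \<le> m" unfolding m_def using \<Lambda> fin(2) by (simp add: card_mono)
          show "cb * m \<le> real (card \<Lambda>)" using h(9) unfolding m_def \<Lambda>_def .
          show "I \<le> 4 * m * real (card {p\<in>P. p \<in> l})" if "l \<in> \<Lambda>" for l
            using h(10) \<Lambda>0 that unfolding num_inc_dual[of L P "(\<in>)"] I_def m_def by blast
        qed (use fin fin\<Lambda> n0 m0 B assms I3 I0 b1 b2 in \<open>auto simp: n_def\<close>)
        moreover have "c * n \<le> cd * n" unfolding c_def using n0 by (intro mult_right_mono) auto
        ultimately show ?thesis unfolding n_def by linarith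
      qed
      ultimately show ?thesis using P' by blast
    qed
  qed
  show ?thesis
    by (rule exI[of _ C1], rule exI[of _ c], rule exI[of _ r], intro conjI allI impI C1(1) c0, elim conjE, rule main)
qed

end
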